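(* There exist $p_0>0$ and $\beta_0<\infty$ such that for all $\beta\ge\beta_0$ and all $p\in[0,p_0)$ the following holds. Let $(n_i)_{i\in\mathbb{Z}}$ be independent identically distributed Bernoulli variables with values in $\{0,1\}$ and $\mathrm{Prob}(n_i=1)=p$. Then for almost every realization of $(n_i)_{i\in\mathbb{Z}}$, the measure $\nu_\beta^{+,(n_i)}$, i.e. the restriction of the plus phase $\mu_\beta^+$ of the two-dimensional Ising model to the sites $\{(i,0): i\in\mathbb{Z},\ n_i=1\}$, is a (bona fide) Gibbs measure.
   Context: Ising model on $\mathbb{Z}^2$ at zero magnetic field: for finite $\Lambda\subset\mathbb{Z}^2$, $\mu^+_{\Lambda,\beta}$ is the probability measure on $\{+1,-1\}^{\Lambda}$ with weights proportional to $\exp[\beta\sum_{\langle xy\rangle:\{x,y\}\cap\Lambda\neq\emptyset}(\sigma_x\sigma_y-1)]$, the sum being over nearest neighbour pairs, with $\sigma_y=+1$ for $y\notin\Lambda$. The plus phase is the weak limit $\mu_\beta^+=\lim_{\Lambda\uparrow\mathbb{Z}^2}\mu^+_{\Lambda,\beta}$. Write $(X(x))_{x\in\mathbb{Z}^2}$ for the random field with law $\mu_\beta^+$. Given $(n_i)$, let $S=\{i\in\mathbb{Z}:n_i=1\}$; $\nu_\beta^{+,(n_i)}$ is the law on $\{+1,-1\}^S$ of $(X((i,0)))_{i\in S}$. Gibbs measures on $\{+1,-1\}^S$ ($S$ countable): a potential is a family of real-valued functions $U(A,\cdot)$ on $\{+1,-1\}^S$, indexed by the finite subsets $A\subset S$,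 with $U(\emptyset,\cdot)=0$ and $U(A,\sigma)$ depending only on $(\sigma(i))_{i\in A}$. It is uniformly absolutely convergent if $\sum_{A\cap V\neq\emptyset}\sup_{\omega}|U(A,\omega)|<\infty$ for every finite $V\subset S$. A probability measure $\nu$ on $\{+1,-1\}^S$ is a (bona fide) Gibbs measure if there is a uniformly absolutely convergent potential $U$ such that for every finite $V\subset S$ and $\nu$-almost every $\omega$, the conditional $\nu$-probability of $\sigma_V\in\{+1,-1\}^V$ given $\omega_{V^c}$ equals $\frac{1}{Z_V(\omega)}\exp\{-\sum_{A\cap V\neq\emptyset}U(A,\sigma_V\omega_{V^c})\}$. Here $V^c=S\setminus V$, $\sigma_V\omega_{V^c}$ is the configuration equal to $\sigma$ on $V$ and to $\omega$ on $V^c$, and $Z_V(\omega)$ is the normalization. *)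

theory Defs
  imports "HOL-Probability.Probability"
begin

type_synonym site = "int \<times> int"

abbreviation spins :: "real set" where
  "spins \<equiv> {1, -1}"

abbreviation configs :: "'a set \<Rightarrow> ('a \<Rightarrow> real) set" where
  "configs S \<equiv> S \<rightarrow>\<^sub>E spins"

definition config_space :: "'a set \<Rightarrow> ('a \<Rightarrow> real) measure" where
  "config_space S = Pi\<^sub>M S (\<lambda>_. count_space spins)"

definition config_topology :: "'a set \<Rightarrow> ('a \<Rightarrow> real) topology" where
  "config_topology S = product_topology (\<lambda>_. discrete_topology spins) S"


section \<open>The Ising model on the square lattice\<close>

definition nearest_neighbours :: "site \<Rightarrow> site \<Rightarrow> bool" where
  "nearest_neighbours x y \<longleftrightarrow> \<bar>fst x - fst y\<bar> + \<bar>snd x - snd y\<bar> = 1"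

text \<open>Bonds are unordered pairs, so each one contributes a single term to the energy.\<close>

definition bonds_touching :: "site set \<Rightarrow> site set set" where
  "bonds_touching \<Lambda> = {{x, y} | x y. nearest_neighbours x y \<and> {x, y} \<inter> \<Lambda> \<noteq> {}}"

definition plus_extension :: "site set \<Rightarrow> (site \<Rightarrow> real) \<Rightarrow> site \<Rightarrow> real" where
  "plus_extension \<Lambda> \<sigma> = (\<lambda>x. if x \<in> \<Lambda> then \<sigma> x else 1)"

definition plus_weight :: "real \<Rightarrow> site set \<Rightarrow> (site \<Rightarrow> real) \<Rightarrow> real" where
  "plus_weight \<beta> \<Lambda> \<sigma> =
     exp (\<beta> * (\<Sum>b\<in>bonds_touching \<Lambda>. (\<Prod>x\<in>b. plus_extension \<Lambda> \<sigma> x) - 1))"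

definition ising_plus :: "real \<Rightarrow> site set \<Rightarrow> (site \<Rightarrow> real) measure" where
  "ising_plus \<beta> \<Lambda> = point_measure (configs \<Lambda>)
     (\<lambda>\<sigma>. ennreal (plus_weight \<beta> \<Lambda> \<sigma> / (\<Sum>\<tau>\<in>configs \<Lambda>. plus_weight \<beta> \<Lambda> \<tau>)))"

text \<open>
  Weak convergence along the net of all finite volumes ordered by inclusion. The finite-volume
  measures are viewed on the full configuration space by setting all spins outside the volume to
  plus one. Continuous functions are bounded, as the configuration space is compact.
\<close>

definition is_plus_limit :: "real \<Rightarrow> (site \<Rightarrow> real) measure \<Rightarrow> bool" where
  "is_plus_limit \<beta> \<mu> \<longleftrightarrow>
     prob_space \<mu> \<and> sets \<mu> = sets (config_space UNIV) \<and>
     (\<forall>f. continuous_map (config_topology UNIV) euclideanreal f \<longrightarrow>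
        ((\<lambda>\<Lambda>. \<integral>\<sigma>. f \<sigma> \<partial>distr (ising_plus \<beta> \<Lambda>) (config_space UNIV) (plus_extension \<Lambda>))
           \<longlongrightarrow> (\<integral>\<sigma>. f \<sigma> \<partial>\<mu>)) (finite_subsets_at_top UNIV))"

definition plus_phase :: "real \<Rightarrow> (site \<Rightarrow> real) measure" where
  "plus_phase \<beta> = (THE \<mu>. is_plus_limit \<beta> \<mu>)"

definition occupied :: "(int \<Rightarrow> nat) \<Rightarrow> int set" where
  "occupied n = {i. n i = 1}"

definition decimated_plus_phase :: "real \<Rightarrow> (int \<Rightarrow> nat) \<Rightarrow> (int \<Rightarrow> real) measure" where
  "decimated_plus_phase \<beta> n =
     distr (plus_phase \<beta>) (config_space (occupied n)) (\<lambda>\<sigma>. \<lambda>i\<in>occupied n. \<sigma> (i, 0))"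


section \<open>Gibbs measures\<close>

text \<open>
  In what follows \<open>U A\<close> is only ever inspected for finite subsets \<open>A\<close> of \<open>S\<close>, and only
  on configurations on \<open>S\<close>.
\<close>

definition is_potential :: "'a set \<Rightarrow> ('a set \<Rightarrow> ('a \<Rightarrow> real) \<Rightarrow> real) \<Rightarrow> bool" where
  "is_potential S U \<longleftrightarrow>
     (\<forall>\<sigma>\<in>configs S. U {} \<sigma> = 0) \<and>
     (\<forall>A. finite A \<and> A \<subseteq> S \<longrightarrow>
        (\<forall>\<sigma>\<in>configs S. \<forall>\<tau>\<in>configs S. (\<forall>i\<in>A. \<sigma> i = \<tau> i) \<longrightarrow> U A \<sigma> = U A \<tau>))"

definition finite_sets_meeting :: "'a set \<Rightarrow> 'a set \<Rightarrow> 'a set set" where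
  "finite_sets_meeting S V = {A. finite A \<and> A \<subseteq> S \<and> A \<inter> V \<noteq> {}}"

text \<open>
  The supremum below is a genuine one: for a potential, each \<open>U A\<close> takes only finitely many values.
\<close>

definition uniformly_absolutely_convergent ::
    "'a set \<Rightarrow> ('a set \<Rightarrow> ('a \<Rightarrow> real) \<Rightarrow> real) \<Rightarrow> bool" where
  "uniformly_absolutely_convergent S U \<longleftrightarrow>
     (\<forall>V. finite V \<and> V \<subseteq> S \<longrightarrow>
        (\<lambda>A. SUP \<omega>\<in>configs S. \<bar>U A \<omega>\<bar>) summable_on finite_sets_meeting S V)"

definition boltzmann_factor ::
    "'a set \<Rightarrow> ('a set \<Rightarrow> ('a \<Rightarrow> real) \<Rightarrow> real) \<Rightarrow> 'a set \<Rightarrow> ('a \<Rightarrow> real) \<Rightarrow> ('a \<Rightarrow> real) \<Rightarrow> real" where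
  "boltzmann_factor S U V \<sigma> \<omega> =
     exp (- (\<Sum>\<^sub>\<infinity>A\<in>finite_sets_meeting S V. U A (merge V (S - V) (\<sigma>, \<omega>))))"

definition outside_algebra :: "'a set \<Rightarrow> 'a set \<Rightarrow> ('a \<Rightarrow> real) measure" where
  "outside_algebra S V =
     vimage_algebra (configs S) (\<lambda>\<omega>. restrict \<omega> (S - V)) (config_space (S - V))"

definition is_gibbs_measure :: "'a set \<Rightarrow> ('a \<Rightarrow> real) measure \<Rightarrow> bool" where
  "is_gibbs_measure S \<nu> \<longleftrightarrow>
     prob_space \<nu> \<and> sets \<nu> = sets (config_space S) \<and>
     (\<exists>U. is_potential S U \<and> uniformly_absolutely_convergent S U \<and>
        (\<forall>V. finite V \<and> V \<subseteq> S \<longrightarrow>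
           (AE \<omega> in \<nu>. \<forall>\<sigma>\<in>configs V.
              real_cond_exp \<nu> (outside_algebra S V)
                  (indicator {\<eta> \<in> configs S. restrict \<eta> V = \<sigma>}) \<omega> =
                boltzmann_factor S U V \<sigma> \<omega> /
                  (\<Sum>\<tau>\<in>configs V. boltzmann_factor S U V \<tau> \<omega>))))"


section \<open>The random set of sites\<close>

text \<open>The joint law of i.i.d. variables \<open>n i\<close>, taking the value 1 with probability \<open>p\<close> and else 0.\<close>

definition iid_bernoulli :: "real \<Rightarrow> (int \<Rightarrow> nat) measure" where
  "iid_bernoulli p = Pi\<^sub>M UNIV (\<lambda>_. measure_pmf (map_pmf of_bool (bernoulli_pmf p)))"

end

theory Submission imports Defs begin

text \<open>
  Fix the set \<open>S\<close> of occupied sites, and condition the plus phase on the spins of a finite part of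
  \<open>S\<close>. What remains is an Ising model with frozen spins. The claim is that the influence of far away
  frozen spins on the spin at a given site \<open>j\<close> vanishes uniformly in the values of the frozen spins.

  The reason is energetic. Let a cluster of minus spins surround \<open>j\<close> and reach far away, and let \<open>I\<close> be the
  interval of columns that it meets. Its outer contour has at least \<open>\<bar>I\<bar>\<close> bonds. Flipping everything
  inside except the frozen spins gains the contour and loses at most a bounded multiple of the number of
  frozen spins inside, which is at most \<open>\<bar>S \<inter> I\<bar>\<close>, all frozen spins being on one line. If \<open>S\<close> has
  low density in all long intervals around \<open>j\<close>, then the gain wins, even if all frozen spins are minus,
  and Peierls' argument (\<open>peierls_estimate\<close>) makes such clusters improbable at low temperature. Short
  intervals do no harm, since a cluster that is narrow and far-reaching has a long contour anyway. The
  density condition is a large deviation event, and Borel--Cantelli gives it for all \<open>j\<close> at once, almost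
  surely (\<open>almost_surely_sparse\<close>), for a density \<open>p\<close> that does not depend on the temperature.

  If no minus path joins \<open>j\<close> to the outside of a big box, then \<open>j\<close> lies in a region with plus boundary
  condition, in which the model depends on the frozen spins inside the box only. By the FKG inequality
  (deduced from the four functions theorem) the plus boundary condition is the one with the fewest minus
  spins, so the two conditional probabilities of a minus spin at \<open>j\<close>, for frozen spins agreeing in the
  box, are within the Peierls probability of each other (\<open>local_comparison\<close>). This estimate is uniform
  in the volume and passes to the plus phase. The latter is constructed from the monotone limits of local
  probabilities by Kolmogorov's extension theorem (\<open>plus_phase_properties\<close>).

  Quasilocality and positivity of the conditional probabilities then yield the Gibbs property by an argument of
  Kozlov (\<open>quasilocal_implies_gibbs\<close>). The sites are enumerated and the spins are changed to plus one
  after another in this order. The energy of the \<open>n\<close>-th change does not see the sites before the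
  \<open>n\<close>-th, so its expansion into local terms only uses sets of sites whose first element is the
  \<open>n\<close>-th site. Hence a finite set of sites meets sets coming from finitely many changes only, and each of
  the expansions can be made to converge absolutely by a suitable grouping of terms, for which uniform
  convergence alone suffices.
\<close>


section \<open>Contours on the square lattice\<close>

definition bdry :: "site set \<Rightarrow> site set set" where
  "bdry M = {{x, y} | x y. nearest_neighbours x y \<and> x \<in> M \<and> y \<notin> M}"

definition hbond :: "int \<Rightarrow> int \<Rightarrow> site set" where "hbond a b = {(a, b), (a + 1, b)}"
definition vbond :: "int \<Rightarrow> int \<Rightarrow> site set" where "vbond a b = {(a, b), (a, b + 1)}"

definition plaquette :: "int \<Rightarrow> int \<Rightarrow> site set set" where
  "plaquette a b = {hbond a b, hbond a (b + 1), vbond a b, vbond (a + 1) b}"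

text \<open>
  In terms of the dual lattice, the edges crossing the two bonds share an end.
\<close>

definition plaquette_adj :: "site set \<Rightarrow> site set \<Rightarrow> bool" where
  "plaquette_adj e e' \<longleftrightarrow> (\<exists>a b. e \<in> plaquette a b \<and> e' \<in> plaquette a b)"

text \<open>
  The points from which the ray to the right crosses \<open>E\<close> an odd number of times. If \<open>E\<close> is a closed
  contour, these are the points that it encloses.
\<close>

definition contour_interior :: "site set set \<Rightarrow> site set" where
  "contour_interior E = {(a, b). odd (card {i. a \<le> i \<and> hbond i b \<in> E})}"

lemma nearest_neighbours_sym: "nearest_neighbours x y \<longleftrightarrow> nearest_neighbours y x"
  by (auto simp: nearest_neighbours_def)

lemma nearest_neighbours_cases:
  assumes "nearest_neighbours x y"
  obtains a b where "x = (a, b)" "y = (a + 1, b)" | a b where "x = (a + 1, b)" "y = (a, b)"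
    | a b where "x = (a, b)" "y = (a, b + 1)" | a b where "x = (a, b + 1)" "y = (a, b)"
proof -
  obtain a b c d where xy: "x = (a, b)" "y = (c, d)" by (cases x, cases y)
  with assms have "\<bar>a - c\<bar> + \<bar>b - d\<bar> = 1" by (simp add: nearest_neighbours_def)
  then consider "c = a + 1" "d = b" | "a = c + 1" "d = b" | "d = b + 1" "c = a" | "b = d + 1" "c = a"
    by linarith
  then show thesis using xy that by cases auto
qed

lemma hbond_eq_iff [simp]: "hbond a b = hbond a' b' \<longleftrightarrow> a = a' \<and> b = b'"
  by (auto simp: hbond_def doubleton_eq_iff)

lemma vbond_eq_iff [simp]: "vbond a b = vbond a' b' \<longleftrightarrow> a = a' \<and> b = b'"
  by (auto simp: vbond_def doubleton_eq_iff)

lemma hbond_neq_vbond [simp]: "hbond a b \<noteq> vbond a' b'" "vbond a' b' \<noteq> hbond a b"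
  by (auto simp: vbond_def hbond_def doubleton_eq_iff)

lemma pair_in_bdry_iff:
  assumes "nearest_neighbours x y"
  shows "{x, y} \<in> bdry M \<longleftrightarrow> (x \<in> M) \<noteq> (y \<in> M)"
proof
  assume "{x, y} \<in> bdry M"
  then show "(x \<in> M) \<noteq> (y \<in> M)" by (auto simp: bdry_def doubleton_eq_iff)
next
  assume "(x \<in> M) \<noteq> (y \<in> M)"
  then consider "x \<in> M" "y \<notin> M" | "y \<in> M" "x \<notin> M" by blast
  then show "{x, y} \<in> bdry M"
  proof cases
    case 1
    then show ?thesis using assms unfolding bdry_def by blast
  next
    case 2
    then have "{y, x} \<in> bdry M"
      using assms nearest_neighbours_sym[of x y] unfolding bdry_def by blast
    then show ?thesis by (simp add: insert_commute)
  qed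
qed

lemma hbond_in_bdry_iff: "hbond a b \<in> bdry M \<longleftrightarrow> ((a, b) \<in> M) \<noteq> ((a + 1, b) \<in> M)"
  unfolding hbond_def by (rule pair_in_bdry_iff) (simp add: nearest_neighbours_def)

lemma vbond_in_bdry_iff: "vbond a b \<in> bdry M \<longleftrightarrow> ((a, b) \<in> M) \<noteq> ((a, b + 1) \<in> M)"
  unfolding vbond_def by (rule pair_in_bdry_iff) (simp add: nearest_neighbours_def)

lemma pair_is_bond:
  assumes "nearest_neighbours x y"
  shows "{x, y} \<in> (range (case_prod hbond)) \<union> (range (case_prod vbond))"
  using assms by (cases rule: nearest_neighbours_cases)
    (auto simp: hbond_def vbond_def insert_commute image_iff)

lemma bdry_subset_bonds: "bdry M \<subseteq> range (case_prod hbond) \<union> range (case_prod vbond)"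
  using pair_is_bond unfolding bdry_def by blast

lemma bdry_eqI:
  assumes "\<And>a b. hbond a b \<in> E \<longleftrightarrow> ((a, b) \<in> H) \<noteq> ((a + 1, b) \<in> H)"
    and "\<And>a b. vbond a b \<in> E \<longleftrightarrow> ((a, b) \<in> H) \<noteq> ((a, b + 1) \<in> H)"
    and "E \<subseteq> range (case_prod hbond) \<union> range (case_prod vbond)"
  shows "bdry H = E"
proof (rule set_eqI)
  fix e
  show "e \<in> bdry H \<longleftrightarrow> e \<in> E"
    using assms bdry_subset_bonds[of H] hbond_in_bdry_iff[of _ _ H] vbond_in_bdry_iff[of _ _ H]
    by (cases "e \<in> range (case_prod hbond) \<union> range (case_prod vbond)") auto
qed

lemma finite_bonds_touching:
  assumes "finite \<Lambda>" shows "finite (bonds_touching \<Lambda>)" "card (bonds_touching \<Lambda>) \<le> 4 * card \<Lambda>"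
proof -
  let ?f = "\<lambda>(x :: site). {hbond (fst x) (snd x), hbond (fst x - 1) (snd x),
      vbond (fst x) (snd x), vbond (fst x) (snd x - 1)}"
  have sub: "bonds_touching \<Lambda> \<subseteq> (\<Union>x\<in>\<Lambda>. ?f x)"
  proof
    fix e assume "e \<in> bonds_touching \<Lambda>"
    then obtain x y where xy: "e = {x, y}" "nearest_neighbours x y" "x \<in> \<Lambda>"
    proof -
      from \<open>e \<in> bonds_touching \<Lambda>\<close> obtain u v
        where uv: "e = {u, v}" "nearest_neighbours u v" "u \<in> \<Lambda> \<or> v \<in> \<Lambda>"
        unfolding bonds_touching_def by blast
      then show thesis
        using that[of u v] that[of v u] nearest_neighbours_sym[of u v] by (auto simp: insert_commute)
    qed
    from xy(2) have "e \<in> ?f x"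
      by (cases rule: nearest_neighbours_cases)
        (use xy(1) in \<open>auto simp: hbond_def vbond_def insert_commute\<close>)
    then show "e \<in> (\<Union>x\<in>\<Lambda>. ?f x)" using xy(3) by blast
  qed
  show "finite (bonds_touching \<Lambda>)" by (rule finite_subset[OF sub]) (use assms in auto)
  have "card (bonds_touching \<Lambda>) \<le> card (\<Union>x\<in>\<Lambda>. ?f x)"
    by (rule card_mono[OF _ sub]) (use assms in auto)
  also have "\<dots> \<le> (\<Sum>x\<in>\<Lambda>. card (?f x))" by (rule card_UN_le[OF assms])
  also have "\<dots> \<le> (\<Sum>x\<in>\<Lambda>. 4)"
    by (rule sum_mono) (auto intro!: order_trans[OF card_insert_le_m1])
  finally show "card (bonds_touching \<Lambda>) \<le> 4 * card \<Lambda>" by simp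
qed

lemma bdry_subset_touching: "bdry M \<subseteq> bonds_touching M"
  unfolding bdry_def bonds_touching_def by blast

lemma finite_bdry: "finite M \<Longrightarrow> finite (bdry M)"
  by (rule finite_subset[OF bdry_subset_touching finite_bonds_touching(1)])

lemma finite_site_set_bounded:
  fixes Z :: "site set"
  assumes "finite Z" shows "\<exists>K. \<forall>z\<in>Z. \<bar>fst z\<bar> < K \<and> \<bar>snd z\<bar> < K"
  using assms
proof (induction Z)
  case (insert z Z)
  then obtain K where "\<forall>z\<in>Z. \<bar>fst z\<bar> < K \<and> \<bar>snd z\<bar> < K" by blast
  then show ?case by (intro exI[of _ "max K (max \<bar>fst z\<bar> \<bar>snd z\<bar> + 1)"]) fastforce
qed simp

text \<open>
  The discrete Poincare lemma modulo 2: an edge set that meets every plaquette evenly is a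
  coboundary. Parity of crossings is an explicit primitive. The identity holds for horizontal bonds by definition
  and spreads to vertical bonds through the plaquettes, starting from the far right where nothing happens.
\<close>

lemma bdry_contour_interior:
  assumes fin: "finite E" and bonds: "E \<subseteq> range (case_prod hbond) \<union> range (case_prod vbond)"
    and closed: "\<And>a b. ((hbond a b \<in> E) \<noteq> (hbond a (b + 1) \<in> E)) =
                        ((vbond a b \<in> E) \<noteq> (vbond (a + 1) b \<in> E))"
  shows "bdry (contour_interior E) = E" "finite (contour_interior E)"
proof -
  have finh: "finite {i. a \<le> i \<and> hbond i b \<in> E}" for a b
  proof -
    have "finite ((\<lambda>i. hbond i b) -` E)" by (rule finite_vimageI[OF fin]) (auto simp: inj_def)
    then show ?thesis by (rule rev_finite_subset) auto
  qed
  have "finite (case_prod hbond -` E)" "finite (case_prod vbond -` E)"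
    by (rule finite_vimageI[OF fin]; auto simp: inj_def)+
  then have "finite (case_prod hbond -` E \<union> case_prod vbond -` E)" by blast
  from finite_site_set_bounded[OF this] obtain K
    where "\<forall>z\<in>case_prod hbond -` E \<union> case_prod vbond -` E. \<bar>fst z\<bar> < K \<and> \<bar>snd z\<bar> < K" ..
  note K = bspec[OF this]
  have Kh: "\<bar>i\<bar> < K \<and> \<bar>b\<bar> < K" if "hbond i b \<in> E" for i b using K[of "(i, b)"] that by simp
  have Kv: "\<bar>i\<bar> < K \<and> \<bar>b\<bar> < K" if "vbond i b \<in> E" for i b using K[of "(i, b)"] that by simp
  have split: "a \<le> i \<longleftrightarrow> i = a \<or> a + 1 \<le> i" for a i :: int by linarith
  have h: "hbond a b \<in> E \<longleftrightarrow> ((a, b) \<in> contour_interior E) \<noteq> ((a + 1, b) \<in> contour_interior E)" for a b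
  proof (cases "hbond a b \<in> E")
    case True
    then have "{i. a \<le> i \<and> hbond i b \<in> E} = insert a {i. a + 1 \<le> i \<and> hbond i b \<in> E}"
      using split by blast
    then show ?thesis using True finh by (simp add: contour_interior_def)
  next
    case False
    then have "a \<le> i \<and> hbond i b \<in> E \<longleftrightarrow> a + 1 \<le> i \<and> hbond i b \<in> E" for i
      using split[of a i] by auto
    then have "{i. a \<le> i \<and> hbond i b \<in> E} = {i. a + 1 \<le> i \<and> hbond i b \<in> E}"
      by presburger
    then show ?thesis using False by (simp add: contour_interior_def)
  qed
  have far: "(a, b) \<notin> contour_interior E" if "K \<le> a \<or> K \<le> \<bar>b\<bar>" for a b
  proof -
    have "{i. a \<le> i \<and> hbond i b \<in> E} = {}" using Kh that by force
    then have "card {i. a \<le> i \<and> hbond i b \<in> E} = 0" by (metis card.empty)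
    then show ?thesis by (simp add: contour_interior_def)
  qed
  \<comment> \<open>Going left column by column from far to the right, closedness on the plaquettes propagates the
      claim for vertical bonds.\<close>
  have v: "vbond a b \<in> E \<longleftrightarrow> ((a, b) \<in> contour_interior E) \<noteq> ((a, b + 1) \<in> contour_interior E)" for a b
  proof (cases "a \<le> K")
    case True
    then show ?thesis
    proof (induction a rule: int_le_induct)
      case base
      then show ?case using Kv[of K b] far[of K] by auto
    next
      case (step i)
      then show ?case using closed[of "i - 1" b] h[of "i - 1" b] h[of "i - 1" "b + 1"] by auto
    qed
  next
    case False
    then show ?thesis using Kv[of a b] far[of a] by auto
  qed
  show "bdry (contour_interior E) = E" using bdry_eqI[OF h v bonds] .
  have left: "(a, b) \<notin> contour_interior E" if "a \<le> - K" for a b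
  proof (cases "b \<le> K")
    case True
    then show ?thesis
    proof (induction b rule: int_le_induct)
      case base
      show ?case using far[of a K] abs_ge_self[of K] by blast
    next
      case (step i)
      have "vbond a (i - 1) \<notin> E" using Kv[of a "i - 1"] that by force
      then show ?case using v[of a "i - 1"] step.IH by simp
    qed
  next
    case False
    then have "K \<le> \<bar>b\<bar>" by linarith
    then show ?thesis using far by blast
  qed
  have "contour_interior E \<subseteq> {- K..K} \<times> {- K..K}"
  proof
    fix z assume z: "z \<in> contour_interior E"
    obtain a b where ab: "z = (a, b)" by (cases z)
    have "\<not> (K \<le> a \<or> K \<le> \<bar>b\<bar>)" "\<not> a \<le> - K" using far left z ab by blast+
    then show "z \<in> {- K..K} \<times> {- K..K}" using ab by auto
  qed
  then show "finite (contour_interior E)" by (rule finite_subset) auto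
qed

definition nn_step :: "site set \<Rightarrow> (site \<times> site) set" where
  "nn_step M = {(u, v). nearest_neighbours u v \<and> u \<in> M \<and> v \<in> M}"

definition nn_component :: "site set \<Rightarrow> site \<Rightarrow> site set" where
  "nn_component M x = {y. (x, y) \<in> (nn_step M)\<^sup>*}"

definition contour_connected :: "site set set \<Rightarrow> site set \<Rightarrow> bool" where
  "contour_connected E e \<longleftrightarrow> e \<in> E \<and>
     (\<forall>e'\<in>E. (e, e') \<in> {(d, d'). d \<in> E \<and> d' \<in> E \<and> plaquette_adj d d'}\<^sup>*)"

lemma self_in_nn_component: "x \<in> nn_component M x"
  by (simp add: nn_component_def)

lemma nn_component_subset: "x \<in> M \<Longrightarrow> nn_component M x \<subseteq> M"
  unfolding nn_component_def nn_step_def by (auto elim: rtranclE)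

lemma nn_component_step:
  assumes "y \<in> nn_component M x" "nearest_neighbours y z" "z \<in> M" "x \<in> M"
  shows "z \<in> nn_component M x"
proof -
  have "y \<in> M" using assms nn_component_subset by blast
  then have "(y, z) \<in> nn_step M" using assms by (simp add: nn_step_def)
  then show ?thesis using assms(1) unfolding nn_component_def by (simp add: rtrancl.rtrancl_into_rtrancl)
qed

lemma nn_component_induct [consumes 2, case_names base step]:
  assumes "y \<in> nn_component M x" "x \<in> M" "P x"
    and "\<And>y z. y \<in> nn_component M x \<Longrightarrow> z \<in> nn_component M x \<Longrightarrow> nearest_neighbours y z \<Longrightarrow> P y \<Longrightarrow> P z"
  shows "P y"
proof -
  have "(x, y) \<in> (nn_step M)\<^sup>*" using assms(1) by (simp add: nn_component_def)
  then show ?thesis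
  proof (induction rule: rtrancl_induct)
    case base show ?case by fact
  next
    case (step y z)
    have "y \<in> nn_component M x" using step by (simp add: nn_component_def)
    moreover have "z \<in> nn_component M x"
      using step by (simp add: nn_component_def rtrancl.rtrancl_into_rtrancl)
    moreover have "nearest_neighbours y z" using step by (simp add: nn_step_def)
    ultimately show ?case using assms(4) step.IH by blast
  qed
qed

lemma nn_component_columns:
  assumes "y \<in> nn_component M x" "x \<in> M"
  shows "{fst x..fst y} \<union> {fst y..fst x} \<subseteq> fst ` nn_component M x"
  using assms
proof (induction rule: nn_component_induct)
  case base show ?case using self_in_nn_component[of x M] by auto
next
  case (step y z)
  have "\<bar>fst y - fst z\<bar> \<le> 1" using step by (auto simp: nearest_neighbours_def)
  then have "{fst x..fst z} \<union> {fst z..fst x} \<subseteq> {fst x..fst y} \<union> {fst y..fst x} \<union> {fst z}" by auto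
  then show ?case using step by blast
qed

lemma nn_component_rows:
  assumes "y \<in> nn_component M x" "x \<in> M"
  shows "{snd x..snd y} \<union> {snd y..snd x} \<subseteq> snd ` nn_component M x"
  using assms
proof (induction rule: nn_component_induct)
  case base show ?case using self_in_nn_component[of x M] by auto
next
  case (step y z)
  have "\<bar>snd y - snd z\<bar> \<le> 1" using step by (auto simp: nearest_neighbours_def)
  then have "{snd x..snd z} \<union> {snd z..snd x} \<subseteq> {snd x..snd y} \<union> {snd y..snd x} \<union> {snd z}" by auto
  then show ?case using step by blast
qed

lemma last_in_finite_int_set:
  assumes "finite {b :: int. P b}" "P b0"
  obtains b where "P b" "b0 \<le> b" "\<And>c. b < c \<Longrightarrow> \<not> P c"
proof -
  have "P (Max {b. P b})" using Max_in[OF assms(1)] assms(2) by auto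
  moreover have "c \<le> Max {b. P b}" if "P c" for c using Max_ge[OF assms(1)] that by auto
  ultimately show thesis using that[of "Max {b. P b}"] assms(2) by force
qed

lemma top_of_column:
  fixes H :: "site set"
  assumes "finite H" "(a, b0) \<in> H"
  obtains b where "(a, b) \<in> H" "(a, b + 1) \<notin> H"
proof -
  have "{b. (a, b) \<in> H} \<subseteq> snd ` H" by force
  then have "finite {b. (a, b) \<in> H}" using assms(1) finite_surj by blast
  then show thesis using last_in_finite_int_set[of "\<lambda>b. (a, b) \<in> H" b0] assms(2) that
    by (metis less_add_one)
qed

lemma end_of_row:
  fixes H :: "site set"
  assumes "finite H" "(a0, b) \<in> H"
  obtains a where "(a, b) \<in> H" "a0 \<le> a" "\<And>c. a < c \<Longrightarrow> (c, b) \<notin> H"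
proof -
  have "{a. (a, b) \<in> H} \<subseteq> fst ` H" by force
  then have "finite {a. (a, b) \<in> H}" using assms(1) finite_surj by blast
  then show thesis using last_in_finite_int_set[of "\<lambda>a. (a, b) \<in> H" a0] assms(2) that by metis
qed

text \<open>
  The bond above the topmost point of a column belongs to the boundary.
\<close>

lemma card_columns_le_bdry:
  assumes "finite H" shows "card (fst ` H) \<le> card (bdry H)"
proof -
  have "\<exists>b. vbond a b \<in> bdry H" if "a \<in> fst ` H" for a
    using that top_of_column[OF assms] vbond_in_bdry_iff by (metis imageE prod.collapse)
  then obtain f where f: "\<And>a. a \<in> fst ` H \<Longrightarrow> vbond a (f a) \<in> bdry H" by metis
  show ?thesis
    by (rule card_inj_on_le[of "\<lambda>a. vbond a (f a)"]) (use f assms in \<open>auto simp: inj_on_def finite_bdry\<close>)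
qed

lemma card_rows_le_bdry:
  assumes "finite H" shows "card (snd ` H) \<le> card (bdry H)"
proof -
  have "\<exists>a. hbond a b \<in> bdry H" if "b \<in> snd ` H" for b
    using that end_of_row[OF assms] hbond_in_bdry_iff by (metis imageE prod.collapse less_add_one)
  then obtain f where f: "\<And>a. a \<in> snd ` H \<Longrightarrow> hbond (f a) a \<in> bdry H" by metis
  show ?thesis
    by (rule card_inj_on_le[of "\<lambda>a. hbond (f a) a"]) (use f assms in \<open>auto simp: inj_on_def finite_bdry\<close>)
qed

text \<open>
  The outer contour of a minus cluster, found without any planar topology. Take the bond at the right end
  of the cluster in the row of \<open>x\<close>, and let \<open>E\<close> be the plaquette-connected component of this bond
  in the cluster boundary. A boundary meets every plaquette evenly, hence so does each of its components,
  and \<open>E\<close> bounds a finite set. The ray to the right from the starting point crosses \<open>E\<close> exactly once,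
  so that set contains the starting point, and with it the entire cluster, which \<open>E\<close> does not cut.
  Every column of the enclosed set has a bond of \<open>E\<close>, which is a boundary bond of the cluster; so
  the enclosed set meets no columns and rows other than those of the cluster.
\<close>

lemma exists_contour:
  assumes fin: "finite M" and x: "x \<in> M"
  obtains E i where "finite (contour_interior E)" "bdry (contour_interior E) = E" "E \<subseteq> bdry M"
    "nn_component M x \<subseteq> contour_interior E"
    "fst ` contour_interior E = fst ` nn_component M x" "snd ` contour_interior E = snd ` nn_component M x"
    "fst x \<le> i" "i < fst x + int (card E)" "contour_connected E (hbond i (snd x))"
proof -
  define C where "C = nn_component M x"
  have finC: "finite C" using nn_component_subset[OF x] fin finite_subset by (auto simp: C_def)
  have xC: "x \<in> C" by (simp add: C_def self_in_nn_component)
  obtain i where i: "(i, snd x) \<in> C" "fst x \<le> i" "\<And>c. i < c \<Longrightarrow> (c, snd x) \<notin> C"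
    using end_of_row[OF finC, of "fst x" "snd x"] xC by auto
  define e where "e = hbond i (snd x)"
  have e: "e \<in> bdry C" using i by (auto simp: e_def hbond_in_bdry_iff)
  define R where "R = {(d, d'). d \<in> bdry C \<and> d' \<in> bdry C \<and> plaquette_adj d d'}"
  define E where "E = {d. (e, d) \<in> R\<^sup>*}"
  have EC: "E \<subseteq> bdry C" using e by (auto simp: E_def R_def elim: rtranclE)
  have finE: "finite E" using EC finite_bdry[OF finC] finite_subset by blast
  have bonds: "E \<subseteq> range (case_prod hbond) \<union> range (case_prod vbond)"
    using EC bdry_subset_bonds by blast
  have all: "d' \<in> E" if "d \<in> E" "d \<in> plaquette a b" "d' \<in> plaquette a b" "d' \<in> bdry C" for d d' a b
  proof -
    have "(d, d') \<in> R" using that EC by (auto simp: R_def plaquette_adj_def)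
    then show ?thesis using that(1) by (simp add: E_def rtrancl.rtrancl_into_rtrancl)
  qed
  have plaq: "E \<inter> plaquette a b = {} \<or> E \<inter> plaquette a b = bdry C \<inter> plaquette a b" for a b
    using all[of _ a b] EC by blast
  have closed: "((hbond a b \<in> E) \<noteq> (hbond a (b + 1) \<in> E)) =
                ((vbond a b \<in> E) \<noteq> (vbond (a + 1) b \<in> E))" for a b
    using plaq[of a b]
  proof
    assume "E \<inter> plaquette a b = {}"
    then show ?thesis by (auto simp: plaquette_def)
  next
    assume eq: "E \<inter> plaquette a b = bdry C \<inter> plaquette a b"
    have "d \<in> E \<longleftrightarrow> d \<in> bdry C" if "d \<in> plaquette a b" for d using eq that by blast
    then show ?thesis by (auto simp: plaquette_def hbond_in_bdry_iff vbond_in_bdry_iff)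
  qed
  note H = bdry_contour_interior[OF finE bonds closed]
  have eE: "e \<in> E" by (simp add: E_def)
  have "hbond k (snd x) \<notin> E" if "i < k" for k
  proof -
    have "hbond k (snd x) \<notin> bdry C" using i(3)[of k] i(3)[of "k+1"] that by (auto simp: hbond_in_bdry_iff)
    then show ?thesis using EC by blast
  qed
  then have "{k. i \<le> k \<and> hbond k (snd x) \<in> E} = {i}" using eE by (force simp: e_def)
  then have "card {k. i \<le> k \<and> hbond k (snd x) \<in> E} = 1" by simp
  then have iH: "(i, snd x) \<in> contour_interior E"
    by (simp only: contour_interior_def mem_Collect_eq case_prod_conv odd_one not_False_eq_True)
  have same: "y \<in> contour_interior E \<longleftrightarrow> z \<in> contour_interior E" if "y \<in> C" "z \<in> C" "nearest_neighbours y z" for y z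
  proof -
    have "{y, z} \<notin> E" using EC that pair_in_bdry_iff[OF that(3), of C] by blast
    then show ?thesis using H(1) that(3) pair_in_bdry_iff[OF that(3), of "contour_interior E"] by auto
  qed
  have "y \<in> contour_interior E \<longleftrightarrow> x \<in> contour_interior E" if "y \<in> C" for y
    using that[unfolded C_def] x
    by (induction rule: nn_component_induct) (use same in \<open>auto simp: C_def\<close>)
  then have CH: "C \<subseteq> contour_interior E" using iH i(1) by blast
  have "fst ` contour_interior E \<subseteq> fst ` C"
  proof
    fix a assume "a \<in> fst ` contour_interior E"
    then obtain b where "(a, b) \<in> contour_interior E" "(a, b + 1) \<notin> contour_interior E"
      using top_of_column[OF H(2)] by (metis imageE prod.collapse)
    then have "vbond a b \<in> bdry C" using H(1) EC vbond_in_bdry_iff by blast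
    then show "a \<in> fst ` C" by (force simp: vbond_in_bdry_iff)
  qed
  then have f: "fst ` contour_interior E = fst ` C" using CH by blast
  have "snd ` contour_interior E \<subseteq> snd ` C"
  proof
    fix b assume "b \<in> snd ` contour_interior E"
    then obtain a where "(a, b) \<in> contour_interior E" "(a + 1, b) \<notin> contour_interior E"
      using end_of_row[OF H(2)] by (metis imageE prod.collapse less_add_one)
    then have "hbond a b \<in> bdry C" using H(1) EC hbond_in_bdry_iff by blast
    then show "b \<in> snd ` C" by (force simp: hbond_in_bdry_iff)
  qed
  then have s: "snd ` contour_interior E = snd ` C" using CH by blast
  have "bdry C \<subseteq> bdry M"
  proof
    fix d assume "d \<in> bdry C"
    then obtain y z where yz: "d = {y, z}" "nearest_neighbours y z" "y \<in> C" "z \<notin> C"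
      by (auto simp: bdry_def)
    then have "y \<in> M" "z \<notin> M"
      using nn_component_subset[OF x] nn_component_step[of y M x z] x by (auto simp: C_def)
    then show "d \<in> bdry M" using yz unfolding bdry_def by blast
  qed
  then have EM: "E \<subseteq> bdry M" using EC by blast
  have "{fst x..i} \<subseteq> fst ` C" using nn_component_columns[OF i(1)[unfolded C_def] x] by (simp add: C_def)
  then have "card {fst x..i} \<le> card (fst ` C)"
    by (rule card_mono[OF finite_imageI[OF finC]])
  also have "\<dots> \<le> card E" using card_columns_le_bdry[OF H(2)] H(1) f by simp
  finally have len: "i < fst x + int (card E)" using i(2) by simp
  have conn: "contour_connected E e"
    unfolding contour_connected_def
  proof (intro conjI ballI eE)
    fix d assume "d \<in> E"
    then have "(e, d) \<in> R\<^sup>*" by (simp add: E_def)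
    then show "(e, d) \<in> {(d, d'). d \<in> E \<and> d' \<in> E \<and> plaquette_adj d d'}\<^sup>*"
    proof (induction rule: rtrancl_induct)
      case (step y z)
      then have "y \<in> E" "z \<in> E" by (auto simp: E_def intro: rtrancl.rtrancl_into_rtrancl)
      then show ?case using step by (intro rtrancl.rtrancl_into_rtrancl[OF step.IH]) (simp add: R_def)
    qed simp
  qed
  show thesis using that[OF H(2,1) EM _ _ _ i(2) len] CH f s conn by (auto simp: C_def e_def)
qed


section \<open>Counting contours\<close>

text \<open>
  A depth-first traversal of a spanning tree: whenever a new element \<open>b\<close> next to a visited element
  \<open>a\<close> is found, the detour \<open>a, b, a\<close> is inserted into the walk.
\<close>

lemma covering_walk:
  assumes fin: "finite A" and v: "v \<in> A" and sym: "\<And>a b. R a b \<Longrightarrow> R b a"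
    and conn: "\<And>u. u \<in> A \<Longrightarrow> (v, u) \<in> {(a, b). a \<in> A \<and> b \<in> A \<and> R a b}\<^sup>*"
  obtains w where "length w = 2 * card A - 1" "w \<noteq> []" "hd w = v" "successively R w" "set w = A"
proof -
  have "\<exists>w. length w = 2 * Suc k - 1 \<and> w \<noteq> [] \<and> hd w = v \<and> successively R w \<and> set w \<subseteq> A \<and> card (set w) = Suc k"
    if "Suc k \<le> card A" for k
    using that
  proof (induction k)
    case 0
    then show ?case using v by (intro exI[of _ "[v]"]) auto
  next
    case (Suc k)
    then obtain w where w: "length w = 2 * Suc k - 1" "w \<noteq> []" "hd w = v" "successively R w"
      "set w \<subseteq> A" "card (set w) = Suc k" by auto
    have "set w \<noteq> A" using w(6) Suc.prems by auto
    then obtain z where z: "z \<in> A" "z \<notin> set w" using w(5) by blast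
    have vw: "v \<in> set w" using w(2,3) by auto
    have "\<exists>a b. a \<in> set w \<and> b \<in> A \<and> b \<notin> set w \<and> R a b"
    proof (rule ccontr)
      assume no: "\<not> ?thesis"
      have "u \<in> set w" if "(v, u) \<in> {(a, b). a \<in> A \<and> b \<in> A \<and> R a b}\<^sup>*" for u
        using that by (induction rule: rtrancl_induct) (use vw no in auto)
      then show False using conn[OF z(1)] z(2) by blast
    qed
    then obtain a b where ab: "a \<in> set w" "b \<in> A" "b \<notin> set w" "R a b" by blast
    obtain xs ys where xs: "w = xs @ a # ys" using split_list[OF ab(1)] by blast
    let ?w = "xs @ a # b # a # ys"
    have "successively R ?w" using w(4) ab(4) sym unfolding xs by (auto simp: successively_append_iff)
    moreover have "hd ?w = v" using w(3) unfolding xs by (cases xs) auto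
    moreover have s: "set ?w = insert b (set w)" unfolding xs by auto
    moreover have "length ?w = 2 * Suc (Suc k) - 1" using w(1) unfolding xs by simp
    moreover have "card (set ?w) = Suc (Suc k)" unfolding s using ab(3) w(6) by simp
    ultimately show ?case using w(5) ab(2) by (intro exI[of _ ?w]) auto
  qed
  moreover have "0 < card A" using fin v card_gt_0_iff by blast
  then obtain k where k: "card A = Suc k" by (cases "card A") auto
  ultimately obtain w where w: "length w = 2 * Suc k - 1" "w \<noteq> []" "hd w = v" "successively R w"
      "set w \<subseteq> A" "card (set w) = Suc k" by (metis order_refl)
  then have "set w = A" using card_subset_eq[OF fin w(5)] k by simp
  then show thesis using that w k by simp
qed

lemma card_walks:
  assumes deg: "\<And>u. finite {u'. R u u'}" "\<And>u. card {u'. R u u'} \<le> d"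
  shows "finite {w. length w = Suc n \<and> hd w = v \<and> successively R w} \<and>
         card {w. length w = Suc n \<and> hd w = v \<and> successively R w} \<le> d ^ n"
proof (induction n arbitrary: v)
  case 0
  have "{w. length w = Suc 0 \<and> hd w = v \<and> successively R w} = {[v]}"
    by (auto simp: length_Suc_conv)
  then show ?case by simp
next
  case (Suc n)
  let ?W = "\<lambda>n v. {w. length w = Suc n \<and> hd w = v \<and> successively R w}"
  have eq: "?W (Suc n) v = (\<Union>u\<in>{u. R v u}. (#) v ` ?W n u)"
  proof (intro set_eqI iffI)
    fix w assume "w \<in> ?W (Suc n) v"
    then show "w \<in> (\<Union>u\<in>{u. R v u}. (#) v ` ?W n u)"
      by (auto simp: length_Suc_conv image_iff)
  next
    fix w assume "w \<in> (\<Union>u\<in>{u. R v u}. (#) v ` ?W n u)"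
    then show "w \<in> ?W (Suc n) v" by (auto simp: successively_Cons)
  qed
  have "card (?W (Suc n) v) \<le> (\<Sum>u\<in>{u. R v u}. card ((#) v ` ?W n u))"
    unfolding eq by (rule card_UN_le[OF deg(1)])
  also have "\<dots> \<le> (\<Sum>u\<in>{u. R v u}. d ^ n)"
    using Suc.IH by (intro sum_mono) (meson card_image_le order_trans)
  also have "\<dots> \<le> d * d ^ n" using deg(2)[of v] by simp
  finally have "card (?W (Suc n) v) \<le> d ^ Suc n" by simp
  moreover have "finite (?W (Suc n) v)" unfolding eq using Suc.IH deg(1) by blast
  ultimately show ?case by blast
qed

lemma plaquette_adj_sym: "plaquette_adj e e' \<Longrightarrow> plaquette_adj e' e"
  by (auto simp: plaquette_adj_def)

text \<open>
  The plaquettes that contain a bond are among the four around one of its ends, with four bonds each.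
\<close>

lemma card_plaquette_adj: "finite {e'. plaquette_adj e e'}" "card {e'. plaquette_adj e e'} \<le> 16"
proof -
  define x where "x = (SOME x. x \<in> e)"
  let ?N = "plaquette (fst x) (snd x) \<union> plaquette (fst x - 1) (snd x) \<union>
            plaquette (fst x) (snd x - 1) \<union> plaquette (fst x - 1) (snd x - 1)"
  have sub: "{e'. plaquette_adj e e'} \<subseteq> ?N"
  proof
    fix e' assume "e' \<in> {e'. plaquette_adj e e'}"
    then obtain a b where ab: "e \<in> plaquette a b" "e' \<in> plaquette a b" by (auto simp: plaquette_adj_def)
    have "e \<noteq> {}" using ab(1) by (auto simp: plaquette_def hbond_def vbond_def)
    then have "x \<in> e" unfolding x_def by (rule some_in_eq[THEN iffD2])
    then have "fst x = a \<or> fst x = a + 1" "snd x = b \<or> snd x = b + 1"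
      using ab(1) by (auto simp: plaquette_def hbond_def vbond_def)
    then have "(a = fst x \<or> a = fst x - 1) \<and> (b = snd x \<or> b = snd x - 1)" by linarith
    then show "e' \<in> ?N" using ab(2) by blast
  qed
  have c: "card (plaquette a b) \<le> 4" for a b
    unfolding plaquette_def by (rule order_trans[OF card_insert_le_m1]) (auto intro!: order_trans[OF card_insert_le_m1])
  have f: "finite (plaquette a b)" for a b by (simp add: plaquette_def)
  show "finite {e'. plaquette_adj e e'}" by (rule finite_subset[OF sub]) (simp add: f)
  have "card {e'. plaquette_adj e e'} \<le> card ?N" by (rule card_mono[OF _ sub]) (simp add: f)
  also have "\<dots> \<le> 4 + 4 + 4 + 4"
    by (intro order_trans[OF card_Un_le] add_mono c)
  finally show "card {e'. plaquette_adj e e'} \<le> 16" by simp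
qed

text \<open>
  The starting bond is recorded because \<open>exists_contour\<close> only locates it in the row of \<open>x\<close>, at
  distance less than the length of the contour.
\<close>

definition contours :: "site \<Rightarrow> nat \<Rightarrow> site set set set" where
  "contours x n = {E. finite E \<and> card E = n \<and>
     (\<exists>i. fst x \<le> i \<and> i < fst x + int n \<and> contour_connected E (hbond i (snd x)))}"

lemma card_contours: "finite (contours x n)" "card (contours x n) \<le> n * 256 ^ n"
proof -
  let ?W = "\<lambda>v. {w. length w = Suc (2 * n - 2) \<and> hd w = v \<and> successively plaquette_adj w}"
  let ?I = "{fst x..<fst x + int n}"
  have W: "finite (?W v)" "card (?W v) \<le> 16 ^ (2 * n - 2)" for v
    using card_walks[of plaquette_adj 16 "2 * n - 2" v] card_plaquette_adj by auto
  have sub: "contours x n \<subseteq> (\<Union>i\<in>?I. set ` ?W (hbond i (snd x)))"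
  proof
    fix E assume "E \<in> contours x n"
    then obtain i where E: "finite E" "card E = n" and i: "i \<in> ?I"
      and conn: "contour_connected E (hbond i (snd x))" by (auto simp: contours_def)
    let ?e = "hbond i (snd x)"
    have e: "?e \<in> E" using conn by (simp add: contour_connected_def)
    then have n: "0 < n" using E card_gt_0_iff by blast
    obtain w where w: "length w = 2 * card E - 1" "w \<noteq> []" "hd w = ?e" "successively plaquette_adj w" "set w = E"
            using covering_walk[OF E(1) e, of plaquette_adj] plaquette_adj_sym conn
      unfolding contour_connected_def by blast
    have "length w = Suc (2 * n - 2)" using w(1) E(2) n by simp
    then have "w \<in> ?W ?e" using w by simp
    then show "E \<in> (\<Union>i\<in>?I. set ` ?W (hbond i (snd x)))" using i w(5) by blast
  qed
  show "finite (contours x n)" by (rule finite_subset[OF sub]) (use W in blast)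
  have "card (contours x n) \<le> card (\<Union>i\<in>?I. set ` ?W (hbond i (snd x)))"
    by (rule card_mono[OF _ sub]) (use W in blast)
  also have "\<dots> \<le> (\<Sum>i\<in>?I. card (set ` ?W (hbond i (snd x))))" by (rule card_UN_le) simp
  also have "\<dots> \<le> (\<Sum>i\<in>?I. 16 ^ (2 * n - 2))"
    by (intro sum_mono order_trans[OF card_image_le W(2)] W(1))
  also have "\<dots> = n * 16 ^ (2 * n - 2)" by simp
  also have "\<dots> \<le> n * 16 ^ (2 * n)" by (intro mult_left_mono power_increasing) auto
  finally show "card (contours x n) \<le> n * 256 ^ n" by (simp add: power_mult)
qed


section \<open>Finite-volume Ising measures as measures on sets of minus sites\<close>

text \<open>
  Configurations are represented by their sets of minus sites; then boundary conditions are sets as well, the order is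
  inclusion, and a bond is unsatisfied iff the set of minus sites cuts it.
\<close>

definition cut_bonds :: "site set \<Rightarrow> site set \<Rightarrow> site set set" where
  "cut_bonds \<Lambda> M = {b \<in> bonds_touching \<Lambda>. b \<inter> M \<noteq> {} \<and> \<not> b \<subseteq> M}"

definition weight :: "real \<Rightarrow> site set \<Rightarrow> site set \<Rightarrow> real" where
  "weight \<beta> \<Lambda> M = exp (- 2 * \<beta> * card (cut_bonds \<Lambda> M))"

text \<open>
  The configurations in the volume \<open>\<Lambda>\<close> with boundary condition \<open>N\<close>. Only the part of \<open>N\<close> off
  \<open>\<Lambda>\<close> matters, so that any configuration can serve as a boundary condition. Frozen spins are sites taken out of the volume.
\<close>

definition confs :: "site set \<Rightarrow> site set \<Rightarrow> site set set" where
  "confs \<Lambda> N = {M. M - \<Lambda> = N - \<Lambda>}"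

definition partition_sum :: "real \<Rightarrow> site set \<Rightarrow> site set \<Rightarrow> real" where
  "partition_sum \<beta> \<Lambda> N = (\<Sum>M\<in>confs \<Lambda> N. weight \<beta> \<Lambda> M)"

definition gibbs_mean :: "real \<Rightarrow> site set \<Rightarrow> site set \<Rightarrow> (site set \<Rightarrow> real) \<Rightarrow> real" where
  "gibbs_mean \<beta> \<Lambda> N f = (\<Sum>M\<in>confs \<Lambda> N. weight \<beta> \<Lambda> M * f M) / partition_sum \<beta> \<Lambda> N"

lemma confs_eq_image: "confs \<Lambda> N = (\<lambda>A. A \<union> (N - \<Lambda>)) ` Pow \<Lambda>"
proof
  show "confs \<Lambda> N \<subseteq> (\<lambda>A. A \<union> (N - \<Lambda>)) ` Pow \<Lambda>"
  proof
    fix M assume "M \<in> confs \<Lambda> N"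
    then have "M = (M \<inter> \<Lambda>) \<union> (N - \<Lambda>)" unfolding confs_def by blast
    then show "M \<in> (\<lambda>A. A \<union> (N - \<Lambda>)) ` Pow \<Lambda>" by blast
  qed
qed (auto simp: confs_def)

lemma sum_confs: "(\<Sum>M\<in>confs \<Lambda> N. f M) = (\<Sum>A\<in>Pow \<Lambda>. f (A \<union> (N - \<Lambda>)))"
  unfolding confs_eq_image by (subst sum.reindex) (auto simp: inj_on_def)

lemma finite_confs: "finite \<Lambda> \<Longrightarrow> finite (confs \<Lambda> N)"
  by (simp add: confs_eq_image)

lemma self_in_confs: "N \<in> confs \<Lambda> N"
  by (simp add: confs_def)

lemma confs_cong: "N - \<Lambda> = N' - \<Lambda> \<Longrightarrow> confs \<Lambda> N = confs \<Lambda> N'"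
  by (simp add: confs_def)

lemma weight_pos: "0 < weight \<beta> \<Lambda> M"
  by (simp add: weight_def)

lemma partition_sum_pos: "finite \<Lambda> \<Longrightarrow> 0 < partition_sum \<beta> \<Lambda> N"
  unfolding partition_sum_def
  by (rule sum_pos) (use self_in_confs in \<open>auto simp: finite_confs weight_pos\<close>)

lemma gibbs_mean_cong:
  assumes "N - \<Lambda> = N' - \<Lambda>" "\<And>M. M \<in> confs \<Lambda> N \<Longrightarrow> f M = g M"
  shows "gibbs_mean \<beta> \<Lambda> N f = gibbs_mean \<beta> \<Lambda> N' g"
  using assms by (simp add: gibbs_mean_def partition_sum_def confs_cong[OF assms(1)])

lemma gibbs_mean_mono:
  assumes "finite \<Lambda>" "\<And>M. M \<in> confs \<Lambda> N \<Longrightarrow> f M \<le> g M"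
  shows "gibbs_mean \<beta> \<Lambda> N f \<le> gibbs_mean \<beta> \<Lambda> N g"
  unfolding gibbs_mean_def
  by (intro divide_right_mono sum_mono mult_left_mono assms less_imp_le[OF weight_pos]
      less_imp_le[OF partition_sum_pos])

lemma gibbs_mean_add: "gibbs_mean \<beta> \<Lambda> N (\<lambda>M. f M + g M) = gibbs_mean \<beta> \<Lambda> N f + gibbs_mean \<beta> \<Lambda> N g"
  by (simp add: gibbs_mean_def algebra_simps sum.distrib add_divide_distrib)

lemma gibbs_mean_diff: "gibbs_mean \<beta> \<Lambda> N (\<lambda>M. f M - g M) = gibbs_mean \<beta> \<Lambda> N f - gibbs_mean \<beta> \<Lambda> N g"
  by (simp add: gibbs_mean_def algebra_simps sum_subtractf diff_divide_distrib)

lemma gibbs_mean_sum: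
  "gibbs_mean \<beta> \<Lambda> N (\<lambda>M. \<Sum>i\<in>I. f i M) = (\<Sum>i\<in>I. gibbs_mean \<beta> \<Lambda> N (f i))"
  unfolding gibbs_mean_def sum_divide_distrib[symmetric]
  by (subst sum.swap) (simp add: sum_distrib_left)

lemma gibbs_mean_cmult: "gibbs_mean \<beta> \<Lambda> N (\<lambda>M. c * f M) = c * gibbs_mean \<beta> \<Lambda> N f"
  by (simp add: gibbs_mean_def sum_distrib_left algebra_simps)

lemma gibbs_mean_const: "finite \<Lambda> \<Longrightarrow> gibbs_mean \<beta> \<Lambda> N (\<lambda>M. c) = c"
  using partition_sum_pos[of \<Lambda> \<beta> N]
  by (simp add: gibbs_mean_def partition_sum_def sum_distrib_right[symmetric])

lemma gibbs_mean_bounds: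
  assumes "finite \<Lambda>" "\<And>M. M \<in> confs \<Lambda> N \<Longrightarrow> a \<le> f M" "\<And>M. M \<in> confs \<Lambda> N \<Longrightarrow> f M \<le> b"
  shows "a \<le> gibbs_mean \<beta> \<Lambda> N f" "gibbs_mean \<beta> \<Lambda> N f \<le> b"
  using gibbs_mean_mono[OF assms(1), of N "\<lambda>_. a" f \<beta>] gibbs_mean_mono[OF assms(1), of N f "\<lambda>_. b" \<beta>]
    assms gibbs_mean_const[OF assms(1)] by auto

lemma bonds_touching_mono: "\<Lambda>' \<subseteq> \<Lambda> \<Longrightarrow> bonds_touching \<Lambda>' \<subseteq> bonds_touching \<Lambda>"
  unfolding bonds_touching_def by blast

lemma finite_cut_bonds: "finite \<Lambda> \<Longrightarrow> finite (cut_bonds \<Lambda> M)"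
  by (simp add: cut_bonds_def finite_bonds_touching(1))

text \<open>
  The quotient of the two weights only involves bonds that do not touch the smaller volume, and the two
  configurations agree on these.
\<close>

lemma weight_exchange:
  assumes fin: "finite \<Lambda>" and sub: "\<Lambda>' \<subseteq> \<Lambda>" and M: "M' \<in> confs \<Lambda>' M"
  shows "weight \<beta> \<Lambda> M * weight \<beta> \<Lambda>' M' = weight \<beta> \<Lambda> M' * weight \<beta> \<Lambda>' M"
proof -
  let ?r = "\<lambda>M. {b \<in> bonds_touching \<Lambda> - bonds_touching \<Lambda>'. b \<inter> M \<noteq> {} \<and> \<not> b \<subseteq> M}"
  have eq: "card (cut_bonds \<Lambda> M) = card (cut_bonds \<Lambda>' M) + card (?r M)" for M
  proof -
    have "cut_bonds \<Lambda> M = cut_bonds \<Lambda>' M \<union> ?r M"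
      using bonds_touching_mono[OF sub] by (auto simp: cut_bonds_def)
    moreover have "cut_bonds \<Lambda>' M \<inter> ?r M = {}" by (auto simp: cut_bonds_def)
    ultimately show ?thesis
      using finite_subset[OF sub fin] finite_bonds_touching(1)[OF fin]
      by (simp add: card_Un_disjoint finite_cut_bonds)
  qed
  have "?r M = ?r M'"
  proof (rule Collect_cong, rule conj_cong[OF refl])
    fix b assume "b \<in> bonds_touching \<Lambda> - bonds_touching \<Lambda>'"
    then have "b \<inter> \<Lambda>' = {}" unfolding bonds_touching_def by blast
    then have "b \<inter> M = b \<inter> M'" using M unfolding confs_def by blast
    then show "(b \<inter> M \<noteq> {} \<and> \<not> b \<subseteq> M) = (b \<inter> M' \<noteq> {} \<and> \<not> b \<subseteq> M')" by blast
  qed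
  then show ?thesis
    by (simp add: weight_def eq[of M] eq[of M'] exp_add[symmetric] algebra_simps)
qed

lemma confs_sym: "M' \<in> confs \<Lambda> M \<longleftrightarrow> M \<in> confs \<Lambda> M'"
  by (auto simp: confs_def)

lemma confs_trans: "\<Lambda>' \<subseteq> \<Lambda> \<Longrightarrow> M \<in> confs \<Lambda> N \<Longrightarrow> M' \<in> confs \<Lambda>' M \<Longrightarrow> M' \<in> confs \<Lambda> N"
  unfolding confs_def by blast

lemma partition_sum_cong: "M' \<in> confs \<Lambda> M \<Longrightarrow> partition_sum \<beta> \<Lambda> M' = partition_sum \<beta> \<Lambda> M"
  unfolding partition_sum_def confs_def by simp

text \<open>
  The DLR equation. Exchanging the two summations turns the resampled configuration into the original one,
  by the symmetry of \<open>weight_exchange\<close>.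
\<close>

theorem gibbs_mean_consistent:
  assumes fin: "finite \<Lambda>" and sub: "\<Lambda>' \<subseteq> \<Lambda>"
  shows "gibbs_mean \<beta> \<Lambda> N f = gibbs_mean \<beta> \<Lambda> N (\<lambda>M. gibbs_mean \<beta> \<Lambda>' M f)"
proof -
  have fin': "finite \<Lambda>'" using sub fin finite_subset by blast
  let ?C = "confs \<Lambda> N"
  have "(\<Sum>M\<in>?C. weight \<beta> \<Lambda> M * gibbs_mean \<beta> \<Lambda>' M f)
      = (\<Sum>M\<in>?C. \<Sum>M' | M' \<in> ?C \<and> M' \<in> confs \<Lambda>' M.
           weight \<beta> \<Lambda> M * weight \<beta> \<Lambda>' M' * f M' / partition_sum \<beta> \<Lambda>' M)"
  proof (rule sum.cong[OF refl])
    fix M assume M: "M \<in> ?C"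
    have "{M'. M' \<in> ?C \<and> M' \<in> confs \<Lambda>' M} = confs \<Lambda>' M" using confs_trans[OF sub M] by blast
    then show "weight \<beta> \<Lambda> M * gibbs_mean \<beta> \<Lambda>' M f = (\<Sum>M' | M' \<in> ?C \<and> M' \<in> confs \<Lambda>' M.
           weight \<beta> \<Lambda> M * weight \<beta> \<Lambda>' M' * f M' / partition_sum \<beta> \<Lambda>' M)"
      by (simp add: gibbs_mean_def sum_distrib_left sum_divide_distrib mult.assoc)
  qed
  also have "\<dots> = (\<Sum>M'\<in>?C. \<Sum>M | M \<in> ?C \<and> M' \<in> confs \<Lambda>' M.
           weight \<beta> \<Lambda> M * weight \<beta> \<Lambda>' M' * f M' / partition_sum \<beta> \<Lambda>' M)"
    by (rule sum.swap_restrict) (simp_all add: finite_confs fin)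
  also have "\<dots> = (\<Sum>M'\<in>?C. \<Sum>M\<in>confs \<Lambda>' M'.
           weight \<beta> \<Lambda> M' * f M' * (weight \<beta> \<Lambda>' M / partition_sum \<beta> \<Lambda>' M'))"
  proof (rule sum.cong[OF refl])
    fix M' assume M': "M' \<in> ?C"
    have eq: "{M. M \<in> ?C \<and> M' \<in> confs \<Lambda>' M} = confs \<Lambda>' M'"
      using confs_trans[OF sub M'] confs_sym by blast
    show "(\<Sum>M | M \<in> ?C \<and> M' \<in> confs \<Lambda>' M.
           weight \<beta> \<Lambda> M * weight \<beta> \<Lambda>' M' * f M' / partition_sum \<beta> \<Lambda>' M) = (\<Sum>M\<in>confs \<Lambda>' M'.
           weight \<beta> \<Lambda> M' * f M' * (weight \<beta> \<Lambda>' M / partition_sum \<beta> \<Lambda>' M'))"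
      unfolding eq
    proof (rule sum.cong[OF refl])
      fix M assume M: "M \<in> confs \<Lambda>' M'"
      then have "M' \<in> confs \<Lambda>' M" by (subst confs_sym)
      from weight_exchange[OF fin sub this, of \<beta>] partition_sum_cong[OF M, of \<beta>]
      show "weight \<beta> \<Lambda> M * weight \<beta> \<Lambda>' M' * f M' / partition_sum \<beta> \<Lambda>' M =
          weight \<beta> \<Lambda> M' * f M' * (weight \<beta> \<Lambda>' M / partition_sum \<beta> \<Lambda>' M')"
        by (simp add: algebra_simps)
    qed
  qed
  also have "\<dots> = (\<Sum>M'\<in>?C. weight \<beta> \<Lambda> M' * f M')"
  proof (rule sum.cong[OF refl])
    fix M'
    have "(\<Sum>M\<in>confs \<Lambda>' M'. weight \<beta> \<Lambda>' M / partition_sum \<beta> \<Lambda>' M') = 1"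
      using partition_sum_pos[OF fin', of \<beta> M'] by (simp add: sum_divide_distrib[symmetric] partition_sum_def)
    then show "(\<Sum>M\<in>confs \<Lambda>' M'. weight \<beta> \<Lambda> M' * f M' * (weight \<beta> \<Lambda>' M / partition_sum \<beta> \<Lambda>' M'))
        = weight \<beta> \<Lambda> M' * f M'"
      by (simp only: sum_distrib_left[symmetric] mult_1_right)
  qed
  finally show ?thesis by (simp add: gibbs_mean_def)
qed

lemma gibbs_mean_pull_out:
  assumes "\<And>M. M \<in> confs \<Lambda> N \<Longrightarrow> g M = c"
  shows "gibbs_mean \<beta> \<Lambda> N (\<lambda>M. g M * f M) = c * gibbs_mean \<beta> \<Lambda> N f"
  unfolding gibbs_mean_cmult[symmetric] by (rule gibbs_mean_cong) (auto simp: assms)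

text \<open>
  The case of a one-element set in the four functions theorem of Ahlswede and Daykin.
\<close>

lemma four_functions_step:
  fixes a0 a1 b0 b1 c0 c1 d0 d1 :: real
  assumes nn: "0 \<le> a0" "0 \<le> a1" "0 \<le> b0" "0 \<le> b1" "0 \<le> c0" "0 \<le> c1" "0 \<le> d0" "0 \<le> d1"
    and 00: "a0 * b0 \<le> c0 * d0" and 01: "a0 * b1 \<le> c1 * d0" and 10: "a1 * b0 \<le> c1 * d0"
    and 11: "a1 * b1 \<le> c1 * d1"
  shows "(a0 + a1) * (b0 + b1) \<le> (c0 + c1) * (d0 + d1)"
proof -
  have expand: "(p + q) * (r + s) = p * r + p * s + q * r + q * s" for p q r s :: real
    by (simp add: algebra_simps)
  show ?thesis
    unfolding expand
  proof (cases "c1 * d0 = 0")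
    case True
    then have z: "a0 * b1 = 0" "a1 * b0 = 0" using 01 10 nn by (smt (verit) mult_nonneg_nonneg)+
    have "0 \<le> c0 * d1" using nn by simp
    then show "a0 * b0 + a0 * b1 + a1 * b0 + a1 * b1 \<le> c0 * d0 + c0 * d1 + c1 * d0 + c1 * d1"
      using 00 11 z True by linarith
  next
    case False
    define t where "t = c1 * d0"
    have t: "0 < t" using False nn by (simp add: t_def less_le)
    have "(a0 * b1) * (a1 * b0) = (a0 * b0) * (a1 * b1)" by simp
    also have "\<dots> \<le> (c0 * d0) * (c1 * d1)" by (rule mult_mono[OF 00 11]) (use nn in simp_all)
    finally have p: "(a0 * b1) * (a1 * b0) \<le> t * (c0 * d1)" by (simp add: t_def algebra_simps)
    \<comment> \<open>Two numbers at most t whose product is at most t s have sum at most t + s.\<close>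
    have "0 \<le> (t - a0 * b1) * (t - a1 * b0)" using 01 10 by (simp add: t_def)
    then have "t * (a0 * b1 + a1 * b0) \<le> t * (t + c0 * d1)" using p by (simp add: algebra_simps)
    then have "a0 * b1 + a1 * b0 \<le> t + c0 * d1" using t by simp
    then show "a0 * b0 + a0 * b1 + a1 * b0 + a1 * b1 \<le> c0 * d0 + c0 * d1 + c1 * d0 + c1 * d1"
      using 00 11 unfolding t_def by linarith
  qed
qed

lemma four_functions:
  fixes \<alpha> \<beta> \<gamma> \<delta> :: "'a set \<Rightarrow> real"
  assumes "finite X"
    and "\<And>A. A \<subseteq> X \<Longrightarrow> 0 \<le> \<alpha> A" "\<And>A. A \<subseteq> X \<Longrightarrow> 0 \<le> \<beta> A" "\<And>A. A \<subseteq> X \<Longrightarrow> 0 \<le> \<gamma> A" "\<And>A. A \<subseteq> X \<Longrightarrow> 0 \<le> \<delta> A"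
    and "\<And>A B. A \<subseteq> X \<Longrightarrow> B \<subseteq> X \<Longrightarrow> \<alpha> A * \<beta> B \<le> \<gamma> (A \<union> B) * \<delta> (A \<inter> B)"
  shows "(\<Sum>A\<in>Pow X. \<alpha> A) * (\<Sum>A\<in>Pow X. \<beta> A) \<le> (\<Sum>A\<in>Pow X. \<gamma> A) * (\<Sum>A\<in>Pow X. \<delta> A)"
  using assms
proof (induction X arbitrary: \<alpha> \<beta> \<gamma> \<delta> rule: finite_induct)
  case empty
  then show ?case by simp
next
  case (insert x X)
  have split: "(\<Sum>A\<in>Pow (insert x X). f A) = (\<Sum>A\<in>Pow X. f A + f (insert x A))" for f :: "'a set \<Rightarrow> real"
  proof -
    have "inj_on (insert x) (Pow X)" using insert.hyps(2) by (intro inj_onI) (metis Diff_insert_absorb PowD subsetD)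
    moreover have "Pow X \<inter> insert x ` Pow X = {}" using insert.hyps(2) by auto
    ultimately show ?thesis
      using insert.hyps by (simp add: Pow_insert sum.union_disjoint sum.reindex sum.distrib)
  qed
  note nn = insert.prems(1-4)
  note four = insert.prems(5)
  show ?case
    unfolding split
  proof (rule insert.IH)
    fix A B assume A: "A \<subseteq> X" and B: "B \<subseteq> X"
    then have x: "x \<notin> A" "x \<notin> B" using insert.hyps(2) by auto
    have sub: "A \<subseteq> insert x X" "B \<subseteq> insert x X" "insert x A \<subseteq> insert x X" "insert x B \<subseteq> insert x X"
      using A B by auto
    have i: "insert x A \<inter> B = A \<inter> B" "A \<inter> insert x B = A \<inter> B" "insert x A \<inter> insert x B = insert x (A \<inter> B)"
      using x by auto
    have u: "insert x A \<union> B = insert x (A \<union> B)" "A \<union> insert x B = insert x (A \<union> B)"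
      "insert x A \<union> insert x B = insert x (A \<union> B)" by auto
    show "(\<alpha> A + \<alpha> (insert x A)) * (\<beta> B + \<beta> (insert x B))
        \<le> (\<gamma> (A \<union> B) + \<gamma> (insert x (A \<union> B))) * (\<delta> (A \<inter> B) + \<delta> (insert x (A \<inter> B)))"
      using four[OF sub(1,2)] four[OF sub(1,4)] four[OF sub(3,2)] four[OF sub(3,4)] A B
      unfolding i u by (intro four_functions_step nn) auto
  next
    fix A assume "A \<subseteq> X"
    then have "A \<subseteq> insert x X" "insert x A \<subseteq> insert x X" by auto
    then show "0 \<le> \<alpha> A + \<alpha> (insert x A)" "0 \<le> \<beta> A + \<beta> (insert x A)"
      "0 \<le> \<gamma> A + \<gamma> (insert x A)" "0 \<le> \<delta> A + \<delta> (insert x A)"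
      by (auto intro!: add_nonneg_nonneg nn)
  qed
qed

text \<open>
  Ferromagnetism: each bond is cut by the union and the intersection at most as often as by
  the two sets. The hypothesis compares the boundary conditions only next to the volume, where they act; this matters
  in \<open>local_comparison\<close>, where nothing is known about them further out.
\<close>

lemma cut_bonds_submodular:
  assumes fin: "finite \<Lambda>" and A: "A \<subseteq> \<Lambda>" and B: "B \<subseteq> \<Lambda>"
    and N: "\<And>y z. y \<in> \<Lambda> \<Longrightarrow> z \<in> N - \<Lambda> \<Longrightarrow> nearest_neighbours y z \<Longrightarrow> z \<in> N'"
  shows "card (cut_bonds \<Lambda> (A \<union> B \<union> (N' - \<Lambda>))) + card (cut_bonds \<Lambda> (A \<inter> B \<union> (N - \<Lambda>)))
       \<le> card (cut_bonds \<Lambda> (A \<union> (N - \<Lambda>))) + card (cut_bonds \<Lambda> (B \<union> (N' - \<Lambda>)))"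
proof -
  define q :: "site set \<Rightarrow> site set \<Rightarrow> nat" where "q b M = of_bool (b \<inter> M \<noteq> {} \<and> \<not> b \<subseteq> M)" for b M
  have card: "card (cut_bonds \<Lambda> M) = (\<Sum>b\<in>bonds_touching \<Lambda>. q b M)" for M
  proof -
    let ?P = "\<lambda>b. b \<inter> M \<noteq> {} \<and> \<not> b \<subseteq> M"
    have "(\<Sum>b\<in>bonds_touching \<Lambda>. of_bool (?P b)) = card (bonds_touching \<Lambda> \<inter> {b. ?P b})"
      by (simp only: sum_of_bool_eq finite_bonds_touching(1)[OF fin] of_nat_id)
    moreover have "cut_bonds \<Lambda> M = bonds_touching \<Lambda> \<inter> {b. ?P b}" unfolding cut_bonds_def by blast
    ultimately show ?thesis unfolding q_def by (simp only:)
  qed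
  have "q b (A \<union> B \<union> (N' - \<Lambda>)) + q b (A \<inter> B \<union> (N - \<Lambda>)) \<le> q b (A \<union> (N - \<Lambda>)) + q b (B \<union> (N' - \<Lambda>))"
    if bt: "b \<in> bonds_touching \<Lambda>" for b
  proof -
    obtain y z where b: "b = {y, z}" "nearest_neighbours y z" "y \<in> \<Lambda>"
    proof -
      obtain u v where uv: "b = {u, v}" "nearest_neighbours u v" "u \<in> \<Lambda> \<or> v \<in> \<Lambda>"
        using bt unfolding bonds_touching_def by blast
      then have "nearest_neighbours v u" "b = {v, u}" by (auto simp: nearest_neighbours_def)
      then show thesis using that uv by blast
    qed
    have "z \<in> N - \<Lambda> \<longrightarrow> z \<in> N'" using N b by blast
    have q: "q b M = of_bool ((y \<in> M) \<noteq> (z \<in> M))" for M unfolding q_def b(1) by auto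
    have y: "y \<in> A \<union> B \<union> (N' - \<Lambda>) \<longleftrightarrow> y \<in> A \<or> y \<in> B" "y \<in> A \<inter> B \<union> (N - \<Lambda>) \<longleftrightarrow> y \<in> A \<and> y \<in> B"
      "y \<in> A \<union> (N - \<Lambda>) \<longleftrightarrow> y \<in> A" "y \<in> B \<union> (N' - \<Lambda>) \<longleftrightarrow> y \<in> B"
      using b(3) by blast+
    show ?thesis
    proof (cases "z \<in> \<Lambda>")
      case True
      then have z: "z \<in> A \<union> B \<union> (N' - \<Lambda>) \<longleftrightarrow> z \<in> A \<or> z \<in> B" "z \<in> A \<inter> B \<union> (N - \<Lambda>) \<longleftrightarrow> z \<in> A \<and> z \<in> B"
        "z \<in> A \<union> (N - \<Lambda>) \<longleftrightarrow> z \<in> A" "z \<in> B \<union> (N' - \<Lambda>) \<longleftrightarrow> z \<in> B"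
        by blast+
      show ?thesis unfolding q y z
        by (cases "y \<in> A"; cases "y \<in> B"; cases "z \<in> A"; cases "z \<in> B") simp_all
    next
      case False
      then have z: "z \<in> A \<union> B \<union> (N' - \<Lambda>) \<longleftrightarrow> z \<in> N'" "z \<in> A \<inter> B \<union> (N - \<Lambda>) \<longleftrightarrow> z \<in> N"
        "z \<in> A \<union> (N - \<Lambda>) \<longleftrightarrow> z \<in> N" "z \<in> B \<union> (N' - \<Lambda>) \<longleftrightarrow> z \<in> N'" "z \<in> N \<longrightarrow> z \<in> N'"
        using A B \<open>z \<in> N - \<Lambda> \<longrightarrow> z \<in> N'\<close> by blast+
      show ?thesis unfolding q y z(1-4) using z(5)
        by (cases "y \<in> A"; cases "y \<in> B"; cases "z \<in> N"; cases "z \<in> N'") simp_all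
    qed
  qed
  then show ?thesis unfolding card sum.distrib[symmetric] by (rule sum_mono)
qed

text \<open>
  The FKG inequality in Holley's form, comparing two boundary conditions.
\<close>

theorem gibbs_mean_increasing_bc:
  assumes \<beta>: "0 \<le> \<beta>" and fin: "finite \<Lambda>" and f: "mono f" and f0: "\<And>M. 0 \<le> f M"
    and N: "\<And>y z. y \<in> \<Lambda> \<Longrightarrow> z \<in> N - \<Lambda> \<Longrightarrow> nearest_neighbours y z \<Longrightarrow> z \<in> N'"
  shows "gibbs_mean \<beta> \<Lambda> N (\<lambda>M. f (M \<inter> \<Lambda>)) \<le> gibbs_mean \<beta> \<Lambda> N' (\<lambda>M. f (M \<inter> \<Lambda>))"
proof -
  let ?w = "\<lambda>N A. weight \<beta> \<Lambda> (A \<union> (N - \<Lambda>))"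
  have four: "(\<Sum>A\<in>Pow \<Lambda>. ?w N A * f A) * (\<Sum>A\<in>Pow \<Lambda>. ?w N' A)
      \<le> (\<Sum>A\<in>Pow \<Lambda>. ?w N' A * f A) * (\<Sum>A\<in>Pow \<Lambda>. ?w N A)"
  proof (rule four_functions[OF fin])
    fix A B assume AB: "A \<subseteq> \<Lambda>" "B \<subseteq> \<Lambda>"
    have "card (cut_bonds \<Lambda> (A \<union> B \<union> (N' - \<Lambda>))) + card (cut_bonds \<Lambda> (A \<inter> B \<union> (N - \<Lambda>)))
       \<le> card (cut_bonds \<Lambda> (A \<union> (N - \<Lambda>))) + card (cut_bonds \<Lambda> (B \<union> (N' - \<Lambda>)))"
      by (rule cut_bonds_submodular[OF fin AB N])
    then have "real (card (cut_bonds \<Lambda> (A \<union> B \<union> (N' - \<Lambda>)))) + real (card (cut_bonds \<Lambda> (A \<inter> B \<union> (N - \<Lambda>))))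
       \<le> real (card (cut_bonds \<Lambda> (A \<union> (N - \<Lambda>)))) + real (card (cut_bonds \<Lambda> (B \<union> (N' - \<Lambda>))))"
      by linarith
    from mult_left_mono[OF this \<beta>] have w: "?w N A * ?w N' B \<le> ?w N' (A \<union> B) * ?w N (A \<inter> B)"
      by (simp add: weight_def exp_add[symmetric] algebra_simps)
    have "?w N A * f A * ?w N' B = ?w N A * ?w N' B * f A" by simp
    also have "\<dots> \<le> ?w N' (A \<union> B) * ?w N (A \<inter> B) * f (A \<union> B)"
      by (rule mult_mono[OF w]) (use monoD[OF f] f0 in \<open>auto simp: weight_pos less_imp_le\<close>)
    finally show "?w N A * f A * ?w N' B \<le> ?w N' (A \<union> B) * f (A \<union> B) * ?w N (A \<inter> B)"
      by (simp add: algebra_simps)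
  qed (auto simp: weight_pos less_imp_le f0)
  have num: "(\<Sum>M\<in>confs \<Lambda> K. weight \<beta> \<Lambda> M * f (M \<inter> \<Lambda>)) = (\<Sum>A\<in>Pow \<Lambda>. ?w K A * f A)" for K
    unfolding sum_confs
  proof (rule sum.cong[OF refl])
    fix A assume "A \<in> Pow \<Lambda>"
    then have "(A \<union> (K - \<Lambda>)) \<inter> \<Lambda> = A" by blast
    then show "?w K A * f ((A \<union> (K - \<Lambda>)) \<inter> \<Lambda>) = ?w K A * f A" by simp
  qed
  have den: "partition_sum \<beta> \<Lambda> K = (\<Sum>A\<in>Pow \<Lambda>. ?w K A)" for K
    unfolding partition_sum_def sum_confs ..
  show ?thesis
    unfolding gibbs_mean_def num
    using four partition_sum_pos[OF fin, of \<beta> N] partition_sum_pos[OF fin, of \<beta> N']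
    unfolding den by (simp add: field_simps)
qed

lemma gibbs_mean_mono_bc:
  assumes \<beta>: "0 \<le> \<beta>" and fin: "finite \<Lambda>" and f: "mono f" and f0: "\<And>M. 0 \<le> f M"
    and N: "N - \<Lambda> \<subseteq> N'"
  shows "gibbs_mean \<beta> \<Lambda> N f \<le> gibbs_mean \<beta> \<Lambda> N' f"
proof -
  define g where "g A = f (A \<union> (N - \<Lambda>))" for A
  have "gibbs_mean \<beta> \<Lambda> N f = gibbs_mean \<beta> \<Lambda> N (\<lambda>M. g (M \<inter> \<Lambda>))"
  proof (rule gibbs_mean_cong[OF refl])
    fix M assume "M \<in> confs \<Lambda> N"
    then have "M = M \<inter> \<Lambda> \<union> (N - \<Lambda>)" unfolding confs_def by blast
    then show "f M = g (M \<inter> \<Lambda>)" unfolding g_def by simp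
  qed
  also have "\<dots> \<le> gibbs_mean \<beta> \<Lambda> N' (\<lambda>M. g (M \<inter> \<Lambda>))"
  proof (rule gibbs_mean_increasing_bc[OF \<beta> fin])
    show "mono g" unfolding g_def by (intro monoI monoD[OF f]) blast
  qed (use N f0 in \<open>auto simp: g_def\<close>)
  also have "\<dots> \<le> gibbs_mean \<beta> \<Lambda> N' f"
  proof (rule gibbs_mean_mono[OF fin])
    fix M assume "M \<in> confs \<Lambda> N'"
    then have "M \<inter> \<Lambda> \<union> (N - \<Lambda>) \<subseteq> M" using N unfolding confs_def by blast
    then show "g (M \<inter> \<Lambda>) \<le> f M" unfolding g_def by (rule monoD[OF f])
  qed
  finally show ?thesis .
qed

text \<open>
  Sites off a volume that are not minus by the boundary condition are plus. Enlarging the volume sets them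
  free, which can only add minus spins.
\<close>

lemma gibbs_mean_mono_volume:
  assumes \<beta>: "0 \<le> \<beta>" and fin: "finite \<Lambda>" and f: "mono f" and f0: "\<And>M. 0 \<le> f M"
    and sub: "\<Lambda>' \<subseteq> \<Lambda>" and N: "N \<inter> \<Lambda> = {}"
  shows "gibbs_mean \<beta> \<Lambda>' N f \<le> gibbs_mean \<beta> \<Lambda> N f"
proof -
  have "gibbs_mean \<beta> \<Lambda>' N f = gibbs_mean \<beta> \<Lambda> N (\<lambda>M. gibbs_mean \<beta> \<Lambda>' N f)"
    by (rule gibbs_mean_const[OF fin, symmetric])
  also have "\<dots> \<le> gibbs_mean \<beta> \<Lambda> N (\<lambda>M. gibbs_mean \<beta> \<Lambda>' M f)"
  proof (rule gibbs_mean_mono[OF fin])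
    fix M assume "M \<in> confs \<Lambda> N"
    then have "N - \<Lambda>' \<subseteq> M" using N unfolding confs_def by blast
    then show "gibbs_mean \<beta> \<Lambda>' N f \<le> gibbs_mean \<beta> \<Lambda>' M f"
      using gibbs_mean_mono_bc[OF \<beta> _ f f0] finite_subset[OF sub fin] by blast
  qed
  also have "\<dots> = gibbs_mean \<beta> \<Lambda> N f" by (rule gibbs_mean_consistent[OF fin sub, symmetric])
  finally show ?thesis .
qed


section \<open>The Peierls estimate in the presence of frozen spins\<close>

lemma in_bdry_iff: "b \<in> bdry M \<longleftrightarrow> (\<exists>y z. b = {y, z} \<and> nearest_neighbours y z \<and> y \<in> M \<and> z \<notin> M)"
  unfolding bdry_def by blast

text \<open>
  Flipping the free spins inside a contour. Bonds that do not touch a frozen site inside behave as if everything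
  inside were flipped: those of the contour become satisfied, the others keep their status. There are at most four
  exceptional bonds for every frozen site inside, each of which may cost twice: as a bond of the contour that is not gained,
  and as a bond that becomes unsatisfied.
\<close>

lemma flip_interior_card:
  assumes fin: "finite \<Gamma>" "finite H" and M: "bdry H \<subseteq> bdry M"
  shows "card (cut_bonds \<Gamma> (sym_diff M (H \<inter> \<Gamma>))) + card (bdry H)
       \<le> card (cut_bonds \<Gamma> M) + 8 * card (H - \<Gamma>)"
proof -
  let ?T = "sym_diff M (H \<inter> \<Gamma>)" and ?Q = "bonds_touching (H - \<Gamma>)"
  have finQ: "finite ?Q" and Q: "card ?Q \<le> 4 * card (H - \<Gamma>)"
    using finite_bonds_touching[of "H - \<Gamma>"] fin by auto
  have fc: "finite (cut_bonds \<Gamma> K)" for K by (rule finite_cut_bonds[OF fin(1)])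
  have fb: "finite (bdry H)" by (rule finite_bdry[OF fin(2)])
  have sub1: "bdry H - ?Q \<subseteq> cut_bonds \<Gamma> M"
  proof
    fix b assume b: "b \<in> bdry H - ?Q"
    then have "b \<in> bdry H" by (rule DiffD1)
    then obtain y z where yz: "b = {y, z}" "nearest_neighbours y z" "y \<in> H" "z \<notin> H"
      unfolding in_bdry_iff by blast
    have "y \<in> \<Gamma>" using b yz unfolding bonds_touching_def by blast
    then have "b \<in> bonds_touching \<Gamma>" using yz unfolding bonds_touching_def by blast
    moreover have "b \<in> bdry M" using b M by blast
    ultimately show "b \<in> cut_bonds \<Gamma> M" unfolding cut_bonds_def in_bdry_iff by blast
  qed
  have sub2: "cut_bonds \<Gamma> ?T \<subseteq> (cut_bonds \<Gamma> M - (bdry H - ?Q)) \<union> ?Q"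
  proof
    fix b assume b: "b \<in> cut_bonds \<Gamma> ?T"
    then obtain y z where yz: "b = {y, z}" "nearest_neighbours y z"
      unfolding cut_bonds_def bonds_touching_def by blast
    show "b \<in> (cut_bonds \<Gamma> M - (bdry H - ?Q)) \<union> ?Q"
    proof (cases "b \<in> ?Q")
      case False
      then have in\<Gamma>: "y \<in> H \<longrightarrow> y \<in> \<Gamma>" "z \<in> H \<longrightarrow> z \<in> \<Gamma>" using yz unfolding bonds_touching_def by blast+
      have T: "(y \<in> ?T) \<noteq> (z \<in> ?T)" using b yz(1) unfolding cut_bonds_def by blast
      have tM: "(y \<in> ?T) = ((y \<in> M) \<noteq> (y \<in> H))" "(z \<in> ?T) = ((z \<in> M) \<noteq> (z \<in> H))" using in\<Gamma> by blast+
      have nb: "b \<notin> bdry H"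
      proof
        assume bH: "b \<in> bdry H"
        then have "b \<in> bdry M" using M by blast
        then have "(y \<in> M) \<noteq> (z \<in> M)" using pair_in_bdry_iff[OF yz(2)] yz(1) by blast
        moreover have "(y \<in> H) \<noteq> (z \<in> H)" using bH pair_in_bdry_iff[OF yz(2)] yz(1) by blast
        ultimately show False using T tM by blast
      qed
      then have "(y \<in> H) = (z \<in> H)" using pair_in_bdry_iff[OF yz(2)] yz(1) by blast
      then have "(y \<in> M) \<noteq> (z \<in> M)" using T tM by blast
      then have "b \<in> cut_bonds \<Gamma> M" using b yz(1) unfolding cut_bonds_def by blast
      then show ?thesis using nb by blast
    qed blast
  qed
  have "card (cut_bonds \<Gamma> ?T) \<le> card ((cut_bonds \<Gamma> M - (bdry H - ?Q)) \<union> ?Q)"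
    by (rule card_mono[OF _ sub2]) (use fc finQ in blast)
  also have "\<dots> \<le> card (cut_bonds \<Gamma> M - (bdry H - ?Q)) + card ?Q" by (rule card_Un_le)
  finally have 1: "card (cut_bonds \<Gamma> ?T) \<le> card (cut_bonds \<Gamma> M - (bdry H - ?Q)) + card ?Q" .
  have 2: "card (cut_bonds \<Gamma> M - (bdry H - ?Q)) + card (bdry H - ?Q) = card (cut_bonds \<Gamma> M)"
    using card_Diff_subset[OF _ sub1] card_mono[OF fc sub1] fb by simp
  have 3: "card (bdry H) \<le> card (bdry H - ?Q) + card ?Q"
    by (rule order_trans[OF card_mono card_Un_le]) (use fb finQ in auto)
  show ?thesis using 1 2 3 Q by linarith
qed

text \<open>
  The flip is an involution of the configurations that improves the weight by the claimed factor.
\<close>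

lemma peierls_single_contour:
  assumes \<beta>: "0 \<le> \<beta>" and fin: "finite \<Gamma>" "finite H"
  shows "gibbs_mean \<beta> \<Gamma> N (\<lambda>M. of_bool (bdry H \<subseteq> bdry M))
       \<le> exp (- 2 * \<beta> * (real (card (bdry H)) - 8 * real (card (H - \<Gamma>))))" (is "_ \<le> ?e")
proof -
  let ?T = "\<lambda>M. sym_diff M (H \<inter> \<Gamma>)"
  have TT: "?T (?T M) = M" for M by blast
  have inj: "inj_on ?T (confs \<Gamma> N)" by (rule inj_on_inverseI[of _ ?T]) (rule TT)
  have Tc: "?T M \<in> confs \<Gamma> N" if "M \<in> confs \<Gamma> N" for M using that unfolding confs_def by blast
  have img: "?T ` confs \<Gamma> N = confs \<Gamma> N"
  proof
    show "confs \<Gamma> N \<subseteq> ?T ` confs \<Gamma> N" using Tc TT by (metis (no_types, lifting) image_eqI subsetI)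
  qed (use Tc in blast)
  have w: "weight \<beta> \<Gamma> M * of_bool (bdry H \<subseteq> bdry M) \<le> ?e * weight \<beta> \<Gamma> (?T M)" for M
  proof (cases "bdry H \<subseteq> bdry M")
    case True
    from flip_interior_card[OF fin True]
    have "real (card (cut_bonds \<Gamma> (?T M))) + real (card (bdry H))
        \<le> real (card (cut_bonds \<Gamma> M)) + 8 * real (card (H - \<Gamma>))" by linarith
    from mult_left_mono[OF this \<beta>] True show ?thesis
      by (simp add: weight_def exp_add[symmetric] algebra_simps)
  qed (simp add: weight_pos less_imp_le)
  have "(\<Sum>M\<in>confs \<Gamma> N. weight \<beta> \<Gamma> M * of_bool (bdry H \<subseteq> bdry M))
      \<le> (\<Sum>M\<in>confs \<Gamma> N. ?e * weight \<beta> \<Gamma> (?T M))" by (rule sum_mono) (rule w)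
  also have "\<dots> = ?e * (\<Sum>M\<in>?T ` confs \<Gamma> N. weight \<beta> \<Gamma> M)"
    by (simp add: sum.reindex[OF inj] sum_distrib_left)
  also have "\<dots> = ?e * partition_sum \<beta> \<Gamma> N" by (simp add: img partition_sum_def)
  finally show ?thesis
    unfolding gibbs_mean_def using partition_sum_pos[OF fin(1), of \<beta> N] by (simp add: divide_le_eq)
qed

definition reaches :: "nat \<Rightarrow> site \<Rightarrow> site set \<Rightarrow> bool" where
  "reaches R x M \<longleftrightarrow> x \<in> M \<and>
     (\<exists>y\<in>nn_component M x. int R \<le> \<bar>fst y - fst x\<bar> \<or> int R \<le> \<bar>snd y - snd x\<bar>)"

text \<open>
  The density 1/16 is half of what \<open>flip_interior_card\<close> tolerates: a contour around a cluster that occupies \<open>l\<close> columns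
  has at least \<open>l\<close> bonds, and loses at most half of them to at most \<open>l / 16\<close> frozen spins.
\<close>

definition sparse_around :: "int set \<Rightarrow> int \<Rightarrow> nat \<Rightarrow> bool" where
  "sparse_around S j L \<longleftrightarrow>
     (\<forall>a b. a \<le> j \<and> j \<le> b \<and> int L \<le> b - a + 1 \<longrightarrow> 16 * int (card (S \<inter> {a..b})) \<le> b - a + 1)"

lemma nn_step_mono: "M \<subseteq> M' \<Longrightarrow> nn_step M \<subseteq> nn_step M'"
  unfolding nn_step_def by blast

lemma nn_component_mono: "M \<subseteq> M' \<Longrightarrow> nn_component M x \<subseteq> nn_component M' x"
  unfolding nn_component_def using rtrancl_mono[OF nn_step_mono] by blast

lemma mono_reaches: "mono (\<lambda>M. of_bool (reaches R x M) :: real)"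
proof (rule monoI)
  fix M M' :: "site set" assume "M \<subseteq> M'"
  then have "reaches R x M \<Longrightarrow> reaches R x M'" unfolding reaches_def using nn_component_mono by blast
  then show "(of_bool (reaches R x M) :: real) \<le> of_bool (reaches R x M')" by simp
qed

text \<open>
  Either the cluster is wide, and then the set of frozen sites is sparse in its interval of columns; or it is narrow, and then there
  are at most \<open>L\<close> frozen sites inside, while the cluster is high and has a contour of length at least \<open>R\<close>.
\<close>

lemma reaches_gives_contour:
  assumes sparse: "sparse_around S (fst x) L" and R: "16 * L \<le> R" "1 \<le> R"
    and \<Delta>: "\<Delta> \<subseteq> S \<times> {0}" and \<Lambda>: "\<Lambda> = {- K..K} \<times> {- K..K}" and M: "M \<subseteq> \<Lambda>" and reach: "reaches R x M"
  obtains E where "E \<in> contours x (card E)" "R \<le> card E" "E \<subseteq> bdry M"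
    "finite (contour_interior E)" "bdry (contour_interior E) = E"
    "16 * card (contour_interior E - (\<Lambda> - \<Delta>)) \<le> card E"
proof -
  have x: "x \<in> M" using reach by (simp add: reaches_def)
  have finM: "finite M" by (rule finite_subset[OF M]) (simp add: \<Lambda>)
  let ?C = "nn_component M x"
  obtain E i where H: "finite (contour_interior E)" "bdry (contour_interior E) = E" "E \<subseteq> bdry M"
    "fst ` contour_interior E = fst ` ?C" "snd ` contour_interior E = snd ` ?C"
    "fst x \<le> i" "i < fst x + int (card E)" "contour_connected E (hbond i (snd x))"
    using exists_contour[OF finM x] by metis
  let ?H = "contour_interior E"
  have C: "?C \<subseteq> M" by (rule nn_component_subset[OF x])
  then have finC: "finite ?C" using finM finite_subset by blast
  have finE: "finite E" using H(1,2) finite_bdry by metis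
  have cols: "card (fst ` ?C) \<le> card E" using card_columns_le_bdry[OF H(1)] H(2,4) by simp
  have rows: "card (snd ` ?C) \<le> card E" using card_rows_le_bdry[OF H(1)] H(2,5) by simp
  \<comment> \<open>The columns met by the cluster form an interval.\<close>
  let ?I = "fst ` ?C"
  define a b where "a = Min ?I" and "b = Max ?I"
  have jI: "fst x \<in> ?I" using self_in_nn_component by blast
  have aI: "a \<in> ?I" and bI: "b \<in> ?I" unfolding a_def b_def using finC jI by (auto intro!: Min_in Max_in)
  have ab: "a \<le> c" "c \<le> b" if "c \<in> ?I" for c unfolding a_def b_def using that finC by auto
  obtain ya yb where "ya \<in> ?C" "a = fst ya" "yb \<in> ?C" "b = fst yb" using aI bI by blast
  then have "{a..fst x} \<subseteq> ?I" "{fst x..b} \<subseteq> ?I" using nn_component_columns[OF _ x] by auto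
  then have "{a..b} \<subseteq> ?I" using ab[OF jI] by fastforce
  then have I: "?I = {a..b}" using ab by fastforce
  have cardI: "int (card ?I) = b - a + 1" unfolding I using ab[OF jI] by simp
  obtain y where y: "y \<in> ?C" "int R \<le> \<bar>fst y - fst x\<bar> \<or> int R \<le> \<bar>snd y - snd x\<bar>"
    using reach by (auto simp: reaches_def)
  have far1: "R \<le> card ?I" if "int R \<le> \<bar>fst y - fst x\<bar>"
  proof -
    have "fst y \<in> {a..b}" "fst x \<in> {a..b}" using I y(1) jI by blast+
    then have "int R \<le> int (card ?I)" using that unfolding cardI by auto
    then show ?thesis by simp
  qed
  have far2: "R \<le> card (snd ` ?C)" if "int R \<le> \<bar>snd y - snd x\<bar>"
  proof -
    have "{snd x..snd y} \<union> {snd y..snd x} \<subseteq> snd ` ?C" by (rule nn_component_rows[OF y(1) x])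
    then have "card {snd x..snd y} \<le> card (snd ` ?C)" "card {snd y..snd x} \<le> card (snd ` ?C)"
      by (intro card_mono[OF finite_imageI[OF finC]]; simp)+
    then show ?thesis using that by auto
  qed
  have RE: "R \<le> card E" using far1 far2 y(2) cols rows by linarith
  have "?H \<subseteq> {- K..K} \<times> {- K..K}"
  proof
    fix h assume h: "h \<in> ?H"
    have "fst h \<in> fst ` ?C" "snd h \<in> snd ` ?C" using h H(4,5) by blast+
    moreover have "fst ` ?C \<subseteq> {- K..K}" "snd ` ?C \<subseteq> {- K..K}" using C M unfolding \<Lambda> by fastforce+
    ultimately show "h \<in> {- K..K} \<times> {- K..K}" by (metis mem_Sigma_iff prod.collapse subsetD)
  qed
  then have "?H - (\<Lambda> - \<Delta>) \<subseteq> \<Delta> \<inter> ?H" unfolding \<Lambda> by blast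
  also have "\<dots> \<subseteq> (S \<inter> ?I) \<times> {0}"
  proof
    fix h assume h: "h \<in> \<Delta> \<inter> ?H"
    then have "fst h \<in> ?I" using H(4) by blast
    moreover have "h \<in> S \<times> {0}" using h \<Delta> by blast
    ultimately show "h \<in> (S \<inter> ?I) \<times> {0}" by force
  qed
  finally have "card (?H - (\<Lambda> - \<Delta>)) \<le> card ((S \<inter> ?I) \<times> {0 :: int})"
    by (intro card_mono) (use finC in auto)
  then have k: "card (?H - (\<Lambda> - \<Delta>)) \<le> card (S \<inter> ?I)" by (simp add: card_cartesian_product)
  have dens: "16 * card (S \<inter> ?I) \<le> card E"
  proof (cases "L \<le> card ?I")
    case True
    then have "int L \<le> b - a + 1" using cardI by linarith
    then have "16 * int (card (S \<inter> {a..b})) \<le> b - a + 1"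
      using sparse ab[OF jI] unfolding sparse_around_def by blast
    then have "16 * card (S \<inter> ?I) \<le> card ?I" unfolding I[symmetric] cardI[symmetric] by linarith
    then show ?thesis using cols by linarith
  next
    case False
    have "card (S \<inter> ?I) \<le> card ?I" using finC by (intro card_mono) auto
    then show ?thesis using False R RE by linarith
  qed
  show thesis
  proof (rule that[of E])
    show "E \<in> contours x (card E)" using finE H(6-8) unfolding contours_def by blast
    show "16 * card (?H - (\<Lambda> - \<Delta>)) \<le> card E" using k dens by linarith
  qed (use RE H in auto)
qed

lemma geometric_tail_le:
  assumes "R \<le> Suc m"
  shows "(\<Sum>n = R..m. (1 / 2 :: real) ^ n) \<le> 2 * (1 / 2) ^ R"
proof -
  have "(\<Sum>n = R..m. (1 / 2 :: real) ^ n) = 2 * (1/2) ^ R - 2 * (1/2) ^ Suc m"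
    using assms by (induction m) (auto simp: le_Suc_eq)
  then show ?thesis by simp
qed

text \<open>
  By \<open>sparse_around\<close> a contour of \<open>n\<close> bonds has probability at most \<open>exp (- \<beta> n)\<close>, and there are at most
  \<open>n 256^n\<close>, hence at most \<open>512^n\<close>, candidates. The volume is first enlarged to a box, which is harmless for an increasing event:
  otherwise the contour could enclose plus spins outside the volume, which cannot be flipped.
\<close>

theorem peierls_estimate:
  assumes \<beta>: "ln 1024 \<le> \<beta>" and sparse: "sparse_around S (fst x) L" and R: "16 * L \<le> R" "1 \<le> R"
    and fin: "finite \<Lambda>" and \<Delta>: "\<Delta> \<subseteq> S \<times> {0}" "finite \<Delta>" and N: "N \<subseteq> \<Delta>"
  shows "gibbs_mean \<beta> (\<Lambda> - \<Delta>) N (\<lambda>M. of_bool (reaches R x M)) \<le> 2 * (1 / 2) ^ R"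
proof -
  have \<beta>0: "0 \<le> \<beta>" using \<beta> ln_ge_zero[of 1024] by linarith
  have "finite (\<Lambda> \<union> \<Delta>)" using fin \<Delta> by blast
  from finite_site_set_bounded[OF this] obtain K
    where "\<forall>z\<in>\<Lambda> \<union> \<Delta>. \<bar>fst z\<bar> < K \<and> \<bar>snd z\<bar> < K" ..
  note K = bspec[OF this]
  define \<Lambda>' where "\<Lambda>' = {- K..K} \<times> {- K..K}"
  have sub: "\<Lambda> \<union> \<Delta> \<subseteq> \<Lambda>'"
  proof
    fix z assume "z \<in> \<Lambda> \<union> \<Delta>"
    from K[OF this] show "z \<in> \<Lambda>'" unfolding \<Lambda>'_def by (cases z) auto
  qed
  have fin': "finite \<Lambda>'" by (simp add: \<Lambda>'_def)
  let ?\<Gamma> = "\<Lambda>' - \<Delta>" and ?m = "card (bonds_touching \<Lambda>')"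
  let ?good = "\<lambda>E. finite (contour_interior E) \<and> bdry (contour_interior E) = E \<and>
      16 * card (contour_interior E - ?\<Gamma>) \<le> card E"
  have "gibbs_mean \<beta> (\<Lambda> - \<Delta>) N (\<lambda>M. of_bool (reaches R x M))
      \<le> gibbs_mean \<beta> ?\<Gamma> N (\<lambda>M. of_bool (reaches R x M))"
    by (rule gibbs_mean_mono_volume[OF \<beta>0]) (use fin' sub N mono_reaches in auto)
  also have "\<dots> \<le> gibbs_mean \<beta> ?\<Gamma> N
      (\<lambda>M. \<Sum>n = R..?m. \<Sum>E | E \<in> contours x n \<and> ?good E. of_bool (bdry (contour_interior E) \<subseteq> bdry M))"
  proof (rule gibbs_mean_mono)
    show "finite ?\<Gamma>" using fin' by simp
    fix M assume M: "M \<in> confs ?\<Gamma> N"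
    have M\<Lambda>: "M \<subseteq> \<Lambda>'" using M N sub unfolding confs_def by blast
    have fg: "finite {E. E \<in> contours x n \<and> ?good E}" for n
      using card_contours(1)[of x n] by (rule rev_finite_subset) blast
    show "of_bool (reaches R x M) \<le> (\<Sum>n = R..?m. \<Sum>E | E \<in> contours x n \<and> ?good E.
        (of_bool (bdry (contour_interior E) \<subseteq> bdry M) :: real))"
    proof (cases "reaches R x M")
      case True
      obtain F where F: "F \<in> contours x (card F)" "R \<le> card F" "F \<subseteq> bdry M" "?good F"
        using reaches_gives_contour[OF sparse R \<Delta>(1) \<Lambda>'_def M\<Lambda> True] by metis
      have "F \<subseteq> bonds_touching \<Lambda>'"
        using F(3) bdry_subset_touching[of M] bonds_touching_mono[OF M\<Lambda>] by blast
      then have m: "card F \<in> {R..?m}" using F(2) card_mono[OF finite_bonds_touching(1)[OF fin']] by simp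
      have "(1 :: real) = of_bool (bdry (contour_interior F) \<subseteq> bdry M)" using F by simp
      also have "\<dots> \<le> (\<Sum>E | E \<in> contours x (card F) \<and> ?good E. of_bool (bdry (contour_interior E) \<subseteq> bdry M))"
        by (rule member_le_sum[OF _ _ fg[of "card F"]]) (use F in auto)
      also have "\<dots> \<le> (\<Sum>n = R..?m. \<Sum>E | E \<in> contours x n \<and> ?good E. of_bool (bdry (contour_interior E) \<subseteq> bdry M))"
        by (rule member_le_sum[OF m]) (auto intro!: sum_nonneg)
      finally show ?thesis using True by simp
    qed (auto intro!: sum_nonneg)
  qed
  also have "\<dots> = (\<Sum>n = R..?m. \<Sum>E | E \<in> contours x n \<and> ?good E.
      gibbs_mean \<beta> ?\<Gamma> N (\<lambda>M. of_bool (bdry (contour_interior E) \<subseteq> bdry M)))"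
    by (simp only: gibbs_mean_sum)
  also have "\<dots> \<le> (\<Sum>n = R..?m. (1 / 2) ^ n)"
  proof (rule sum_mono)
    fix n
    have "gibbs_mean \<beta> ?\<Gamma> N (\<lambda>M. of_bool (bdry (contour_interior E) \<subseteq> bdry M)) \<le> (1 / 1024) ^ n"
      if "E \<in> {E. E \<in> contours x n \<and> ?good E}" for E
    proof -
      have E: "card E = n" "?good E" using that unfolding contours_def by blast+
      have "gibbs_mean \<beta> ?\<Gamma> N (\<lambda>M. of_bool (bdry (contour_interior E) \<subseteq> bdry M))
          \<le> exp (- 2 * \<beta> * (real (card (bdry (contour_interior E))) - 8 * real (card (contour_interior E - ?\<Gamma>))))"
        by (rule peierls_single_contour[OF \<beta>0]) (use fin' E in auto)
      also have "\<dots> \<le> exp (real n * (- ln 1024))"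
      proof -
        have "8 * real (card (contour_interior E - ?\<Gamma>)) \<le> real n / 2" using E by linarith
        then have "real n / 2 \<le> real (card (bdry (contour_interior E))) - 8 * real (card (contour_interior E - ?\<Gamma>))"
          using E by simp
        then have "2 * \<beta> * (real n / 2)
            \<le> 2 * \<beta> * (real (card (bdry (contour_interior E))) - 8 * real (card (contour_interior E - ?\<Gamma>)))"
          using \<beta>0 by (intro mult_left_mono) auto
        moreover have "ln 1024 * real n \<le> \<beta> * real n" using \<beta> by (rule mult_right_mono) simp
        ultimately show ?thesis by (simp add: algebra_simps)
      qed
      also have "\<dots> = (1 / 1024) ^ n" by (simp add: exp_of_nat_mult exp_minus field_simps)
      finally show ?thesis .
    qed
    then have "(\<Sum>E | E \<in> contours x n \<and> ?good E.
        gibbs_mean \<beta> ?\<Gamma> N (\<lambda>M. of_bool (bdry (contour_interior E) \<subseteq> bdry M)))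
        \<le> (\<Sum>E | E \<in> contours x n \<and> ?good E. (1 / 1024) ^ n)" by (rule sum_mono)
    also have "\<dots> \<le> real (n * 256 ^ n) * (1 / 1024) ^ n"
    proof -
      have "card {E. E \<in> contours x n \<and> ?good E} \<le> card (contours x n)"
        by (rule card_mono[OF card_contours(1)]) blast
      also have "\<dots> \<le> n * 256 ^ n" by (rule card_contours(2))
      finally show ?thesis by (simp del: of_nat_mult of_nat_power add: mult_right_mono)
    qed
    also have "\<dots> \<le> (2 ^ n * 256 ^ n) * (1 / 1024) ^ n"
    proof -
      have "real n \<le> 2 ^ n" using less_exp[of n] by (metis less_imp_le of_nat_le_iff of_nat_numeral of_nat_power)
      then show ?thesis by (simp add: mult_right_mono)
    qed
    also have "\<dots> = (1 / 2) ^ n" by (simp add: power_mult_distrib[symmetric])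
    finally show "(\<Sum>E | E \<in> contours x n \<and> ?good E.
        gibbs_mean \<beta> ?\<Gamma> N (\<lambda>M. of_bool (bdry (contour_interior E) \<subseteq> bdry M))) \<le> (1 / 2) ^ n" .
  qed
  also have "\<dots> \<le> 2 * (1 / 2) ^ R"
  proof (cases "R \<le> Suc ?m")
    case False
    then show ?thesis by simp
  qed (rule geometric_tail_le)
  finally show ?thesis .
qed


section \<open>Exploring the minus clusters from outside\<close>

text \<open>
  What is seen when all minus clusters that enter the box \<open>B\<close> from outside are explored.
\<close>

inductive_set explored :: "site set \<Rightarrow> site set \<Rightarrow> site set" for B M where
  outside: "z \<notin> B \<Longrightarrow> z \<in> explored B M"
| step: "y \<in> explored B M \<Longrightarrow> nearest_neighbours y z \<Longrightarrow> z \<in> M \<Longrightarrow> z \<in> explored B M"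

text \<open>
  The unexplored sites next to an explored site are known to be plus; the core consists of the others, about which the
  exploration gives no information.
\<close>

definition unexplored_core :: "site set \<Rightarrow> site set" where
  "unexplored_core Q = {z. z \<notin> Q \<and> (\<forall>y. nearest_neighbours y z \<longrightarrow> y \<notin> Q)}"

lemma explored_local:
  assumes "M - unexplored_core (explored B M) = M' - unexplored_core (explored B M)"
  shows "explored B M' = explored B M"
proof
  let ?D = "unexplored_core (explored B M)"
  show "explored B M' \<subseteq> explored B M"
  proof
    fix z assume "z \<in> explored B M'"
    then show "z \<in> explored B M"
    proof induction
      case (step y z)
      then have "z \<notin> ?D" unfolding unexplored_core_def by blast
      then have "z \<in> M" using step assms by blast
      then show ?case using step explored.step by blast
    qed (rule explored.outside)
  qed
  show "explored B M \<subseteq> explored B M'"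
  proof
    fix z assume "z \<in> explored B M"
    then show "z \<in> explored B M'"
    proof induction
      case (step y z)
      have "z \<in> explored B M" using step explored.step by blast
      then have "z \<notin> ?D" unfolding unexplored_core_def by blast
      then have "z \<in> M'" using step assms by blast
      then show ?case using step explored.step by blast
    qed (rule explored.outside)
  qed
qed

lemma plus_around_core:
  assumes "z \<notin> unexplored_core (explored B M)" "z \<notin> explored B M"
  shows "z \<notin> M"
  using assms explored.step unfolding unexplored_core_def by blast

text \<open>
  Condition on the explored set. Unless \<open>x\<close> is explored, which is the error term, it is either plus or in the core.
  The core is surrounded by plus spins and by frozen spins that both models share. In the other
  model the core has the same frozen spins and a boundary condition with more minus spins, so the probability
  of a minus spin at \<open>x\<close> is larger there, by the FKG inequality.
\<close>

theorem local_comparison: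
  assumes \<beta>: "0 \<le> \<beta>" and fin: "finite \<Gamma>" "finite \<Gamma>'" and x: "x \<in> \<Gamma>"
    and \<Gamma>: "\<Gamma> \<inter> B = \<Gamma>' \<inter> B" and N: "(N - \<Gamma>) \<inter> B = (N' - \<Gamma>') \<inter> B"
  shows "gibbs_mean \<beta> \<Gamma> N (\<lambda>M. of_bool (x \<in> M)) \<le>
         gibbs_mean \<beta> \<Gamma>' N' (\<lambda>M. of_bool (x \<in> M)) + gibbs_mean \<beta> \<Gamma> N (\<lambda>M. of_bool (x \<in> M \<and> x \<in> explored B M))"
proof -
  let ?q = "gibbs_mean \<beta> \<Gamma>' N' (\<lambda>M. of_bool (x \<in> M))"
  define \<O> where "\<O> = explored B ` confs \<Gamma> N"
  have fin\<O>: "finite \<O>" unfolding \<O>_def using finite_confs[OF fin(1)] by blast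
  define core where "core Q M \<longleftrightarrow> explored B M = Q \<and> x \<in> unexplored_core Q" for Q M
  have q0: "0 \<le> ?q" by (rule gibbs_mean_bounds(1)[OF fin(2), where b = 1]) simp_all
  \<comment> \<open>Given the explored set, the core sees a plus boundary, and so lies below the other measure.\<close>
  have inner: "gibbs_mean \<beta> \<Gamma> N (\<lambda>M. of_bool (core Q M) * of_bool (x \<in> M))
      \<le> gibbs_mean \<beta> \<Gamma> N (\<lambda>M. of_bool (core Q M) * ?q)" for Q
  proof -
    let ?D = "unexplored_core Q \<inter> \<Gamma>"
    have "gibbs_mean \<beta> \<Gamma> N (\<lambda>M. of_bool (core Q M) * of_bool (x \<in> M))
        = gibbs_mean \<beta> \<Gamma> N (\<lambda>M. gibbs_mean \<beta> ?D M (\<lambda>M. of_bool (core Q M) * of_bool (x \<in> M)))"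
      by (rule gibbs_mean_consistent[OF fin(1)]) blast
    also have "\<dots> \<le> gibbs_mean \<beta> \<Gamma> N (\<lambda>M. of_bool (core Q M) * ?q)"
    proof (rule gibbs_mean_mono[OF fin(1)])
      fix M assume M: "M \<in> confs \<Gamma> N"
      have pull: "gibbs_mean \<beta> ?D M (\<lambda>M. of_bool (core Q M) * of_bool (x \<in> M))
          = of_bool (core Q M) * gibbs_mean \<beta> ?D M (\<lambda>M. of_bool (x \<in> M))"
      proof (rule gibbs_mean_pull_out)
        fix M' assume M': "M' \<in> confs ?D M"
        have 1: "explored B M' = explored B M" if "explored B M = Q"
          by (rule explored_local) (use M' that in \<open>auto simp: confs_def\<close>)
        have 2: "explored B M = explored B M'" if "explored B M' = Q"
          by (rule explored_local) (use M' that in \<open>auto simp: confs_def\<close>)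
        have "core Q M' = core Q M" using 1 2 unfolding core_def by blast
        then show "of_bool (core Q M') = (of_bool (core Q M) :: real)" by simp
      qed
      show "gibbs_mean \<beta> ?D M (\<lambda>M. of_bool (core Q M) * of_bool (x \<in> M)) \<le> of_bool (core Q M) * ?q"
        unfolding pull
      proof (cases "core Q M")
        case True
        have Q: "explored B M = Q" and xD: "x \<in> ?D" using True x unfolding core_def by blast+
        have DB: "unexplored_core Q \<subseteq> B"
          using explored.outside[of _ B M] unfolding unexplored_core_def Q by blast
        have finD: "finite ?D" using fin by blast
        have sub: "?D \<subseteq> \<Gamma>'" using DB \<Gamma> by blast
        have "gibbs_mean \<beta> ?D M (\<lambda>M. of_bool (x \<in> M)) = gibbs_mean \<beta> \<Gamma>' N' (\<lambda>M'. gibbs_mean \<beta> ?D M (\<lambda>M. of_bool (x \<in> M)))"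
          by (rule gibbs_mean_const[OF fin(2), symmetric])
        also have "\<dots> \<le> gibbs_mean \<beta> \<Gamma>' N' (\<lambda>M'. gibbs_mean \<beta> ?D M' (\<lambda>M. of_bool (x \<in> M)))"
        proof (rule gibbs_mean_mono[OF fin(2)])
          fix M' assume M': "M' \<in> confs \<Gamma>' N'"
          have "gibbs_mean \<beta> ?D M (\<lambda>M. of_bool (x \<in> M \<inter> ?D)) \<le> gibbs_mean \<beta> ?D M' (\<lambda>M. of_bool (x \<in> M \<inter> ?D))"
          proof (rule gibbs_mean_increasing_bc[OF \<beta> finD, of "\<lambda>M. of_bool (x \<in> M)"])
            show "mono (\<lambda>M. of_bool (x \<in> M) :: real)" by (auto intro!: monoI)
            fix y z assume yz: "y \<in> ?D" "z \<in> M - ?D" "nearest_neighbours y z"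
            have zQ: "z \<notin> Q" using yz nearest_neighbours_sym unfolding unexplored_core_def by blast
            have zc: "z \<in> unexplored_core Q"
              using plus_around_core[of z B M] yz(2) zQ unfolding Q by blast
            then have z\<Gamma>: "z \<notin> \<Gamma>" using yz(2) by blast
            then have "z \<in> N - \<Gamma>" using yz(2) M unfolding confs_def by blast
            then have "z \<in> N' - \<Gamma>'" using N zc DB by blast
            then show "z \<in> M'" using M' unfolding confs_def by blast
          qed simp
          then show "gibbs_mean \<beta> ?D M (\<lambda>M. of_bool (x \<in> M)) \<le> gibbs_mean \<beta> ?D M' (\<lambda>M. of_bool (x \<in> M))"
            using xD by simp
        qed
        also have "\<dots> = ?q" by (rule gibbs_mean_consistent[OF fin(2) sub, symmetric])
        finally show "of_bool (core Q M) * gibbs_mean \<beta> ?D M (\<lambda>M. of_bool (x \<in> M)) \<le> of_bool (core Q M) * ?q"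
          using True by simp
      qed simp
    qed
    finally show ?thesis .
  qed
  have pick: "(\<Sum>Q\<in>\<O>. of_bool (core Q M)) = (of_bool (x \<in> unexplored_core (explored B M)) :: real)"
    if "M \<in> confs \<Gamma> N" for M
  proof -
    have "explored B M \<in> \<O>" using that unfolding \<O>_def by blast
    moreover have "(\<Sum>Q\<in>\<O>. of_bool (core Q M)) =
        (\<Sum>Q\<in>\<O>. if Q = explored B M then of_bool (x \<in> unexplored_core (explored B M)) else 0 :: real)"
      by (rule sum.cong[OF refl]) (auto simp: core_def)
    ultimately show ?thesis using fin\<O> by simp
  qed
  have "gibbs_mean \<beta> \<Gamma> N (\<lambda>M. of_bool (x \<in> M)) \<le> gibbs_mean \<beta> \<Gamma> N
      (\<lambda>M. (\<Sum>Q\<in>\<O>. of_bool (core Q M) * of_bool (x \<in> M)) + of_bool (x \<in> M \<and> x \<in> explored B M))"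
  proof (rule gibbs_mean_mono[OF fin(1)])
    fix M assume M: "M \<in> confs \<Gamma> N"
    show "of_bool (x \<in> M) \<le> (\<Sum>Q\<in>\<O>. of_bool (core Q M) * of_bool (x \<in> M)) + (of_bool (x \<in> M \<and> x \<in> explored B M) :: real)"
      unfolding sum_distrib_right[symmetric] pick[OF M] using plus_around_core[of x B M] by auto
  qed
  also have "\<dots> = (\<Sum>Q\<in>\<O>. gibbs_mean \<beta> \<Gamma> N (\<lambda>M. of_bool (core Q M) * of_bool (x \<in> M))) +
      gibbs_mean \<beta> \<Gamma> N (\<lambda>M. of_bool (x \<in> M \<and> x \<in> explored B M))"
    by (simp only: gibbs_mean_add gibbs_mean_sum)
  also have "\<dots> \<le> (\<Sum>Q\<in>\<O>. gibbs_mean \<beta> \<Gamma> N (\<lambda>M. of_bool (core Q M) * ?q)) +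
      gibbs_mean \<beta> \<Gamma> N (\<lambda>M. of_bool (x \<in> M \<and> x \<in> explored B M))"
    by (intro add_right_mono sum_mono inner)
  also have "(\<Sum>Q\<in>\<O>. gibbs_mean \<beta> \<Gamma> N (\<lambda>M. of_bool (core Q M) * ?q))
      = gibbs_mean \<beta> \<Gamma> N (\<lambda>M. \<Sum>Q\<in>\<O>. of_bool (core Q M) * ?q)"
    by (simp only: gibbs_mean_sum)
  also have "\<dots> \<le> gibbs_mean \<beta> \<Gamma> N (\<lambda>M. ?q)"
    by (rule gibbs_mean_mono[OF fin(1)]) (simp add: sum_distrib_right[symmetric] pick q0 mult_left_le_one_le)
  also have "\<dots> = ?q" by (rule gibbs_mean_const[OF fin(1)])
  finally show ?thesis by simp
qed

lemma nn_component_trans: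
  "y \<in> nn_component M x \<Longrightarrow> z \<in> nn_component M y \<Longrightarrow> z \<in> nn_component M x"
  unfolding nn_component_def by (simp add: rtrancl_trans)

lemma explored_component:
  assumes "z \<in> explored B M" "z \<in> B"
  shows "z \<in> M \<and> (\<exists>y\<in>nn_component M z. \<exists>y'. nearest_neighbours y y' \<and> y' \<notin> B)"
  using assms
proof induction
  case (step y z)
  show ?case
  proof (cases "y \<in> B")
    case True
    then obtain u u' where u: "u \<in> nn_component M y" "nearest_neighbours u u'" "u' \<notin> B" "y \<in> M"
      using step.IH by blast
    have "nearest_neighbours z y" using step nearest_neighbours_sym by blast
    then have "y \<in> nn_component M z"
      using nn_component_step[OF self_in_nn_component _ u(4)] step by blast
    then have "u \<in> nn_component M z" using u(1) by (rule nn_component_trans)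
    then show ?thesis using u step by blast
  next
    case False
    then show ?thesis using step self_in_nn_component nearest_neighbours_sym by blast
  qed
qed blast


section \<open>Uniform quasilocality in finite volume\<close>

text \<open>
  The bound holds for arbitrary volumes that contain \<open>B\<close>, not only for equal ones. By symmetry it is an estimate of
  the distance of the two conditional probabilities.
\<close>

theorem finite_volume_quasilocality:
  assumes \<beta>: "ln 1024 \<le> \<beta>" and sparse: "sparse_around S j L" and \<epsilon>: "0 < \<epsilon>"
  obtains B where "finite B" "\<And>\<Lambda> \<Lambda>' \<Delta> \<Delta>' s s'. finite \<Lambda> \<Longrightarrow> finite \<Lambda>' \<Longrightarrow> finite \<Delta> \<Longrightarrow> finite \<Delta>' \<Longrightarrow>
     B \<subseteq> \<Lambda> \<Longrightarrow> B \<subseteq> \<Lambda>' \<Longrightarrow> \<Delta> \<subseteq> (S - {j}) \<times> {0} \<Longrightarrow> \<Delta>' \<subseteq> (S - {j}) \<times> {0} \<Longrightarrow>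
     s \<subseteq> \<Delta> \<Longrightarrow> s' \<subseteq> \<Delta>' \<Longrightarrow> \<Delta> \<inter> B = \<Delta>' \<inter> B \<Longrightarrow> s \<inter> B = s' \<inter> B \<Longrightarrow>
     gibbs_mean \<beta> (\<Lambda> - \<Delta>) s (\<lambda>M. of_bool ((j, 0) \<in> M))
       \<le> gibbs_mean \<beta> (\<Lambda>' - \<Delta>') s' (\<lambda>M. of_bool ((j, 0) \<in> M)) + \<epsilon>"
proof -
  have \<beta>0: "0 \<le> \<beta>" using \<beta> ln_ge_zero[of 1024] by linarith
  obtain n where n: "(1 / 2 :: real) ^ n < \<epsilon> / 2" using real_arch_pow_inv[of "\<epsilon> / 2" "1 / 2"] \<epsilon> by auto
  define R where "R = max n (max (16 * L) 1)"
  have R: "16 * L \<le> R" "1 \<le> R" by (auto simp: R_def)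
  have "(1 / 2 :: real) ^ R \<le> (1 / 2) ^ n" by (rule power_decreasing) (auto simp: R_def)
  then have R\<epsilon>: "2 * (1 / 2 :: real) ^ R \<le> \<epsilon>" using n by linarith
  define B :: "site set" where "B = {j - int R..j + int R} \<times> {- int R..int R}"
  show thesis
  proof (rule that[of B])
    show "finite B" by (simp add: B_def)
    fix \<Lambda> \<Lambda>' \<Delta> \<Delta>' s s' :: "site set"
    assume fin: "finite \<Lambda>" "finite \<Lambda>'" "finite \<Delta>" "finite \<Delta>'" and B: "B \<subseteq> \<Lambda>" "B \<subseteq> \<Lambda>'"
      and \<Delta>: "\<Delta> \<subseteq> (S - {j}) \<times> {0}" "\<Delta>' \<subseteq> (S - {j}) \<times> {0}" and s: "s \<subseteq> \<Delta>" "s' \<subseteq> \<Delta>'"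
      and eq: "\<Delta> \<inter> B = \<Delta>' \<inter> B" "s \<inter> B = s' \<inter> B"
    have xB: "(j, 0) \<in> B" by (simp add: B_def)
    have reach: "reaches R (j, 0) M" if expl: "(j, 0) \<in> explored B M" for M
    proof -
      obtain y y' where y: "(j, 0) \<in> M" "y \<in> nn_component M (j, 0)" "nearest_neighbours y y'" "y' \<notin> B"
        using explored_component[OF expl xB] by blast
      have "int R < \<bar>fst y' - j\<bar> \<or> int R < \<bar>snd y'\<bar>" using y(4) unfolding B_def by (cases y') auto
      moreover have "\<bar>fst y' - fst y\<bar> \<le> 1" "\<bar>snd y' - snd y\<bar> \<le> 1"
        using y(3) by (auto simp: nearest_neighbours_def)
      ultimately have "int R \<le> \<bar>fst y - j\<bar> \<or> int R \<le> \<bar>snd y\<bar>" by linarith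
      then show ?thesis unfolding reaches_def using y by auto
    qed
    have "gibbs_mean \<beta> (\<Lambda> - \<Delta>) s (\<lambda>M. of_bool ((j, 0) \<in> M))
       \<le> gibbs_mean \<beta> (\<Lambda>' - \<Delta>') s' (\<lambda>M. of_bool ((j, 0) \<in> M)) +
         gibbs_mean \<beta> (\<Lambda> - \<Delta>) s (\<lambda>M. of_bool ((j, 0) \<in> M \<and> (j, 0) \<in> explored B M))"
    proof (rule local_comparison[OF \<beta>0])
      show "(j, 0) \<in> \<Lambda> - \<Delta>" using xB B \<Delta> by blast
      show "(\<Lambda> - \<Delta>) \<inter> B = (\<Lambda>' - \<Delta>') \<inter> B" using B eq(1) by blast
      show "(s - (\<Lambda> - \<Delta>)) \<inter> B = (s' - (\<Lambda>' - \<Delta>')) \<inter> B" using s eq(2) by blast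
    qed (use fin in auto)
    also have "gibbs_mean \<beta> (\<Lambda> - \<Delta>) s (\<lambda>M. of_bool ((j, 0) \<in> M \<and> (j, 0) \<in> explored B M))
        \<le> gibbs_mean \<beta> (\<Lambda> - \<Delta>) s (\<lambda>M. of_bool (reaches R (j, 0) M))"
      by (rule gibbs_mean_mono) (use fin reach in auto)
    also have "\<dots> \<le> 2 * (1 / 2) ^ R"
      by (rule peierls_estimate[OF \<beta> _ R fin(1) _ fin(3) s(1), of S]) (use sparse \<Delta> in auto)
    finally show "gibbs_mean \<beta> (\<Lambda> - \<Delta>) s (\<lambda>M. of_bool ((j, 0) \<in> M))
       \<le> gibbs_mean \<beta> (\<Lambda>' - \<Delta>') s' (\<lambda>M. of_bool ((j, 0) \<in> M)) + \<epsilon>" using R\<epsilon> by linarith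
  qed
qed


section \<open>Infinite-volume local probabilities\<close>

lemma mono_of_bool: "(\<And>M M'. M \<subseteq> M' \<Longrightarrow> P M \<Longrightarrow> P M') \<Longrightarrow> mono (\<lambda>M. of_bool (P M) :: real)"
  by (auto intro!: monoI)

text \<open>
  With plus boundary condition the means of an increasing function increase with the volume.
\<close>

lemma convergent_increasing_mean:
  assumes \<beta>: "0 \<le> \<beta>" and f: "mono f" and f0: "\<And>M. 0 \<le> f M" and f1: "\<And>M. f M \<le> 1"
  shows "\<exists>l. ((\<lambda>\<Lambda>. gibbs_mean \<beta> \<Lambda> {} f) \<longlongrightarrow> l) (finite_subsets_at_top UNIV)"
proof -
  let ?g = "\<lambda>\<Lambda>. gibbs_mean \<beta> \<Lambda> {} f"
  let ?l = "SUP \<Lambda>\<in>{\<Lambda>. finite \<Lambda>}. ?g \<Lambda>"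
  have bdd: "bdd_above (?g ` {\<Lambda>. finite \<Lambda>})"
    by (rule bdd_aboveI2[of _ _ 1]) (use gibbs_mean_bounds(2)[of _ _ 0 f 1] f0 f1 in auto)
  have "(?g \<longlongrightarrow> ?l) (finite_subsets_at_top UNIV)"
  proof (rule increasing_tendsto)
    show "\<forall>\<^sub>F \<Lambda> in finite_subsets_at_top UNIV. ?g \<Lambda> \<le> ?l"
      by (rule eventually_finite_subsets_at_top_weakI) (auto intro!: cSUP_upper[OF _ bdd])
    fix a assume "a < ?l"
    then obtain \<Lambda>0 where \<Lambda>0: "finite \<Lambda>0" "a < ?g \<Lambda>0"
      by (subst (asm) less_cSUP_iff) (use bdd in auto)
    have "a < ?g \<Lambda>" if "finite \<Lambda>" "\<Lambda>0 \<subseteq> \<Lambda>" for \<Lambda>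
      using gibbs_mean_mono_volume[OF \<beta> that(1) f f0 that(2), of "{}"] \<Lambda>0(2) by auto
    then show "\<forall>\<^sub>F \<Lambda> in finite_subsets_at_top UNIV. a < ?g \<Lambda>"
      unfolding eventually_finite_subsets_at_top using \<Lambda>0(1) by blast
  qed
  then show ?thesis ..
qed

definition local_prob :: "real \<Rightarrow> site set \<Rightarrow> site set \<Rightarrow> real" where
  "local_prob \<beta> \<Delta> s = Lim (finite_subsets_at_top UNIV) (\<lambda>\<Lambda>. gibbs_mean \<beta> \<Lambda> {} (\<lambda>M. of_bool (M \<inter> \<Delta> = s)))"

text \<open>
  The indicator function of a local event is the difference of two increasing functions.
\<close>

lemma tendsto_local_prob:
  assumes \<beta>: "0 \<le> \<beta>"
  shows "((\<lambda>\<Lambda>. gibbs_mean \<beta> \<Lambda> {} (\<lambda>M. of_bool (M \<inter> \<Delta> = s))) \<longlongrightarrow> local_prob \<beta> \<Delta> s)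
    (finite_subsets_at_top UNIV)"
proof -
  let ?f = "\<lambda>M. of_bool (s \<subseteq> M) :: real" and ?g = "\<lambda>M. of_bool (s \<subseteq> M \<and> M \<inter> (\<Delta> - s) \<noteq> {}) :: real"
  have "\<exists>l. ((\<lambda>\<Lambda>. gibbs_mean \<beta> \<Lambda> {} ?f) \<longlongrightarrow> l) (finite_subsets_at_top UNIV)"
    by (rule convergent_increasing_mean[OF \<beta> mono_of_bool]) (blast, simp_all)
  moreover have "\<exists>l. ((\<lambda>\<Lambda>. gibbs_mean \<beta> \<Lambda> {} ?g) \<longlongrightarrow> l) (finite_subsets_at_top UNIV)"
    by (rule convergent_increasing_mean[OF \<beta> mono_of_bool]) (blast, simp_all)
  ultimately obtain l l' where "((\<lambda>\<Lambda>. gibbs_mean \<beta> \<Lambda> {} ?f) \<longlongrightarrow> l) (finite_subsets_at_top UNIV)"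
    "((\<lambda>\<Lambda>. gibbs_mean \<beta> \<Lambda> {} ?g) \<longlongrightarrow> l') (finite_subsets_at_top UNIV)" by blast
  from tendsto_diff[OF this]
  have lim: "((\<lambda>\<Lambda>. gibbs_mean \<beta> \<Lambda> {} (\<lambda>M. ?f M - ?g M)) \<longlongrightarrow> l - l') (finite_subsets_at_top UNIV)"
    by (simp only: gibbs_mean_diff)
  have "\<exists>l. ((\<lambda>\<Lambda>. gibbs_mean \<beta> \<Lambda> {} (\<lambda>M. of_bool (M \<inter> \<Delta> = s))) \<longlongrightarrow> l) (finite_subsets_at_top UNIV)"
  proof (cases "s \<subseteq> \<Delta>")
    case True
    then have "of_bool (M \<inter> \<Delta> = s) = ?f M - ?g M" for M by auto
    then show ?thesis using lim by (intro exI[of _ "l - l'"]) (simp only:)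
  next
    case False
    then have "of_bool (M \<inter> \<Delta> = s) = (0 :: real)" for M by auto
    then show ?thesis by (intro exI[of _ 0]) (simp add: gibbs_mean_def)
  qed
  then show ?thesis unfolding local_prob_def
    using tendsto_Lim[OF finite_subsets_at_top_neq_bot] by blast
qed

lemma tendsto_local_mean:
  assumes \<beta>: "0 \<le> \<beta>" and fin: "finite \<Delta>"
  shows "((\<lambda>\<Lambda>. gibbs_mean \<beta> \<Lambda> {} (\<lambda>M. F (M \<inter> \<Delta>))) \<longlongrightarrow> (\<Sum>s\<in>Pow \<Delta>. F s * local_prob \<beta> \<Delta> s))
    (finite_subsets_at_top UNIV)"
proof -
  have eq: "F (M \<inter> \<Delta>) = (\<Sum>s\<in>Pow \<Delta>. F s * of_bool (M \<inter> \<Delta> = s))" for M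
  proof -
    have "(\<Sum>s\<in>Pow \<Delta>. F s * of_bool (M \<inter> \<Delta> = s)) = (\<Sum>s\<in>Pow \<Delta>. if M \<inter> \<Delta> = s then F s else 0)"
      by (rule sum.cong) auto
    then show ?thesis using fin by simp
  qed
  show ?thesis
    unfolding eq gibbs_mean_sum gibbs_mean_cmult
    by (intro tendsto_sum tendsto_mult tendsto_const tendsto_local_prob[OF \<beta>])
qed

lemma local_prob_unique:
  assumes \<beta>: "0 \<le> \<beta>" and fin: "finite \<Delta>"
    and l: "((\<lambda>\<Lambda>. gibbs_mean \<beta> \<Lambda> {} (\<lambda>M. F (M \<inter> \<Delta>))) \<longlongrightarrow> l) (finite_subsets_at_top UNIV)"
  shows "l = (\<Sum>s\<in>Pow \<Delta>. F s * local_prob \<beta> \<Delta> s)"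
  by (rule tendsto_unique[OF finite_subsets_at_top_neq_bot l tendsto_local_mean[OF \<beta> fin]])

lemma local_prob_nonneg: "0 \<le> \<beta> \<Longrightarrow> 0 \<le> local_prob \<beta> \<Delta> s"
  by (rule tendsto_lowerbound[OF tendsto_local_prob _ finite_subsets_at_top_neq_bot])
     (auto intro!: eventually_finite_subsets_at_top_weakI gibbs_mean_bounds(1)[where b = 1])

lemma local_prob_sum:
  assumes \<beta>: "0 \<le> \<beta>" and fin: "finite \<Delta>"
  shows "(\<Sum>s\<in>Pow \<Delta>. local_prob \<beta> \<Delta> s) = 1"
proof -
  have "((\<lambda>\<Lambda>. gibbs_mean \<beta> \<Lambda> {} (\<lambda>M. 1)) \<longlongrightarrow> 1) (finite_subsets_at_top UNIV)"
    by (rule tendsto_eventually, rule eventually_finite_subsets_at_top_weakI) (rule gibbs_mean_const)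
  from local_prob_unique[OF \<beta> fin this] show ?thesis by simp
qed

lemma local_prob_marginal:
  assumes \<beta>: "0 \<le> \<beta>" and fin: "finite H" and sub: "J \<subseteq> H"
  shows "local_prob \<beta> J s = (\<Sum>t | t \<subseteq> H \<and> t \<inter> J = s. local_prob \<beta> H t)"
proof -
  have "((\<lambda>\<Lambda>. gibbs_mean \<beta> \<Lambda> {} (\<lambda>M. of_bool ((M \<inter> H) \<inter> J = s))) \<longlongrightarrow> local_prob \<beta> J s) (finite_subsets_at_top UNIV)"
    using tendsto_local_prob[OF \<beta>, of J s] sub by (simp add: Int_assoc Int_absorb1)
  from local_prob_unique[OF \<beta> fin this]
  have "local_prob \<beta> J s = (\<Sum>t\<in>Pow H. of_bool (t \<inter> J = s) * local_prob \<beta> H t)" .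
  also have "\<dots> = (\<Sum>t\<in>Pow H. if t \<inter> J = s then local_prob \<beta> H t else 0)"
    by (rule sum.cong) simp_all
  also have "\<dots> = (\<Sum>t\<in>{t \<in> Pow H. t \<inter> J = s}. local_prob \<beta> H t)"
    by (rule sum.inter_filter[symmetric]) (simp add: fin)
  finally show ?thesis by (simp add: Pow_iff)
qed

definition local_pmf :: "real \<Rightarrow> site set \<Rightarrow> site set pmf" where
  "local_pmf \<beta> J = embed_pmf (\<lambda>s. if s \<subseteq> J then local_prob \<beta> J s else 0)"

lemma pmf_local_pmf:
  assumes \<beta>: "0 \<le> \<beta>" and fin: "finite J"
  shows "pmf (local_pmf \<beta> J) s = (if s \<subseteq> J then local_prob \<beta> J s else 0)"
  unfolding local_pmf_def
proof (rule pmf_embed_pmf)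
  have "(\<integral>\<^sup>+s. ennreal (if s \<subseteq> J then local_prob \<beta> J s else 0) \<partial>count_space UNIV)
      = (\<Sum>s\<in>Pow J. ennreal (if s \<subseteq> J then local_prob \<beta> J s else 0))"
    by (rule nn_integral_count_space') (auto simp: fin)
  also have "\<dots> = (\<Sum>s\<in>Pow J. ennreal (local_prob \<beta> J s))" by (rule sum.cong) auto
  also have "\<dots> = 1" using local_prob_sum[OF \<beta> fin] by (simp add: sum_ennreal local_prob_nonneg[OF \<beta>])
  finally show "(\<integral>\<^sup>+s. ennreal (if s \<subseteq> J then local_prob \<beta> J s else 0) \<partial>count_space UNIV) = 1" .
qed (simp add: local_prob_nonneg[OF \<beta>])

lemma map_local_pmf:
  assumes \<beta>: "0 \<le> \<beta>" and fin: "finite H" and sub: "J \<subseteq> H"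
  shows "map_pmf (\<lambda>s. s \<inter> J) (local_pmf \<beta> H) = local_pmf \<beta> J"
proof (rule pmf_eqI)
  fix s
  have finJ: "finite J" using sub fin finite_subset by blast
  let ?A = "{t. t \<subseteq> H \<and> t \<inter> J = s}"
  have finA: "finite ?A" by (rule finite_subset[of _ "Pow H"]) (use fin in auto)
  have "pmf (map_pmf (\<lambda>s. s \<inter> J) (local_pmf \<beta> H)) s = measure_pmf.prob (local_pmf \<beta> H) ((\<lambda>s. s \<inter> J) -` {s})"
    by (rule pmf_map)
  also have "\<dots> = measure_pmf.prob (local_pmf \<beta> H) ?A"
    by (rule measure_prob_cong_0) (auto simp: pmf_local_pmf[OF \<beta> fin])
  also have "\<dots> = (\<Sum>t\<in>?A. pmf (local_pmf \<beta> H) t)" by (rule measure_measure_pmf_finite[OF finA])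
  also have "\<dots> = (\<Sum>t\<in>?A. local_prob \<beta> H t)" by (rule sum.cong) (auto simp: pmf_local_pmf[OF \<beta> fin])
  also have "\<dots> = local_prob \<beta> J s" by (rule local_prob_marginal[OF \<beta> fin sub, symmetric])
  also have "\<dots> = pmf (local_pmf \<beta> J) s"
  proof (cases "s \<subseteq> J")
    case False
    then have "?A = {}" by auto
    then have "local_prob \<beta> J s = 0" unfolding local_prob_marginal[OF \<beta> fin sub] by (metis sum.empty)
    then show ?thesis using False by (simp add: pmf_local_pmf[OF \<beta> finJ])
  qed (simp add: pmf_local_pmf[OF \<beta> finJ])
  finally show "pmf (map_pmf (\<lambda>s. s \<inter> J) (local_pmf \<beta> H)) s = pmf (local_pmf \<beta> J) s" .
qed

definition spin :: "site set \<Rightarrow> site \<Rightarrow> real" where "spin M x = (if x \<in> M then - 1 else 1)"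

lemma spin_in_configs [simp]: "spin M \<in> configs UNIV" "spin M x \<in> spins"
  by (auto simp: spin_def split: if_splits)

lemma spin_eq_iff [simp]: "spin M x = spin M' x \<longleftrightarrow> (x \<in> M \<longleftrightarrow> x \<in> M')"
  by (auto simp: spin_def)

text \<open>
  The spins take values in the Polish space of all reals, as the extension theorem requires. They are
  mapped back to 1 and -1 after the extension.
\<close>

definition local_law :: "real \<Rightarrow> site set \<Rightarrow> (site \<Rightarrow> real) measure" where
  "local_law \<beta> J = distr (measure_pmf (local_pmf \<beta> J)) (Pi\<^sub>M J (\<lambda>_. borel)) (\<lambda>s. restrict (spin s) J)"

lemma polish_projective_local_law:
  assumes \<beta>: "0 \<le> \<beta>"
  shows "polish_projective UNIV (local_law \<beta>)"
proof (intro polish_projective.intro projective_family.intro)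
  fix J H :: "site set" assume sub: "J \<subseteq> H" and fin: "finite H"
  have "distr (local_law \<beta> H) (Pi\<^sub>M J (\<lambda>_. borel)) (\<lambda>f. restrict f J)
      = distr (measure_pmf (local_pmf \<beta> H)) (Pi\<^sub>M J (\<lambda>_. borel)) ((\<lambda>f. restrict f J) \<circ> (\<lambda>s. restrict (spin s) H))"
    unfolding local_law_def
    by (rule distr_distr[OF measurable_restrict_subset[OF sub]]) (simp add: space_PiM)
  also have "(\<lambda>f. restrict f J) \<circ> (\<lambda>s. restrict (spin s) H) = (\<lambda>s. restrict (spin s) J) \<circ> (\<lambda>s. s \<inter> J)"
    using sub by (auto simp: fun_eq_iff spin_def restrict_def)
  also have "distr (measure_pmf (local_pmf \<beta> H)) (Pi\<^sub>M J (\<lambda>_. borel)) ((\<lambda>s. restrict (spin s) J) \<circ> (\<lambda>s. s \<inter> J))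
      = distr (distr (measure_pmf (local_pmf \<beta> H)) (count_space UNIV) (\<lambda>s. s \<inter> J)) (Pi\<^sub>M J (\<lambda>_. borel)) (\<lambda>s. restrict (spin s) J)"
    by (rule distr_distr[symmetric]) (auto simp: space_PiM)
  also have "\<dots> = local_law \<beta> J"
    unfolding map_pmf_rep_eq[symmetric] map_local_pmf[OF \<beta> fin sub] local_law_def ..
  finally show "local_law \<beta> J = distr (local_law \<beta> H) (Pi\<^sub>M J (\<lambda>_. borel)) (\<lambda>f. restrict f J)" ..
next
  fix J :: "site set"
  show "prob_space (local_law \<beta> J)" unfolding local_law_def
    by (rule measure_pmf.prob_space_distr) (simp add: space_PiM)
qed

lemma exists_measure_with_local_probs:
  assumes \<beta>: "0 \<le> \<beta>"
  obtains \<mu> where "prob_space \<mu>" "sets \<mu> = sets (config_space UNIV)"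
    "\<And>\<Delta> s. finite \<Delta> \<Longrightarrow> s \<subseteq> \<Delta> \<Longrightarrow>
      measure \<mu> {\<sigma> \<in> configs UNIV. \<forall>x\<in>\<Delta>. \<sigma> x = spin s x} = local_prob \<beta> \<Delta> s"
proof -
  interpret P: polish_projective UNIV "local_law \<beta>" by (rule polish_projective_local_law[OF \<beta>])
  define g :: "(site \<Rightarrow> real) \<Rightarrow> site \<Rightarrow> real" where "g \<omega> = (\<lambda>x. if \<omega> x = - 1 then - 1 else 1)" for \<omega>
  have g [measurable]: "g \<in> measurable P.lim (config_space UNIV)"
    unfolding config_space_def
  proof (rule measurable_PiM_single')
    fix x :: site
    have "(\<lambda>\<omega>. if \<omega> x = - 1 then - 1 else 1 :: real) \<in> measurable P.lim (count_space spins)"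
      by (rule measurable_If) (auto intro: measurable_const)
    then show "(\<lambda>\<omega>. g \<omega> x) \<in> measurable P.lim (count_space spins)" by (simp add: g_def)
  qed (auto simp: g_def split: if_splits)
  show thesis
  proof (rule that[of "distr P.lim (config_space UNIV) g"])
    show "prob_space (distr P.lim (config_space UNIV) g)" by (rule P.P.prob_space_distr[OF g])
    fix \<Delta> s :: "site set" assume fin: "finite \<Delta>" and s: "s \<subseteq> \<Delta>"
    let ?C = "{\<sigma> \<in> configs UNIV. \<forall>x\<in>\<Delta>. \<sigma> x = spin s x}"
    have C: "?C \<in> sets (config_space UNIV)"
    proof -
      have "{\<sigma> \<in> space (config_space UNIV). \<forall>x\<in>\<Delta>. \<sigma> x = spin s x} \<in> sets (config_space UNIV)"
        unfolding config_space_def using fin by measurable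
      then show ?thesis by (simp add: config_space_def space_PiM)
    qed
    let ?X = "{f \<in> space (\<Pi>\<^sub>M i\<in>\<Delta>. borel). \<forall>x\<in>\<Delta>. (if f x = - 1 then - 1 else 1 :: real) = spin s x}"
    have X: "?X \<in> sets (\<Pi>\<^sub>M i\<in>\<Delta>. (borel :: real measure))" using fin by measurable
    have "g -` ?C \<inter> space P.lim = prod_emb UNIV (\<lambda>_. borel) \<Delta> ?X"
      by (auto simp: prod_emb_def g_def space_PiM PiE_iff extensional_def)
    then have "measure (distr P.lim (config_space UNIV) g) ?C = measure (local_law \<beta> \<Delta>) ?X"
      using P.measure_lim_emb[OF _ fin X] by (simp add: measure_distr[OF g C])
    also have "\<dots> = measure_pmf.prob (local_pmf \<beta> \<Delta>) ((\<lambda>t. restrict (spin t) \<Delta>) -` ?X)"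
      unfolding local_law_def by (subst measure_distr[OF _ X]) (auto simp: space_PiM)
    also have "\<dots> = measure_pmf.prob (local_pmf \<beta> \<Delta>) {s}"
    proof (rule measure_prob_cong_0)
      fix t assume t: "t \<in> (\<lambda>t. restrict (spin t) \<Delta>) -` ?X - {s}"
      then have "\<forall>x\<in>\<Delta>. (if restrict (spin t) \<Delta> x = - 1 then - 1 else 1 :: real) = spin s x"
        unfolding vimage_def by blast
      then have "spin t x = spin s x" if "x \<in> \<Delta>" for x
        using that by (auto simp: spin_def split: if_splits)
      then have "t \<inter> \<Delta> = s" using s by auto
      then have "\<not> t \<subseteq> \<Delta>" using t by blast
      then show "pmf (local_pmf \<beta> \<Delta>) t = 0" by (simp add: pmf_local_pmf[OF \<beta> fin])
    next
      fix t assume "t \<in> {s} - (\<lambda>t. restrict (spin t) \<Delta>) -` ?X"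
      then show "pmf (local_pmf \<beta> \<Delta>) t = 0" by (auto simp: spin_def space_PiM)
    qed
    also have "\<dots> = local_prob \<beta> \<Delta> s" using s by (simp add: measure_pmf_single pmf_local_pmf[OF \<beta> fin])
    finally show "measure (distr P.lim (config_space UNIV) g) ?C = local_prob \<beta> \<Delta> s" .
  qed simp
qed


section \<open>Cylinders in configuration space\<close>

definition cylinder :: "'a set \<Rightarrow> 'a set \<Rightarrow> ('a \<Rightarrow> real) \<Rightarrow> ('a \<Rightarrow> real) set" where
  "cylinder S \<Delta> \<omega> = {\<eta> \<in> configs S. \<forall>i\<in>\<Delta>. \<eta> i = \<omega> i}"

text \<open>
  Unlike \<open>merge\<close> this does not restrict the result to the two index sets, which avoids side conditions.
\<close>

definition glue :: "'a set \<Rightarrow> ('a \<Rightarrow> real) \<Rightarrow> ('a \<Rightarrow> real) \<Rightarrow> 'a \<Rightarrow> real" where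
  "glue V \<sigma> \<omega> = (\<lambda>i. if i \<in> V then \<sigma> i else \<omega> i)"

lemma space_config_space: "space (config_space S) = configs S"
  by (simp add: config_space_def space_PiM)

lemma configs_nonempty: "(\<lambda>i. if i \<in> S then 1 else undefined) \<in> configs S"
  by (auto simp: PiE_iff extensional_def)

lemma cylinder_measurable:
  assumes "finite \<Delta>" "\<Delta> \<subseteq> S"
  shows "cylinder S \<Delta> \<omega> \<in> sets (config_space S)"
proof -
  have [measurable]: "(\<lambda>\<eta>. \<eta> i) \<in> measurable (config_space S) (count_space spins)" if "i \<in> \<Delta>" for i
    unfolding config_space_def using that assms by (intro measurable_component_singleton) auto
  have "{\<eta> \<in> space (config_space S). \<eta> i = \<omega> i} \<in> sets (config_space S)" if "i \<in> \<Delta>" for i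
  proof -
    have "(\<lambda>\<eta>. \<eta> i) -` {\<omega> i} \<inter> space (config_space S) = (\<lambda>\<eta>. \<eta> i) -` ({\<omega> i} \<inter> spins) \<inter> space (config_space S)"
      using that assms by (auto simp: space_config_space)
    also have "\<dots> \<in> sets (config_space S)" using that by (intro measurable_sets[of _ _ "count_space spins"]) auto
    finally show ?thesis by (simp add: vimage_def Int_def conj_commute)
  qed
  then have "{\<eta> \<in> space (config_space S). \<forall>i\<in>\<Delta>. \<eta> i = \<omega> i} \<in> sets (config_space S)"
    by (rule sets.sets_Collect_finite_All) (assumption, rule assms(1))
  then show ?thesis by (simp add: cylinder_def space_config_space)
qed

lemma cylinder_cong: "(\<And>i. i \<in> \<Delta> \<Longrightarrow> \<omega> i = \<omega>' i) \<Longrightarrow> cylinder S \<Delta> \<omega> = cylinder S \<Delta> \<omega>'"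
  by (auto simp: cylinder_def)

lemma finite_configs: "finite V \<Longrightarrow> finite (configs V)"
  by (rule finite_PiE) auto

text \<open>
  Since there are only two spin values, cylinders that prescribe finitely many spins exactly are enough.
\<close>

lemma config_measure_eqI:
  assumes P: "sets P = sets (config_space T)" "finite_measure P"
    and Q: "sets Q = sets (config_space T)" "finite_measure Q"
    and eq: "\<And>J t. finite J \<Longrightarrow> J \<subseteq> T \<Longrightarrow> t \<in> configs J \<Longrightarrow> measure P (cylinder T J t) = measure Q (cylinder T J t)"
  shows "P = Q"
proof (rule measure_eqI_PiM_infinite[of P T "\<lambda>_. count_space spins"])
  show "sets P = sets (Pi\<^sub>M T (\<lambda>_. count_space spins))" "sets Q = sets (Pi\<^sub>M T (\<lambda>_. count_space spins))"
    using P Q by (simp_all add: config_space_def)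
  fix A :: "'a \<Rightarrow> real set" and J
  assume J: "finite J" "J \<subseteq> T" and A: "\<And>i. i \<in> J \<Longrightarrow> A i \<in> sets (count_space spins)"
  interpret P: finite_measure P by fact
  interpret Q: finite_measure Q by fact
  have fin: "finite (PiE J A)" using A J by (intro finite_PiE) (auto intro: finite_subset)
  have dec: "prod_emb T (\<lambda>_. count_space spins) J (PiE J A) = (\<Union>t\<in>PiE J A. cylinder T J t)"
  proof (intro set_eqI iffI)
    fix \<eta> assume \<eta>: "\<eta> \<in> prod_emb T (\<lambda>_. count_space spins) J (PiE J A)"
    then have "restrict \<eta> J \<in> PiE J A" "\<eta> \<in> cylinder T J (restrict \<eta> J)"
      by (auto simp: prod_emb_def cylinder_def space_PiM)
    then show "\<eta> \<in> (\<Union>t\<in>PiE J A. cylinder T J t)" by blast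
  next
    fix \<eta> assume "\<eta> \<in> (\<Union>t\<in>PiE J A. cylinder T J t)"
    then obtain t where t: "t \<in> PiE J A" "\<eta> \<in> configs T" "\<And>i. i \<in> J \<Longrightarrow> \<eta> i = t i"
      by (auto simp: cylinder_def)
    then have "restrict \<eta> J = t" by (auto simp: restrict_def PiE_iff extensional_def fun_eq_iff)
    then show "\<eta> \<in> prod_emb T (\<lambda>_. count_space spins) J (PiE J A)"
      using t by (auto simp: prod_emb_def)
  qed
  have disj: "disjoint_family_on (cylinder T J) (PiE J A)"
    unfolding disjoint_family_on_def
  proof (intro ballI impI)
    fix t u assume tu: "t \<in> PiE J A" "u \<in> PiE J A" "t \<noteq> u"
    show "cylinder T J t \<inter> cylinder T J u = {}"
    proof (rule ccontr)
      assume "cylinder T J t \<inter> cylinder T J u \<noteq> {}"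
      then have "\<And>i. i \<in> J \<Longrightarrow> t i = u i" by (auto simp: cylinder_def)
      then have "t = u" using tu(1,2) by (intro PiE_ext[of t J A u]) auto
      then show False using tu(3) by simp
    qed
  qed
  have "measure P (\<Union>t\<in>PiE J A. cylinder T J t) = (\<Sum>t\<in>PiE J A. measure P (cylinder T J t))"
    by (rule P.finite_measure_finite_Union[OF fin _ disj]) (use cylinder_measurable[OF J] P in auto)
  also have "\<dots> = (\<Sum>t\<in>PiE J A. measure Q (cylinder T J t))"
  proof (rule sum.cong[OF refl])
    fix t assume "t \<in> PiE J A"
    moreover have "A i \<subseteq> spins" if "i \<in> J" for i using A[OF that] by simp
    ultimately have "t \<in> configs J" using PiE_mono[of J A "\<lambda>_. spins"] by blast
    then show "measure P (cylinder T J t) = measure Q (cylinder T J t)" by (rule eq[OF J])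
  qed
  also have "\<dots> = measure Q (\<Union>t\<in>PiE J A. cylinder T J t)"
    by (rule Q.finite_measure_finite_Union[OF fin _ disj, symmetric]) (use cylinder_measurable[OF J] Q in auto)
  finally show "emeasure P (prod_emb T (\<lambda>_. count_space spins) J (PiE J A)) =
      emeasure Q (prod_emb T (\<lambda>_. count_space spins) J (PiE J A))"
    unfolding dec by (simp add: P.emeasure_eq_measure Q.emeasure_eq_measure)
qed fact

lemma glue_in_configs:
  assumes "\<sigma> \<in> configs V" "\<omega> \<in> configs S" "V \<subseteq> S"
  shows "glue V \<sigma> \<omega> \<in> configs S"
  using assms by (auto simp: glue_def PiE_iff extensional_def)

text \<open>
  Conditioning on finitely many spins as a finite sum. With \<open>g = 1\<close> it becomes the law of total probability.
\<close>

lemma integral_local_function: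
  assumes \<nu>: "prob_space \<nu>" "sets \<nu> = sets (config_space S)"
    and D: "finite D" "D \<subseteq> S" and E: "finite E" "E \<subseteq> S" "D \<inter> E = {}"
    and g: "\<And>\<eta> \<eta>'. \<eta> \<in> configs S \<Longrightarrow> \<eta>' \<in> configs S \<Longrightarrow> (\<And>i. i \<in> D \<union> E \<Longrightarrow> \<eta> i = \<eta>' i) \<Longrightarrow> g \<eta> = g \<eta>'"
    and \<omega>: "\<omega> \<in> configs S"
  shows "(\<integral>\<eta>. indicator (cylinder S D \<omega>) \<eta> * g \<eta> \<partial>\<nu>) =
     (\<Sum>t\<in>configs E. g (glue E t \<omega>) * measure \<nu> (cylinder S (D \<union> E) (glue E t \<omega>)))"
proof -
  interpret prob_space \<nu> by fact
  have space: "space \<nu> = configs S" using sets_eq_imp_space_eq[OF \<nu>(2)] by (simp add: space_config_space)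
  have cyl: "cylinder S (D \<union> E) \<omega>' \<in> sets \<nu>" for \<omega>' using cylinder_measurable[of "D \<union> E" S] D E \<nu>(2) by auto
  have eq: "indicator (cylinder S D \<omega>) \<eta> * g \<eta> =
      (\<Sum>t\<in>configs E. g (glue E t \<omega>) * indicator (cylinder S (D \<union> E) (glue E t \<omega>)) \<eta>)"
    if \<eta>: "\<eta> \<in> configs S" for \<eta>
  proof -
    have mem: "\<eta> \<in> cylinder S (D \<union> E) (glue E t \<omega>) \<longleftrightarrow> \<eta> \<in> cylinder S D \<omega> \<and> t = restrict \<eta> E"
      if "t \<in> configs E" for t
    proof -
      have "(\<forall>i\<in>E. \<eta> i = t i) \<longleftrightarrow> t = restrict \<eta> E"
        using that by (auto simp: fun_eq_iff restrict_def PiE_iff extensional_def)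
      moreover have "\<eta> \<in> cylinder S (D \<union> E) (glue E t \<omega>) \<longleftrightarrow> (\<forall>i\<in>D. \<eta> i = \<omega> i) \<and> (\<forall>i\<in>E. \<eta> i = t i)"
        using \<eta> E(3) unfolding cylinder_def glue_def by auto
      ultimately show ?thesis using \<eta> unfolding cylinder_def by blast
    qed
    have "(\<Sum>t\<in>configs E. g (glue E t \<omega>) * indicator (cylinder S (D \<union> E) (glue E t \<omega>)) \<eta>) =
        (\<Sum>t\<in>configs E. if t = restrict \<eta> E then indicator (cylinder S D \<omega>) \<eta> * g \<eta> else 0)"
    proof (rule sum.cong[OF refl])
      fix t assume t: "t \<in> configs E"
      show "g (glue E t \<omega>) * indicator (cylinder S (D \<union> E) (glue E t \<omega>)) \<eta> =
          (if t = restrict \<eta> E then indicator (cylinder S D \<omega>) \<eta> * g \<eta> else 0)"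
      proof (cases "\<eta> \<in> cylinder S (D \<union> E) (glue E t \<omega>)")
        case True
        then have "g (glue E t \<omega>) = g \<eta>"
          by (intro g glue_in_configs[OF t \<omega> E(2)] \<eta>) (auto simp: cylinder_def)
        then show ?thesis using True mem[OF t] by simp
      next
        case False
        then show ?thesis using mem[OF t] by auto
      qed
    qed
    also have "\<dots> = indicator (cylinder S D \<omega>) \<eta> * g \<eta>"
      using \<eta> E(1,2) by (subst sum.delta) (auto simp: finite_configs)
    finally show ?thesis ..
  qed
  have "(\<integral>\<eta>. indicator (cylinder S D \<omega>) \<eta> * g \<eta> \<partial>\<nu>) =
      (\<integral>\<eta>. (\<Sum>t\<in>configs E. g (glue E t \<omega>) * indicator (cylinder S (D \<union> E) (glue E t \<omega>)) \<eta>) \<partial>\<nu>)"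
    by (rule Bochner_Integration.integral_cong[OF refl]) (simp add: space eq)
  also have "\<dots> = (\<Sum>t\<in>configs E. g (glue E t \<omega>) * measure \<nu> (cylinder S (D \<union> E) (glue E t \<omega>)))"
  proof (subst Bochner_Integration.integral_sum)
    show "integrable \<nu> (\<lambda>\<eta>. g (glue E t \<omega>) * indicator (cylinder S (D \<union> E) (glue E t \<omega>)) \<eta>)" for t
      using cyl by (intro integrable_mult_right integrable_real_indicator) (auto simp: emeasure_eq_measure)
  qed (use cyl in auto)
  finally show ?thesis .
qed

lemma measure_cylinder_split:
  assumes \<nu>: "prob_space \<nu>" "sets \<nu> = sets (config_space S)"
    and D: "finite D" "D \<subseteq> S" and E: "finite E" "E \<subseteq> S" "D \<inter> E = {}" and \<omega>: "\<omega> \<in> configs S"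
  shows "measure \<nu> (cylinder S D \<omega>) = (\<Sum>t\<in>configs E. measure \<nu> (cylinder S (D \<union> E) (glue E t \<omega>)))"
proof -
  interpret prob_space \<nu> by fact
  have "cylinder S D \<omega> \<in> sets \<nu>" using cylinder_measurable[OF D] \<nu>(2) by simp
  then show ?thesis using integral_local_function[OF \<nu> D E _ \<omega>, of "\<lambda>_. 1"] by simp
qed

text \<open>
  Approximating logarithms of ratios uniformly is as good as approximating the normalised probabilities uniformly, without a
  bound on the size of the logarithms.
\<close>

lemma ratio_from_logs:
  fixes a b :: "'b \<Rightarrow> real"
  assumes fin: "finite T" and \<sigma>: "\<sigma> \<in> T" and close: "\<And>\<tau>. \<tau> \<in> T \<Longrightarrow> \<bar>(a \<tau> - a \<sigma>) - (b \<tau> - b \<sigma>)\<bar> \<le> \<delta>"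
  shows "\<bar>exp (a \<sigma>) / (\<Sum>\<tau>\<in>T. exp (a \<tau>)) - exp (b \<sigma>) / (\<Sum>\<tau>\<in>T. exp (b \<tau>))\<bar> \<le> exp \<delta> - 1"
proof -
  define A B where "A = (\<Sum>\<tau>\<in>T. exp (a \<tau> - a \<sigma>))" and "B = (\<Sum>\<tau>\<in>T. exp (b \<tau> - b \<sigma>))"
  have A: "exp (a \<sigma>) / (\<Sum>\<tau>\<in>T. exp (a \<tau>)) = 1 / A" and B: "exp (b \<sigma>) / (\<Sum>\<tau>\<in>T. exp (b \<tau>)) = 1 / B"
    unfolding A_def B_def exp_diff sum_divide_distrib[symmetric] by simp_all
  have 1: "1 \<le> A" "1 \<le> B" unfolding A_def B_def
    using member_le_sum[OF \<sigma>, of "\<lambda>\<tau>. exp (a \<tau> - a \<sigma>)"] member_le_sum[OF \<sigma>, of "\<lambda>\<tau>. exp (b \<tau> - b \<sigma>)"] fin by auto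
  have \<delta>: "0 \<le> \<delta>" using close[OF \<sigma>] by simp
  have AB: "A \<le> exp \<delta> * B" unfolding A_def B_def sum_distrib_left exp_add[symmetric]
    by (rule sum_mono) (use close in \<open>fastforce simp: abs_le_iff\<close>)
  have BA: "B \<le> exp \<delta> * A" unfolding A_def B_def sum_distrib_left exp_add[symmetric]
    by (rule sum_mono) (use close in \<open>fastforce simp: abs_le_iff\<close>)
  have e: "0 \<le> exp \<delta> - 1" using \<delta> by simp
  have *: "1 / X - 1 / Y \<le> exp \<delta> - 1" if "1 \<le> X" "1 \<le> Y" "Y \<le> exp \<delta> * X" for X Y :: real
  proof -
    have "1 / X \<le> exp \<delta> / Y" using that by (simp add: field_simps)
    then have "1 / X - 1 / Y \<le> (exp \<delta> - 1) / Y" by (simp add: diff_divide_distrib)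
    also have "\<dots> \<le> exp \<delta> - 1" using that e mult_left_mono[of 1 Y "exp \<delta> - 1"] by (simp add: divide_le_eq)
    finally show ?thesis .
  qed
  show ?thesis unfolding A B using *[OF 1 BA] *[OF 1(2,1) AB] by linarith
qed


section \<open>A criterion for being a Gibbs measure\<close>

text \<open>
  As functions of \<open>A\<close> both sides are finite measures, so it is enough to compare them on cylinders.
\<close>

lemma (in prob_space) restricted_integral_eqI:
  fixes g h :: "'a \<Rightarrow> real"
  assumes f: "f \<in> measurable M (config_space T)" and g: "integrable M g" "\<And>x. 0 \<le> g x"
    and h: "integrable M h" "\<And>x. 0 \<le> h x"
    and eq: "\<And>J t. finite J \<Longrightarrow> J \<subseteq> T \<Longrightarrow> t \<in> configs J \<Longrightarrow>
      (\<integral>x. indicator (f -` cylinder T J t \<inter> space M) x * g x \<partial>M) = (\<integral>x. indicator (f -` cylinder T J t \<inter> space M) x * h x \<partial>M)"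
    and A: "A \<in> sets (config_space T)"
  shows "(\<integral>x. indicator (f -` A \<inter> space M) x * g x \<partial>M) = (\<integral>x. indicator (f -` A \<inter> space M) x * h x \<partial>M)"
proof -
  let ?Q = "\<lambda>g. distr (density M (\<lambda>x. ennreal (g x))) (config_space T) f"
  have Q: "measure (?Q g) B = (\<integral>x. indicator (f -` B \<inter> space M) x * g x \<partial>M)"
    if g: "integrable M g" "\<And>x. 0 \<le> g x" and B: "B \<in> sets (config_space T)" for g :: "'a \<Rightarrow> real" and B
  proof -
    let ?B = "f -` B \<inter> space M"
    have sB: "?B \<in> sets M" by (rule measurable_sets[OF f B])
    have int: "integrable M (\<lambda>x. indicator ?B x * g x)"
      using integrable_mult_indicator[OF sB g(1)] by simp
    have fd: "f \<in> measurable (density M (\<lambda>x. ennreal (g x))) (config_space T)" using f by simp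
    have "emeasure (density M (\<lambda>x. ennreal (g x))) ?B = (\<integral>\<^sup>+x. ennreal (g x) * indicator ?B x \<partial>M)"
      by (rule emeasure_density) (use sB g in auto)
    also have "\<dots> = (\<integral>\<^sup>+x. ennreal (indicator ?B x * g x) \<partial>M)"
      by (rule nn_integral_cong) (auto split: split_indicator)
    also have "\<dots> = ennreal (\<integral>x. indicator ?B x * g x \<partial>M)"
      by (rule nn_integral_eq_integral[OF int]) (use g in auto)
    finally have "measure (density M (\<lambda>x. ennreal (g x))) ?B = (\<integral>x. indicator ?B x * g x \<partial>M)"
      using g by (simp add: measure_def integral_nonneg_AE)
    then show ?thesis using measure_distr[OF fd B] by simp
  qed
  have fin: "finite_measure (?Q g)" if g: "integrable M g" "\<And>x. 0 \<le> g x" for g :: "'a \<Rightarrow> real"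
  proof -
    have "emeasure (density M (\<lambda>x. ennreal (g x))) (space M) = (\<integral>\<^sup>+x. ennreal (g x) * indicator (space M) x \<partial>M)"
      by (rule emeasure_density) (use g in auto)
    also have "\<dots> = (\<integral>\<^sup>+x. ennreal (g x) \<partial>M)" by (rule nn_integral_cong) simp
    also have "\<dots> = ennreal (\<integral>x. g x \<partial>M)" by (rule nn_integral_eq_integral[OF g(1)]) (use g in auto)
    finally have "finite_measure (density M (\<lambda>x. ennreal (g x)))" by (intro finite_measureI) simp
    then show ?thesis by (rule finite_measure.finite_measure_distr) (use f in simp)
  qed
  have "?Q g = ?Q h"
  proof (rule config_measure_eqI)
    fix J t assume J: "finite J" "J \<subseteq> T" "t \<in> configs J"
    show "measure (?Q g) (cylinder T J t) = measure (?Q h) (cylinder T J t)"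
      unfolding Q[OF g cylinder_measurable[OF J(1,2)]] Q[OF h cylinder_measurable[OF J(1,2)]]
      by (rule eq[OF J])
  qed (use fin[OF g] fin[OF h] in auto)
  then show ?thesis using Q[OF g A] Q[OF h A] by simp
qed

lemma merge_eq_glue:
  assumes "V \<subseteq> S" "\<omega> \<in> configs S"
  shows "merge V (S - V) (\<sigma>, \<omega>) = glue V \<sigma> \<omega>"
  using assms by (auto simp: merge_def glue_def fun_eq_iff PiE_iff extensional_def)

lemma exhausting_finite_sets:
  assumes "countable S"
  obtains D :: "nat \<Rightarrow> 'a set" where "\<And>n. finite (D n)" "\<And>n. D n \<subseteq> S"
    "filterlim D (finite_subsets_at_top S) sequentially"
proof (rule that[of "\<lambda>n. {x \<in> S. to_nat_on S x < n}"])
  show fin: "finite {x \<in> S. to_nat_on S x < n}" for n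
  proof -
    have "finite (to_nat_on S ` {x \<in> S. to_nat_on S x < n})" by (rule finite_subset[of _ "{..<n}"]) auto
    moreover have "inj_on (to_nat_on S) {x \<in> S. to_nat_on S x < n}"
      by (rule inj_on_subset[OF inj_on_to_nat_on[OF assms]]) auto
    ultimately show ?thesis using finite_imageD by blast
  qed
  show "filterlim (\<lambda>n. {x \<in> S. to_nat_on S x < n}) (finite_subsets_at_top S) sequentially"
    unfolding filterlim_finite_subsets_at_top
  proof (intro allI impI)
    fix \<Delta> assume \<Delta>: "finite \<Delta> \<and> \<Delta> \<subseteq> S"
    then have "eventually (\<lambda>n. \<forall>x\<in>\<Delta>. to_nat_on S x < n) sequentially"
      by (auto intro!: eventually_ball_finite eventually_gt_at_top)
    then show "\<forall>\<^sub>F n in sequentially. finite {x \<in> S. to_nat_on S x < n} \<and>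
        \<Delta> \<subseteq> {x \<in> S. to_nat_on S x < n} \<and> {x \<in> S. to_nat_on S x < n} \<subseteq> S"
      by (rule eventually_mono) (use \<Delta> fin in auto)
  qed
qed auto

lemma eventually_finite_supersets:
  assumes "finite X" "X \<subseteq> S"
  shows "\<forall>\<^sub>F \<Delta> in finite_subsets_at_top S. finite \<Delta> \<and> X \<subseteq> \<Delta> \<and> \<Delta> \<subseteq> S"
  unfolding eventually_finite_subsets_at_top using assms by blast

definition energy :: "'a set \<Rightarrow> ('a set \<Rightarrow> ('a \<Rightarrow> real) \<Rightarrow> real) \<Rightarrow> 'a set \<Rightarrow> ('a \<Rightarrow> real) \<Rightarrow> real" where
  "energy S U V \<omega> = (\<Sum>\<^sub>\<infinity>A\<in>finite_sets_meeting S V. U A \<omega>)"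

text \<open>
  For a finite set \<open>\<Delta>\<close> containing \<open>V\<close>, the function \<open>r \<Delta> \<sigma>\<close> below is the conditional probability of \<open>\<sigma>\<close> on \<open>V\<close>
  given the spins in \<open>\<Delta> - V\<close>. By hypothesis these functions converge uniformly to the Boltzmann form \<open>\<phi> \<sigma>\<close>. Each
  of them has the correct integral over cylinders on fewer sites off \<open>V\<close>, hence so has \<open>\<phi> \<sigma>\<close>, and cylinders determine the
  conditional expectation.
\<close>

theorem gibbs_from_log_ratios:
  fixes \<nu> :: "('a \<Rightarrow> real) measure"
  assumes S: "countable S" and \<nu>: "prob_space \<nu>" "sets \<nu> = sets (config_space S)"
    and pos: "\<And>\<Delta> \<omega>. finite \<Delta> \<Longrightarrow> \<Delta> \<subseteq> S \<Longrightarrow> \<omega> \<in> configs S \<Longrightarrow> 0 < measure \<nu> (cylinder S \<Delta> \<omega>)"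
    and U: "is_potential S U" "uniformly_absolutely_convergent S U"
    and lim: "\<And>V \<epsilon>. finite V \<Longrightarrow> V \<subseteq> S \<Longrightarrow> 0 < \<epsilon> \<Longrightarrow>
      \<forall>\<^sub>F \<Delta> in finite_subsets_at_top S. \<forall>\<omega>\<in>configs S. \<forall>\<sigma>\<in>configs V. \<forall>\<tau>\<in>configs V.
         \<bar>(ln (measure \<nu> (cylinder S \<Delta> (glue V \<tau> \<omega>))) - ln (measure \<nu> (cylinder S \<Delta> (glue V \<sigma> \<omega>))))
          - (energy S U V (glue V \<sigma> \<omega>) - energy S U V (glue V \<tau> \<omega>))\<bar> \<le> \<epsilon>"
  shows "is_gibbs_measure S \<nu>"
  unfolding is_gibbs_measure_def
proof (intro conjI exI[of _ U] allI impI)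
  fix V assume V: "finite V \<and> V \<subseteq> S"
  then have finV: "finite V" and VS: "V \<subseteq> S" by auto
  interpret prob_space \<nu> by (rule \<nu>(1))
  have space: "space \<nu> = configs S" using sets_eq_imp_space_eq[OF \<nu>(2)] by (simp add: space_config_space)
  let ?F = "outside_algebra S V" and ?f = "\<lambda>\<omega>. restrict \<omega> (S - V)"
  let ?p = "\<lambda>\<Delta> \<omega>. measure \<nu> (cylinder S \<Delta> \<omega>)"
  have fS: "?f \<in> configs S \<rightarrow> space (config_space (S - V))"
    by (rule funcsetI) (auto simp: space_config_space PiE_iff)
  have f\<nu>: "?f \<in> measurable \<nu> (config_space (S - V))"
    using measurable_restrict_subset[of "S - V" S "\<lambda>_. count_space spins"] \<nu>(2)
    by (simp add: config_space_def cong: measurable_cong_sets)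
  have spaceF: "space ?F = configs S" by (simp add: outside_algebra_def)
  have setsF: "sets ?F = {?f -` A \<inter> configs S | A. A \<in> sets (config_space (S - V))}"
    unfolding outside_algebra_def by (rule sets_vimage_algebra2[OF fS])
  have sub: "subalgebra \<nu> ?F"
    unfolding subalgebra_def space spaceF setsF using measurable_sets[OF f\<nu>] by (auto simp: space)
  have "finite_measure_subalgebra \<nu> ?F"
    using sub by (simp add: finite_measure_subalgebra_def finite_measure_subalgebra_axioms_def finite_measure_axioms)
  then interpret sigma_finite_subalgebra \<nu> ?F by (rule finite_measure_subalgebra_is_sigma_finite)
  have cyl: "cylinder S \<Delta> \<omega> \<in> sets \<nu>" if "finite \<Delta>" "\<Delta> \<subseteq> S" for \<Delta> \<omega>
    using cylinder_measurable[OF that] \<nu>(2) by simp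
  obtain D where D: "\<And>n. finite (D n)" "\<And>n. D n \<subseteq> S"
    "filterlim D (finite_subsets_at_top S) sequentially"
    using exhausting_finite_sets[OF S] by metis

  define r where "r \<Delta> \<sigma> \<omega> = ?p \<Delta> (glue V \<sigma> \<omega>) / (\<Sum>\<tau>\<in>configs V. ?p \<Delta> (glue V \<tau> \<omega>))" for \<Delta> \<sigma> \<omega>
  define \<phi> where "\<phi> \<sigma> \<omega> = exp (- energy S U V (glue V \<sigma> \<omega>)) /
      (\<Sum>\<tau>\<in>configs V. exp (- energy S U V (glue V \<tau> \<omega>)))" for \<sigma> \<omega>
  have r01: "0 \<le> r \<Delta> \<sigma> \<omega>" for \<Delta> \<sigma> \<omega>
    unfolding r_def by (intro divide_nonneg_nonneg sum_nonneg) auto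
  have r1: "r \<Delta> \<sigma> \<omega> \<le> 1" if "\<sigma> \<in> configs V" for \<Delta> \<sigma> \<omega>
    unfolding r_def using member_le_sum[OF that, of "\<lambda>\<tau>. ?p \<Delta> (glue V \<tau> \<omega>)"] finite_configs[OF finV]
    by (intro divide_le_eq_1[THEN iffD2]) (auto simp: less_le sum_nonneg)
  have \<phi>0: "0 \<le> \<phi> \<sigma> \<omega>" for \<sigma> \<omega>
    unfolding \<phi>_def by (intro divide_nonneg_nonneg sum_nonneg) auto
  have \<phi>1: "\<phi> \<sigma> \<omega> \<le> 1" if "\<sigma> \<in> configs V" for \<sigma> \<omega>
    unfolding \<phi>_def using member_le_sum[OF that, of "\<lambda>\<tau>. exp (- energy S U V (glue V \<tau> \<omega>))"] finite_configs[OF finV]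
    by (intro divide_le_eq_1[THEN iffD2]) (auto simp: less_le sum_nonneg)

  have unif: "\<forall>\<^sub>F \<Delta> in finite_subsets_at_top S.
      \<forall>\<omega>\<in>configs S. \<forall>\<sigma>\<in>configs V. \<bar>r \<Delta> \<sigma> \<omega> - \<phi> \<sigma> \<omega>\<bar> \<le> \<epsilon>" if \<epsilon>: "0 < \<epsilon>" for \<epsilon>
  proof -
    have "0 < ln (1 + \<epsilon>)" using \<epsilon> by simp
    from eventually_conj[OF lim[OF finV VS this] eventually_finite_supersets[of "{}" S, OF finite.emptyI empty_subsetI]]
    show ?thesis
    proof (rule eventually_mono, elim conjE, intro ballI)
      fix \<Delta> \<omega> \<sigma>
      assume close: "\<forall>\<omega>\<in>configs S. \<forall>\<sigma>\<in>configs V. \<forall>\<tau>\<in>configs V.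
         \<bar>(ln (?p \<Delta> (glue V \<tau> \<omega>)) - ln (?p \<Delta> (glue V \<sigma> \<omega>)))
          - (energy S U V (glue V \<sigma> \<omega>) - energy S U V (glue V \<tau> \<omega>))\<bar> \<le> ln (1 + \<epsilon>)"
        and \<Delta>: "finite \<Delta>" "\<Delta> \<subseteq> S" and \<omega>: "\<omega> \<in> configs S" and \<sigma>: "\<sigma> \<in> configs V"
      have e: "exp (ln (?p \<Delta> (glue V \<tau> \<omega>))) = ?p \<Delta> (glue V \<tau> \<omega>)" if "\<tau> \<in> configs V" for \<tau>
        using pos[OF \<Delta> glue_in_configs[OF that \<omega> VS]] by simp
      note close = bspec[OF bspec[OF bspec[OF close \<omega>] \<sigma>]]
      have "\<bar>exp (ln (?p \<Delta> (glue V \<sigma> \<omega>))) / (\<Sum>\<tau>\<in>configs V. exp (ln (?p \<Delta> (glue V \<tau> \<omega>)))) -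
            exp (- energy S U V (glue V \<sigma> \<omega>)) / (\<Sum>\<tau>\<in>configs V. exp (- energy S U V (glue V \<tau> \<omega>)))\<bar>
            \<le> exp (ln (1 + \<epsilon>)) - 1"
        by (rule ratio_from_logs[OF finite_configs[OF finV] \<sigma>]) (drule close, simp)
      then show "\<bar>r \<Delta> \<sigma> \<omega> - \<phi> \<sigma> \<omega>\<bar> \<le> \<epsilon>" using e \<sigma> \<epsilon> by (simp add: r_def \<phi>_def)
    qed
  qed

  have restr: "(\<lambda>\<omega>. restrict \<omega> (\<Delta> - V)) \<in> measurable ?F (count_space (configs (\<Delta> - V)))"
    if \<Delta>: "finite \<Delta>" "\<Delta> \<subseteq> S" for \<Delta>
  proof -
    have "(\<lambda>\<omega>. restrict (?f \<omega>) (\<Delta> - V)) \<in> measurable ?F (config_space (\<Delta> - V))"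
      unfolding outside_algebra_def
      by (rule measurable_compose[OF measurable_vimage_algebra1[OF fS]])
         (unfold config_space_def, rule measurable_restrict_subset, use \<Delta> in blast)
    moreover have "restrict (?f \<omega>) (\<Delta> - V) = restrict \<omega> (\<Delta> - V)" for \<omega> :: "'a \<Rightarrow> real"
      using \<Delta>(2) by (auto simp: restrict_def fun_eq_iff)
    moreover have "config_space (\<Delta> - V) = count_space (configs (\<Delta> - V))"
      unfolding config_space_def by (rule count_space_PiM_finite) (use \<Delta> in auto)
    ultimately show ?thesis by (simp only:)
  qed
  have r_meas: "r \<Delta> \<sigma> \<in> borel_measurable ?F" if \<Delta>: "finite \<Delta>" "\<Delta> \<subseteq> S" for \<Delta> \<sigma>
  proof -
    have "(\<lambda>\<omega>. r \<Delta> \<sigma> (restrict \<omega> (\<Delta> - V))) \<in> borel_measurable ?F"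
      by (rule measurable_compose[OF restr[OF \<Delta>]]) simp
    moreover have "cylinder S \<Delta> (glue V \<tau> (restrict \<omega> (\<Delta> - V))) = cylinder S \<Delta> (glue V \<tau> \<omega>)" for \<omega> \<tau>
      by (rule cylinder_cong) (auto simp: glue_def)
    then have "r \<Delta> \<sigma> (restrict \<omega> (\<Delta> - V)) = r \<Delta> \<sigma> \<omega>" for \<omega> by (simp only: r_def)
    ultimately show ?thesis by (simp only:)
  qed
  have \<phi>_meas: "\<phi> \<sigma> \<in> borel_measurable ?F" if \<sigma>: "\<sigma> \<in> configs V" for \<sigma>
  proof (rule borel_measurable_LIMSEQ_real)
    fix n show "r (D n) \<sigma> \<in> borel_measurable ?F" by (rule r_meas[OF D(1,2)])
  next
    fix \<omega> assume "\<omega> \<in> space ?F"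
    then have \<omega>: "\<omega> \<in> configs S" by (simp add: spaceF)
    show "(\<lambda>n. r (D n) \<sigma> \<omega>) \<longlonglongrightarrow> \<phi> \<sigma> \<omega>"
    proof (rule tendstoI)
      fix e :: real assume e: "0 < e"
      have "\<forall>\<^sub>F n in sequentially. \<forall>\<omega>\<in>configs S. \<forall>\<sigma>\<in>configs V. \<bar>r (D n) \<sigma> \<omega> - \<phi> \<sigma> \<omega>\<bar> \<le> e / 2"
        using unif[of "e / 2"] e by (intro eventually_compose_filterlim[OF _ D(3)]) simp
      then show "\<forall>\<^sub>F n in sequentially. dist (r (D n) \<sigma> \<omega>) (\<phi> \<sigma> \<omega>) < e"
      proof (rule eventually_mono)
        fix n assume "\<forall>\<omega>\<in>configs S. \<forall>\<sigma>\<in>configs V. \<bar>r (D n) \<sigma> \<omega> - \<phi> \<sigma> \<omega>\<bar> \<le> e / 2"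
        from bspec[OF bspec[OF this \<omega>] \<sigma>] e show "dist (r (D n) \<sigma> \<omega>) (\<phi> \<sigma> \<omega>) < e" by (simp add: dist_real_def)
      qed
    qed
  qed
  have int_r: "integrable \<nu> (r \<Delta> \<sigma>)" if "finite \<Delta>" "\<Delta> \<subseteq> S" "\<sigma> \<in> configs V" for \<Delta> \<sigma>
    by (rule integrable_const_bound[of _ 1])
       (use r01 r1[OF that(3)] measurable_from_subalg[OF sub r_meas[OF that(1,2)]] in auto)
  have int_\<phi>: "integrable \<nu> (\<phi> \<sigma>)" if "\<sigma> \<in> configs V" for \<sigma>
    by (rule integrable_const_bound[of _ 1])
       (use \<phi>0 \<phi>1[OF that] measurable_from_subalg[OF sub \<phi>_meas[OF that]] in auto)

  \<comment> \<open>The conditional probabilities given finitely many spins have the correct integrals, by splitting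
      the cylinder according to the spins in \<open>\<Delta> - V\<close>.\<close>
  have exact: "(\<integral>\<eta>. indicator (cylinder S J \<omega>) \<eta> * r \<Delta> \<sigma> \<eta> \<partial>\<nu>) = ?p (J \<union> V) (glue V \<sigma> \<omega>)"
    if J: "finite J" "J \<subseteq> S - V" and \<Delta>: "finite \<Delta>" "J \<union> V \<subseteq> \<Delta>" "\<Delta> \<subseteq> S" and \<omega>: "\<omega> \<in> configs S" and \<sigma>: "\<sigma> \<in> configs V"
    for J \<omega> \<sigma> \<Delta>
  proof -
    let ?E = "\<Delta> - V - J"
    have JS: "J \<subseteq> S" and E: "finite ?E" "?E \<subseteq> S" "J \<inter> ?E = {}" using J \<Delta> by auto
    have JE: "J \<union> ?E = \<Delta> - V" using J \<Delta> by auto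
    have loc: "r \<Delta> \<sigma> \<eta> = r \<Delta> \<sigma> \<eta>'" if "\<And>i. i \<in> J \<union> ?E \<Longrightarrow> \<eta> i = \<eta>' i" for \<eta> \<eta>'
    proof -
      have "cylinder S \<Delta> (glue V \<tau> \<eta>) = cylinder S \<Delta> (glue V \<tau> \<eta>')" for \<tau>
        by (rule cylinder_cong) (use that JE in \<open>auto simp: glue_def\<close>)
      then show ?thesis by (simp add: r_def)
    qed
    have "(\<integral>\<eta>. indicator (cylinder S J \<omega>) \<eta> * r \<Delta> \<sigma> \<eta> \<partial>\<nu>) =
        (\<Sum>t\<in>configs ?E. r \<Delta> \<sigma> (glue ?E t \<omega>) * ?p (J \<union> ?E) (glue ?E t \<omega>))"
      by (rule integral_local_function[OF \<nu> J(1) JS E loc \<omega>]) auto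
    also have "\<dots> = (\<Sum>t\<in>configs ?E. ?p ((J \<union> V) \<union> ?E) (glue ?E t (glue V \<sigma> \<omega>)))"
    proof (rule sum.cong[OF refl])
      fix t assume t: "t \<in> configs ?E"
      let ?x = "glue ?E t \<omega>"
      have x: "?x \<in> configs S" by (rule glue_in_configs[OF t \<omega> E(2)])
      have un: "(\<Delta> - V) \<union> V = \<Delta>" "\<Delta> \<union> V = \<Delta>" "(J \<union> V) \<union> ?E = \<Delta>" using \<Delta> by auto
      have "?p (\<Delta> - V) ?x = (\<Sum>\<tau>\<in>configs V. ?p ((\<Delta> - V) \<union> V) (glue V \<tau> ?x))"
        by (rule measure_cylinder_split[OF \<nu> _ _ finV VS _ x]) (use \<Delta> in auto)
      moreover have "0 < ?p (\<Delta> - V) ?x" by (rule pos[OF _ _ x]) (use \<Delta> in auto)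
      ultimately have "r \<Delta> \<sigma> ?x * ?p (\<Delta> - V) ?x = ?p \<Delta> (glue V \<sigma> ?x)" by (simp add: r_def un)
      also have "glue V \<sigma> ?x = glue ?E t (glue V \<sigma> \<omega>)" by (auto simp: glue_def)
      finally show "r \<Delta> \<sigma> ?x * ?p (J \<union> ?E) ?x = ?p ((J \<union> V) \<union> ?E) (glue ?E t (glue V \<sigma> \<omega>))"
        by (simp only: JE un)
    qed
    also have "\<dots> = ?p (J \<union> V) (glue V \<sigma> \<omega>)"
      by (rule measure_cylinder_split[OF \<nu> _ _ E(1,2) _ glue_in_configs[OF \<sigma> \<omega> VS], symmetric])
         (use J finV VS in auto)
    finally show ?thesis .
  qed
  have main: "(\<integral>\<eta>. indicator (cylinder S J \<omega>) \<eta> * \<phi> \<sigma> \<eta> \<partial>\<nu>) = ?p (J \<union> V) (glue V \<sigma> \<omega>)"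
    if J: "finite J" "J \<subseteq> S - V" and \<omega>: "\<omega> \<in> configs S" and \<sigma>: "\<sigma> \<in> configs V" for J \<omega> \<sigma>
  proof -
    have JS: "J \<subseteq> S" using J by blast
    let ?I = "indicator (cylinder S J \<omega>) :: _ \<Rightarrow> real"
    have int: "integrable \<nu> (\<lambda>\<eta>. ?I \<eta> * g \<eta>)" if "integrable \<nu> g" for g :: "_ \<Rightarrow> real"
      using integrable_mult_indicator[OF cyl[OF J(1) JS] that] by simp
    have "\<bar>(\<integral>\<eta>. ?I \<eta> * \<phi> \<sigma> \<eta> \<partial>\<nu>) - ?p (J \<union> V) (glue V \<sigma> \<omega>)\<bar> \<le> \<epsilon>" if \<epsilon>: "0 < \<epsilon>" for \<epsilon>
    proof -
      have "finite (J \<union> V)" "J \<union> V \<subseteq> S" using J finV VS by auto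
      from eventually_happens'[OF finite_subsets_at_top_neq_bot
          eventually_conj[OF unif[OF \<epsilon>] eventually_finite_supersets[OF this]]]
      obtain \<Delta> where ev: "(\<forall>\<omega>\<in>configs S. \<forall>\<sigma>\<in>configs V. \<bar>r \<Delta> \<sigma> \<omega> - \<phi> \<sigma> \<omega>\<bar> \<le> \<epsilon>) \<and>
        (finite \<Delta> \<and> J \<union> V \<subseteq> \<Delta> \<and> \<Delta> \<subseteq> S)" ..
      note close = conjunct1[OF ev]
      have \<Delta>: "finite \<Delta>" "J \<union> V \<subseteq> \<Delta>" "\<Delta> \<subseteq> S" using conjunct2[OF ev] by simp_all
      have b: "\<bar>?I \<eta> * \<phi> \<sigma> \<eta> - ?I \<eta> * r \<Delta> \<sigma> \<eta>\<bar> \<le> \<epsilon>" if "\<eta> \<in> space \<nu>" for \<eta>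
        using bspec[OF bspec[OF close] \<sigma>, of \<eta>] that \<epsilon> unfolding space by (auto split: split_indicator)
      have "\<bar>(\<integral>\<eta>. ?I \<eta> * \<phi> \<sigma> \<eta> \<partial>\<nu>) - (\<integral>\<eta>. ?I \<eta> * r \<Delta> \<sigma> \<eta> \<partial>\<nu>)\<bar>
          = \<bar>\<integral>\<eta>. ?I \<eta> * \<phi> \<sigma> \<eta> - ?I \<eta> * r \<Delta> \<sigma> \<eta> \<partial>\<nu>\<bar>"
        using int[OF int_\<phi>[OF \<sigma>]] int[OF int_r[OF \<Delta>(1,3) \<sigma>]] by simp
      also have "\<dots> \<le> (\<integral>\<eta>. \<bar>?I \<eta> * \<phi> \<sigma> \<eta> - ?I \<eta> * r \<Delta> \<sigma> \<eta>\<bar> \<partial>\<nu>)" by (rule integral_abs_bound)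
      also have "\<dots> \<le> (\<integral>\<eta>. \<epsilon> \<partial>\<nu>)"
      proof (rule integral_mono)
        show "integrable \<nu> (\<lambda>\<eta>. \<bar>?I \<eta> * \<phi> \<sigma> \<eta> - ?I \<eta> * r \<Delta> \<sigma> \<eta>\<bar>)"
          by (intro integrable_abs Bochner_Integration.integrable_diff int int_\<phi> int_r \<sigma> \<Delta>(1,3))
      qed (simp, rule b)
      also have "\<dots> = \<epsilon>" by (simp add: prob_space)
      finally show ?thesis using exact[OF J \<Delta> \<omega> \<sigma>] by simp
    qed
    then have "\<bar>(\<integral>\<eta>. ?I \<eta> * \<phi> \<sigma> \<eta> \<partial>\<nu>) - ?p (J \<union> V) (glue V \<sigma> \<omega>)\<bar> \<le> 0"
      by (rule field_le_epsilon) (simp only: add_0)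
    then show ?thesis by simp
  qed
  have cond: "AE \<omega> in \<nu>. real_cond_exp \<nu> ?F (indicator {\<eta> \<in> configs S. restrict \<eta> V = \<sigma>}) \<omega> = \<phi> \<sigma> \<omega>"
    if \<sigma>: "\<sigma> \<in> configs V" for \<sigma>
  proof -
    let ?C = "{\<eta> \<in> configs S. restrict \<eta> V = \<sigma>}"
    have C: "?C = cylinder S V \<sigma>"
      using \<sigma> by (auto simp: cylinder_def restrict_def fun_eq_iff PiE_iff extensional_def)
    have int_C: "integrable \<nu> (indicator ?C :: _ \<Rightarrow> real)"
      unfolding C using cyl[OF finV VS] by (intro integrable_real_indicator) (auto simp: emeasure_eq_measure)
    show ?thesis
    proof (rule real_cond_exp_charact[OF _ int_C int_\<phi>[OF \<sigma>] \<phi>_meas[OF \<sigma>]])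
      fix A assume "A \<in> sets ?F"
      then obtain A' where A': "A' \<in> sets (config_space (S - V))" "A = ?f -` A' \<inter> space \<nu>"
        unfolding setsF space by blast
      have "(\<integral>x. indicator (?f -` A' \<inter> space \<nu>) x * indicator ?C x \<partial>\<nu>) =
          (\<integral>x. indicator (?f -` A' \<inter> space \<nu>) x * \<phi> \<sigma> x \<partial>\<nu>)"
      proof (rule restricted_integral_eqI[OF f\<nu> int_C _ int_\<phi>[OF \<sigma>] \<phi>0 _ A'(1)])
        fix J t assume J: "finite J" "J \<subseteq> S - V" "t \<in> configs J"
        define \<omega> where "\<omega> = glue J t (\<lambda>i. if i \<in> S then 1 else undefined)"
        have \<omega>: "\<omega> \<in> configs S" unfolding \<omega>_def by (rule glue_in_configs[OF J(3) configs_nonempty]) (use J in auto)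
        have JS: "J \<subseteq> S" using J by blast
        have eq: "?f -` cylinder (S - V) J t \<inter> space \<nu> = cylinder S J \<omega>"
          unfolding space
        proof (intro set_eqI iffI)
          fix \<eta> assume "\<eta> \<in> ?f -` cylinder (S - V) J t \<inter> configs S"
          then show "\<eta> \<in> cylinder S J \<omega>" using J(2) by (auto simp: cylinder_def \<omega>_def glue_def subset_iff)
        next
          fix \<eta> assume \<eta>: "\<eta> \<in> cylinder S J \<omega>"
          then have "\<eta> \<in> configs S" by (simp add: cylinder_def)
          moreover from this have "?f \<eta> \<in> configs (S - V)" by (auto simp: PiE_iff)
          moreover have "\<forall>i\<in>J. ?f \<eta> i = t i" using \<eta> J(2) by (auto simp: cylinder_def \<omega>_def glue_def subset_iff)
          ultimately show "\<eta> \<in> ?f -` cylinder (S - V) J t \<inter> configs S" by (simp add: cylinder_def)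
        qed
        have "(\<integral>x. indicator (cylinder S J \<omega>) x * indicator ?C x \<partial>\<nu>) = (\<integral>x. indicator (cylinder S (J \<union> V) (glue V \<sigma> \<omega>)) x \<partial>\<nu> :: real)"
        proof (rule Bochner_Integration.integral_cong[OF refl])
          fix x
          have "x \<in> cylinder S (J \<union> V) (glue V \<sigma> \<omega>) \<longleftrightarrow> x \<in> cylinder S J \<omega> \<and> x \<in> ?C"
            unfolding C using J(2) by (auto simp: cylinder_def glue_def subset_iff)
          then show "indicator (cylinder S J \<omega>) x * indicator ?C x = (indicator (cylinder S (J \<union> V) (glue V \<sigma> \<omega>)) x :: real)"
            by (simp add: indicator_def)
        qed
        also have "\<dots> = ?p (J \<union> V) (glue V \<sigma> \<omega>)"
        proof -
          have "cylinder S (J \<union> V) (glue V \<sigma> \<omega>) \<in> sets \<nu>" by (rule cyl) (use J JS finV VS in auto)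
          then show ?thesis by simp
        qed
        also have "\<dots> = (\<integral>\<eta>. indicator (cylinder S J \<omega>) \<eta> * \<phi> \<sigma> \<eta> \<partial>\<nu>)" by (rule main[OF J(1,2) \<omega> \<sigma>, symmetric])
        finally show "(\<integral>x. indicator (?f -` cylinder (S - V) J t \<inter> space \<nu>) x * indicator ?C x \<partial>\<nu>) =
          (\<integral>x. indicator (?f -` cylinder (S - V) J t \<inter> space \<nu>) x * \<phi> \<sigma> x \<partial>\<nu>)" unfolding eq .
      qed simp
      then show "(\<integral>x\<in>A. indicator ?C x \<partial>\<nu>) = (\<integral>x\<in>A. \<phi> \<sigma> x \<partial>\<nu>)"
        unfolding A'(2) set_lebesgue_integral_def by simp
    qed
  qed
  have "AE \<omega> in \<nu>. \<forall>\<sigma>\<in>configs V. real_cond_exp \<nu> ?F (indicator {\<eta> \<in> configs S. restrict \<eta> V = \<sigma>}) \<omega> = \<phi> \<sigma> \<omega>"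
    using cond finite_configs[OF finV] by (intro AE_finite_allI) auto
  then show "AE \<omega> in \<nu>. \<forall>\<sigma>\<in>configs V. real_cond_exp \<nu> ?F (indicator {\<eta> \<in> configs S. restrict \<eta> V = \<sigma>}) \<omega> =
      boltzmann_factor S U V \<sigma> \<omega> / (\<Sum>\<tau>\<in>configs V. boltzmann_factor S U V \<tau> \<omega>)"
  proof (rule AE_mp, intro AE_I2 impI)
    fix \<omega> assume "\<omega> \<in> space \<nu>" and *: "\<forall>\<sigma>\<in>configs V. real_cond_exp \<nu> ?F (indicator {\<eta> \<in> configs S. restrict \<eta> V = \<sigma>}) \<omega> = \<phi> \<sigma> \<omega>"
    then have \<omega>: "\<omega> \<in> configs S" by (simp add: space)
    have "boltzmann_factor S U V \<tau> \<omega> = exp (- energy S U V (glue V \<tau> \<omega>))" for \<tau>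
      by (simp add: boltzmann_factor_def energy_def merge_eq_glue[OF VS \<omega>])
    then show "\<forall>\<sigma>\<in>configs V. real_cond_exp \<nu> ?F (indicator {\<eta> \<in> configs S. restrict \<eta> V = \<sigma>}) \<omega> =
      boltzmann_factor S U V \<sigma> \<omega> / (\<Sum>\<tau>\<in>configs V. boltzmann_factor S U V \<tau> \<omega>)"
      using * by (simp add: \<phi>_def)
  qed
qed (use \<nu> U in auto)


section \<open>Kozlov's construction of the potential\<close>

lemma configs_not_empty: "configs S \<noteq> {}"
proof
  assume "configs S = {}"
  then show False using configs_nonempty[of S] by (simp only: empty_iff)
qed

text \<open>
  For finitely many sites a single interaction term, minus the logarithm of the probability of a configuration, does it.
\<close>

lemma gibbs_if_finite:
  assumes fin: "finite S" and \<nu>: "prob_space \<nu>" "sets \<nu> = sets (config_space S)"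
    and pos: "\<And>\<Delta> \<omega>. finite \<Delta> \<Longrightarrow> \<Delta> \<subseteq> S \<Longrightarrow> \<omega> \<in> configs S \<Longrightarrow> 0 < measure \<nu> (cylinder S \<Delta> \<omega>)"
  shows "is_gibbs_measure S \<nu>"
proof (rule gibbs_from_log_ratios[OF countable_finite[OF fin] \<nu> pos])
  define U where "U A \<omega> = (if A = S \<and> S \<noteq> {} then - ln (measure \<nu> (cylinder S S \<omega>)) else 0)" for A \<omega>
  show "is_potential S U"
    unfolding is_potential_def
  proof (intro conjI ballI allI impI)
    fix A and \<sigma> \<tau> :: "'a \<Rightarrow> real" assume "\<forall>i\<in>A. \<sigma> i = \<tau> i"
    then have "A = S \<Longrightarrow> cylinder S S \<sigma> = cylinder S S \<tau>" by (intro cylinder_cong) blast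
    then show "U A \<sigma> = U A \<tau>" by (auto simp: U_def)
  qed (auto simp: U_def)
  have finm: "finite (finite_sets_meeting S V)" for V
    by (rule finite_subset[of _ "Pow S"]) (use fin in \<open>auto simp: finite_sets_meeting_def\<close>)
  then show "uniformly_absolutely_convergent S U"
    by (simp add: uniformly_absolutely_convergent_def)
  fix V :: "'a set" and \<epsilon> :: real assume V: "finite V" "V \<subseteq> S" and \<epsilon>: "0 < \<epsilon>"
  have "energy S U V \<omega> = - ln (measure \<nu> (cylinder S S \<omega>))" if "V \<noteq> {}" for \<omega>
  proof -
    have S: "S \<in> finite_sets_meeting S V" "S \<noteq> {}" using V fin that by (auto simp: finite_sets_meeting_def)
    have "energy S U V \<omega> = (\<Sum>A\<in>finite_sets_meeting S V. if A = S then - ln (measure \<nu> (cylinder S S \<omega>)) else 0)"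
      unfolding energy_def infsum_finite[OF finm] by (rule sum.cong) (use S in \<open>auto simp: U_def\<close>)
    then show ?thesis using S finm by simp
  qed
  moreover have "\<sigma> = \<tau>" if "V = {}" "\<sigma> \<in> configs V" "\<tau> \<in> configs V" for \<sigma> \<tau> :: "'a \<Rightarrow> real"
    using that by auto
  ultimately have "\<forall>\<omega>\<in>configs S. \<forall>\<sigma>\<in>configs V. \<forall>\<tau>\<in>configs V.
         \<bar>(ln (measure \<nu> (cylinder S S (glue V \<tau> \<omega>))) - ln (measure \<nu> (cylinder S S (glue V \<sigma> \<omega>))))
          - (energy S U V (glue V \<sigma> \<omega>) - energy S U V (glue V \<tau> \<omega>))\<bar> \<le> \<epsilon>"
    using \<epsilon> by (cases "V = {}") auto
  then show "\<forall>\<^sub>F \<Delta> in finite_subsets_at_top S. \<forall>\<omega>\<in>configs S. \<forall>\<sigma>\<in>configs V. \<forall>\<tau>\<in>configs V.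
         \<bar>(ln (measure \<nu> (cylinder S \<Delta> (glue V \<tau> \<omega>))) - ln (measure \<nu> (cylinder S \<Delta> (glue V \<sigma> \<omega>))))
          - (energy S U V (glue V \<sigma> \<omega>) - energy S U V (glue V \<tau> \<omega>))\<bar> \<le> \<epsilon>"
    by (simp add: eventually_finite_subsets_at_top_finite[OF fin])
qed

text \<open>
  The function \<open>L x\<close> is the energy gained by changing the spin at \<open>x\<close> to plus, given all other spins. It is the
  uniform limit of local functions.
\<close>

locale flip_ratios =
  fixes S :: "'a set" and \<nu> :: "('a \<Rightarrow> real) measure" and L :: "'a \<Rightarrow> ('a \<Rightarrow> real) \<Rightarrow> real"
  assumes countable: "countable S" and infinite: "infinite S"
    and prob: "prob_space \<nu>" and sets: "sets \<nu> = sets (config_space S)"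
    and pos: "\<And>\<Delta> \<omega>. finite \<Delta> \<Longrightarrow> \<Delta> \<subseteq> S \<Longrightarrow> \<omega> \<in> configs S \<Longrightarrow> 0 < measure \<nu> (cylinder S \<Delta> \<omega>)"
    and flip: "\<And>x. x \<in> S \<Longrightarrow> uniform_limit (configs S)
      (\<lambda>\<Delta> \<omega>. ln (measure \<nu> (cylinder S \<Delta> \<omega>)) - ln (measure \<nu> (cylinder S \<Delta> ((\<omega>)(x := 1))))) (L x) (finite_subsets_at_top S)"
begin

abbreviation p :: "'a set \<Rightarrow> ('a \<Rightarrow> real) \<Rightarrow> real" where "p \<Delta> \<omega> \<equiv> measure \<nu> (cylinder S \<Delta> \<omega>)"

definition site_at :: "nat \<Rightarrow> 'a" where "site_at = from_nat_into S"
definition rank :: "'a \<Rightarrow> nat" where "rank = to_nat_on S"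

lemma rank_site_at [simp]: "rank (site_at n) = n"
  by (simp add: rank_def site_at_def countable infinite)

lemma site_at_in [simp]: "site_at n \<in> S"
  using infinite by (auto simp: site_at_def intro!: from_nat_into)

lemma site_at_rank: "x \<in> S \<Longrightarrow> site_at (rank x) = x"
  by (simp add: rank_def site_at_def countable)

lemma inj_site_at: "inj site_at"
  by (metis injI rank_site_at)

definition plus_before :: "nat \<Rightarrow> ('a \<Rightarrow> real) \<Rightarrow> 'a \<Rightarrow> real" where
  "plus_before n \<omega> = (\<lambda>i. if i \<in> S \<and> rank i < n then 1 else \<omega> i)"

definition plus_from :: "nat \<Rightarrow> ('a \<Rightarrow> real) \<Rightarrow> 'a \<Rightarrow> real" where
  "plus_from m \<omega> = (\<lambda>i. if i \<in> S \<and> m \<le> rank i then 1 else \<omega> i)"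

lemma plus_in_configs:
  "\<omega> \<in> configs S \<Longrightarrow> plus_before n \<omega> \<in> configs S" "\<omega> \<in> configs S \<Longrightarrow> plus_from n \<omega> \<in> configs S"
  by (auto simp: plus_before_def plus_from_def PiE_iff extensional_def)

lemma plus_before_0: "plus_before 0 \<omega> = \<omega>"
  by (simp add: plus_before_def)

lemma plus_before_Suc: "plus_before (Suc n) \<omega> = (plus_before n \<omega>)(site_at n := 1)"
proof
  fix i
  have "i \<in> S \<and> rank i < Suc n \<longleftrightarrow> i \<in> S \<and> rank i < n \<or> i = site_at n"
    using site_at_rank[of i] by (auto simp: less_Suc_eq)
  then show "plus_before (Suc n) \<omega> i = ((plus_before n \<omega>)(site_at n := 1)) i"
    by (auto simp: plus_before_def)
qed

text \<open>
  The energy of changing the spin of rank \<open>n\<close> after all earlier ones have been changed to plus. Summing over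
  \<open>n < N\<close> telescopes to the energy of changing the first \<open>N\<close> spins.
\<close>

definition step :: "nat \<Rightarrow> ('a \<Rightarrow> real) \<Rightarrow> real" where
  "step n \<omega> = L (site_at n) (plus_before n \<omega>)"

lemma flip_close:
  assumes "x \<in> S" "0 < \<epsilon>"
  shows "\<forall>\<^sub>F \<Delta> in finite_subsets_at_top S. \<forall>\<omega>\<in>configs S. \<bar>(ln (p \<Delta> \<omega>) - ln (p \<Delta> ((\<omega>)(x := 1)))) - L x \<omega>\<bar> < \<epsilon>"
  using flip[OF assms(1)] assms(2) unfolding uniform_limit_iff dist_real_def by blast

lemma finite_below_rank:
  assumes "finite \<Delta>" obtains N where "\<And>x. x \<in> \<Delta> \<Longrightarrow> rank x < N"
proof -
  obtain N where "\<forall>n\<in>rank ` \<Delta>. n < N" using finite_nat_set_iff_bounded[of "rank ` \<Delta>"] assms by blast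
  then show thesis using that by blast
qed

text \<open>
  Choose a finite set on which a local function approximates \<open>L\<close>; spins of higher rank than those in the
  set do not affect that local function.
\<close>

lemma step_quasilocal:
  assumes \<epsilon>: "0 < \<epsilon>"
  shows "\<exists>M. \<forall>m\<ge>M. \<forall>\<omega>\<in>configs S. \<bar>step n (plus_from m \<omega>) - step n \<omega>\<bar> \<le> \<epsilon>"
proof -
  let ?x = "site_at n"
  have "0 < \<epsilon> / 2" using \<epsilon> by simp
  from eventually_happens'[OF finite_subsets_at_top_neq_bot
      eventually_conj[OF flip_close[OF site_at_in this] eventually_finite_supersets[OF finite.emptyI empty_subsetI]]]
  obtain \<Delta> where ev: "(\<forall>\<omega>\<in>configs S. \<bar>(ln (p \<Delta> \<omega>) - ln (p \<Delta> ((\<omega>)(?x := 1)))) - L ?x \<omega>\<bar> < \<epsilon> / 2) \<and>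
      finite \<Delta> \<and> {} \<subseteq> \<Delta> \<and> \<Delta> \<subseteq> S" ..
  obtain M where M: "\<And>x. x \<in> \<Delta> \<Longrightarrow> rank x < M" using finite_below_rank ev by blast
  have "\<bar>step n (plus_from m \<omega>) - step n \<omega>\<bar> \<le> \<epsilon>" if m: "M \<le> m" and \<omega>: "\<omega> \<in> configs S" for m \<omega>
  proof -
    let ?a = "plus_before n \<omega>" and ?b = "plus_before n (plus_from m \<omega>)"
    have ab: "?a \<in> configs S" "?b \<in> configs S"
      by (rule plus_in_configs(1)[OF \<omega>], rule plus_in_configs(1)[OF plus_in_configs(2)[OF \<omega>]])
    have agree: "?a i = ?b i" if "i \<in> \<Delta>" for i
      using M[OF that] m by (simp add: plus_before_def plus_from_def)
    have c: "cylinder S \<Delta> ?a = cylinder S \<Delta> ?b" "cylinder S \<Delta> (?a(?x := 1)) = cylinder S \<Delta> (?b(?x := 1))"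
      by (rule cylinder_cong; simp add: agree)+
    have "\<bar>(ln (p \<Delta> ?a) - ln (p \<Delta> (?a(?x := 1)))) - L ?x ?a\<bar> < \<epsilon> / 2"
      "\<bar>(ln (p \<Delta> ?b) - ln (p \<Delta> (?b(?x := 1)))) - L ?x ?b\<bar> < \<epsilon> / 2"
      using conjunct1[OF ev] ab by blast+
    then show ?thesis unfolding step_def c by linarith
  qed
  then show ?thesis by blast
qed

definition modulus :: "nat \<Rightarrow> nat \<Rightarrow> nat" where
  "modulus n j = (SOME M. \<forall>m\<ge>M. \<forall>\<omega>\<in>configs S. \<bar>step n (plus_from m \<omega>) - step n \<omega>\<bar> \<le> (1 / 2) ^ j)"

text \<open>
  Beyond this rank all spins together contribute at most \<open>(1 / 2) ^ j\<close> to the \<open>n\<close>-th step. The sum over all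
  earlier moduli makes the cutoffs strictly increasing in \<open>j\<close>, so that different indices give different
  blocks.
\<close>

definition cutoff :: "nat \<Rightarrow> nat \<Rightarrow> nat" where
  "cutoff n j = Suc (n + j) + (\<Sum>i\<le>j. modulus n i)"

lemma step_cutoff:
  assumes "\<omega> \<in> configs S" shows "\<bar>step n (plus_from (cutoff n j) \<omega>) - step n \<omega>\<bar> \<le> (1 / 2) ^ j"
proof -
  have "\<exists>M. \<forall>m\<ge>M. \<forall>\<omega>\<in>configs S. \<bar>step n (plus_from m \<omega>) - step n \<omega>\<bar> \<le> (1 / 2) ^ j"
    by (rule step_quasilocal) simp
  from someI_ex[OF this] have "\<forall>m\<ge>modulus n j. \<forall>\<omega>\<in>configs S. \<bar>step n (plus_from m \<omega>) - step n \<omega>\<bar> \<le> (1 / 2) ^ j"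
    unfolding modulus_def .
  moreover have "modulus n j \<le> cutoff n j"
    unfolding cutoff_def by (rule trans_le_add2, rule member_le_sum) auto
  ultimately show ?thesis using assms by blast
qed

lemma strict_mono_cutoff: "strict_mono (cutoff n)"
  by (rule strict_mono_Suc_iff[THEN iffD2]) (simp add: cutoff_def)

lemma less_cutoff: "n < cutoff n j"
  by (simp add: cutoff_def)

text \<open>
  The terms of the telescoping series of \<open>step n\<close> along the cutoffs, in which spins beyond the cutoff are replaced by plus.
\<close>

definition increment :: "nat \<Rightarrow> nat \<Rightarrow> ('a \<Rightarrow> real) \<Rightarrow> real" where
  "increment n j \<omega> = step n (plus_from (cutoff n j) \<omega>) -
     (if j = 0 then 0 else step n (plus_from (cutoff n (j - 1)) \<omega>))"

text \<open>
  The sites on which the increment depends. The first one has rank \<open>n\<close>, so a finite set of sites meets blocks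
  for finitely many \<open>n\<close> only. This is what makes the potential absolutely convergent.
\<close>

definition block :: "nat \<times> nat \<Rightarrow> 'a set" where
  "block = (\<lambda>(n, j). site_at ` {n..<cutoff n j})"

definition potential :: "'a set \<Rightarrow> ('a \<Rightarrow> real) \<Rightarrow> real" where
  "potential A \<omega> = (if A \<in> range block then - case_prod increment (inv block A) \<omega> else 0)"

lemma inj_block: "inj block"
proof (rule injI)
  fix a b assume eq: "block a = block b"
  obtain n j n' j' where ab: "a = (n, j)" "b = (n', j')" by (cases a, cases b)
  have "{n..<cutoff n j} = {n'..<cutoff n' j'}"
    using eq inj_image_eq_iff[OF inj_site_at] by (simp add: ab block_def)
  then have "n = n'" "cutoff n j = cutoff n' j'"
    using atLeastLessThan_inj[OF _ less_cutoff less_cutoff] by simp_all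
  then show "a = b" using strict_mono_eq[OF strict_mono_cutoff] by (simp add: ab)
qed

lemma potential_block: "potential (block (n, j)) \<omega> = - increment n j \<omega>"
  by (simp add: potential_def inv_f_f[OF inj_block])

lemma potential_outside: "A \<notin> range block \<Longrightarrow> potential A \<omega> = 0"
  by (simp add: potential_def)

lemma step_local:
  assumes \<omega>: "\<omega> \<in> configs S" "\<tau> \<in> configs S" and agree: "\<And>i. i \<in> block (n, j) \<Longrightarrow> \<omega> i = \<tau> i" and m: "m \<le> cutoff n j"
  shows "step n (plus_from m \<omega>) = step n (plus_from m \<tau>)"
proof -
  have "plus_before n (plus_from m \<omega>) i = plus_before n (plus_from m \<tau>) i" for i
  proof (cases "i \<in> S \<and> n \<le> rank i \<and> rank i < m")
    case True
    then have "i \<in> block (n, j)" using site_at_rank[of i] m by (force simp: block_def image_iff)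
    then show ?thesis using agree by (simp add: plus_before_def plus_from_def)
  next
    case False
    then show ?thesis using \<omega> by (auto simp: plus_before_def plus_from_def PiE_iff extensional_def)
  qed
  then show ?thesis unfolding step_def by presburger
qed

lemma increment_local:
  assumes "\<omega> \<in> configs S" "\<tau> \<in> configs S" "\<And>i. i \<in> block (n, j) \<Longrightarrow> \<omega> i = \<tau> i"
  shows "increment n j \<omega> = increment n j \<tau>"
proof -
  have le: "cutoff n (j - 1) \<le> cutoff n j" by (rule strict_mono_leD[OF strict_mono_cutoff]) simp
  have "step n (plus_from (cutoff n (j - 1)) \<omega>) = step n (plus_from (cutoff n (j - 1)) \<tau>)"
    by (rule step_local[OF assms le])
  moreover have "step n (plus_from (cutoff n j) \<omega>) = step n (plus_from (cutoff n j) \<tau>)"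
    by (rule step_local[OF assms order_refl])
  ultimately show ?thesis by (simp only: increment_def)
qed

lemma is_potential: "is_potential S potential"
  unfolding is_potential_def
proof (intro conjI ballI allI impI)
  fix \<sigma> :: "'a \<Rightarrow> real"
  have "block (n, j) \<noteq> {}" for n j using less_cutoff[of n j] by (auto simp: block_def)
  then have "{} \<notin> range block" by (metis (no_types, lifting) imageE prod.collapse)
  then show "potential {} \<sigma> = 0" by (rule potential_outside)
next
  fix A and \<sigma> \<tau> :: "'a \<Rightarrow> real"
  assume *: "\<sigma> \<in> configs S" "\<tau> \<in> configs S" "\<forall>i\<in>A. \<sigma> i = \<tau> i"
  show "potential A \<sigma> = potential A \<tau>"
  proof (cases "A \<in> range block")
    case True
    then obtain n j where A: "A = block (n, j)" by auto
    then show ?thesis using increment_local[of \<sigma> \<tau> n j] * by (simp add: potential_block)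
  qed (simp add: potential_outside)
qed

lemma increment_bound:
  assumes \<omega>: "\<omega> \<in> configs S" shows "\<bar>increment n (Suc j) \<omega>\<bar> \<le> 2 * (1 / 2) ^ j"
proof -
  have "increment n (Suc j) \<omega> =
      step n (plus_from (cutoff n (Suc j)) \<omega>) - step n (plus_from (cutoff n j) \<omega>)"
    by (simp add: increment_def)
  then have "\<bar>increment n (Suc j) \<omega>\<bar> \<le> (1 / 2) ^ Suc j + (1 / 2) ^ j"
    using step_cutoff[OF \<omega>, of n "Suc j"] step_cutoff[OF \<omega>, of n j] by linarith
  also have "\<dots> \<le> 2 * (1 / 2) ^ j" by simp
  finally show ?thesis .
qed

lemma summable_halves: "summable (\<lambda>j. 2 * (1 / 2 :: real) ^ j)"
  by (intro summable_mult summable_geometric) simp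

lemma step_has_sum:
  assumes \<omega>: "\<omega> \<in> configs S"
  shows "((\<lambda>A. potential A \<omega>) has_sum - step n \<omega>) (range (\<lambda>j. block (n, j)))"
proof -
  have "summable (\<lambda>j. norm (increment n (Suc j) \<omega>))"
    by (rule summable_comparison_test'[OF summable_halves, of 0]) (use increment_bound[OF \<omega>] in auto)
  then have sm: "summable (\<lambda>j. norm (increment n j \<omega>))" by (rule summable_Suc_iff[THEN iffD1])
  have part: "(\<Sum>j<Suc J. increment n j \<omega>) = step n (plus_from (cutoff n J) \<omega>)" for J
    by (induction J) (auto simp: increment_def)
  have "(\<lambda>J. step n (plus_from (cutoff n J) \<omega>)) \<longlonglongrightarrow> step n \<omega>"
  proof (rule LIM_zero_cancel, rule Lim_null_comparison)
    show "\<forall>\<^sub>F J in sequentially. norm (step n (plus_from (cutoff n J) \<omega>) - step n \<omega>) \<le> (1 / 2) ^ J"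
      using step_cutoff[OF \<omega>] by simp
  qed (simp add: LIMSEQ_realpow_zero)
  then have "(\<lambda>j. increment n j \<omega>) sums step n \<omega>"
    unfolding sums_def part[symmetric] by (rule LIMSEQ_imp_Suc)
  from norm_summable_imp_has_sum[OF sm this] have "((\<lambda>j. - increment n j \<omega>) has_sum - step n \<omega>) UNIV"
    by (simp add: has_sum_uminus)
  moreover have "inj (\<lambda>j. block (n, j))" using inj_block by (auto simp: inj_def)
  ultimately show ?thesis by (simp add: has_sum_reindex o_def potential_block)
qed

lemma sup_summable_on_range: "(\<lambda>A. SUP \<omega>\<in>configs S. \<bar>potential A \<omega>\<bar>) summable_on range (\<lambda>j. block (n, j))"
proof -
  have bound: "norm (SUP \<omega>\<in>configs S. \<bar>increment n (Suc j) \<omega>\<bar>) \<le> 2 * (1 / 2) ^ j" for j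
  proof -
    have "(SUP \<omega>\<in>configs S. \<bar>increment n (Suc j) \<omega>\<bar>) \<le> 2 * (1 / 2) ^ j"
      by (rule cSUP_least[OF configs_not_empty increment_bound])
    moreover have "0 \<le> (SUP \<omega>\<in>configs S. \<bar>increment n (Suc j) \<omega>\<bar>)"
    proof -
      have "bdd_above ((\<lambda>\<omega>. \<bar>increment n (Suc j) \<omega>\<bar>) ` configs S)"
        by (rule bdd_aboveI2[OF increment_bound])
      from cSUP_upper[OF configs_nonempty this] show ?thesis by (rule order_trans[rotated]) simp
    qed
    ultimately show ?thesis by simp
  qed
  have "summable (\<lambda>j. norm (SUP \<omega>\<in>configs S. \<bar>increment n (Suc j) \<omega>\<bar>))"
    by (rule summable_comparison_test'[OF summable_halves, of 0]) (use bound in auto)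
  then have "summable (\<lambda>j. norm (SUP \<omega>\<in>configs S. \<bar>increment n j \<omega>\<bar>))" by (rule summable_Suc_iff[THEN iffD1])
  from norm_summable_imp_summable_on[OF this]
  have "(\<lambda>j. SUP \<omega>\<in>configs S. \<bar>increment n j \<omega>\<bar>) summable_on UNIV" .
  moreover have "inj (\<lambda>j. block (n, j))" using inj_block by (auto simp: inj_def)
  ultimately show ?thesis by (simp add: summable_on_reindex o_def potential_block)
qed

definition first_sites :: "nat \<Rightarrow> 'a set" where "first_sites N = site_at ` {..<N}"

lemma blocks_meeting_first_sites:
  "(\<Union>n<N. range (\<lambda>j. block (n, j))) = finite_sets_meeting S (first_sites N) \<inter> range block"
proof (intro set_eqI iffI)
  fix A assume "A \<in> (\<Union>n<N. range (\<lambda>j. block (n, j)))"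
  then obtain n j where nj: "n < N" "A = block (n, j)" by auto
  then have "site_at n \<in> A \<inter> first_sites N" using less_cutoff[of n j] by (auto simp: block_def first_sites_def)
  moreover have "finite A" "A \<subseteq> S" using nj by (auto simp: block_def)
  ultimately show "A \<in> finite_sets_meeting S (first_sites N) \<inter> range block"
    using nj by (auto simp: finite_sets_meeting_def)
next
  fix A assume A: "A \<in> finite_sets_meeting S (first_sites N) \<inter> range block"
  then obtain n j where nj: "A = block (n, j)" by auto
  obtain k where k: "k < N" "site_at k \<in> block (n, j)"
    using A nj by (auto simp: finite_sets_meeting_def first_sites_def)
  then have "k \<in> {n..<cutoff n j}" using inj_image_mem_iff[OF inj_site_at] by (simp add: block_def)
  then have "n < N" using k(1) by simp
  then show "A \<in> (\<Union>n<N. range (\<lambda>j. block (n, j)))" using nj by blast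
qed

lemma blocks_disjoint: "(\<Union>n<N. range (\<lambda>j. block (n, j))) \<inter> range (\<lambda>j. block (N, j)) = {}"
  using inj_block by (auto simp: inj_def)

lemma energy_first_sites:
  assumes \<omega>: "\<omega> \<in> configs S"
  shows "((\<lambda>A. potential A \<omega>) has_sum - (\<Sum>n<N. step n \<omega>)) (finite_sets_meeting S (first_sites N))"
proof -
  have "((\<lambda>A. potential A \<omega>) has_sum - (\<Sum>n<N. step n \<omega>)) (\<Union>n<N. range (\<lambda>j. block (n, j)))"
  proof (induction N)
    case (Suc N)
    from has_sum_Un_disjoint[OF Suc step_has_sum[OF \<omega>, of N] blocks_disjoint]
    show ?case by (simp add: lessThan_Suc Un_commute algebra_simps)
  qed simp
  then show ?thesis unfolding blocks_meeting_first_sites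
    by (rule has_sum_cong_neutral[THEN iffD1, rotated -1]) (auto intro: potential_outside)
qed

lemma potential_converges: "uniformly_absolutely_convergent S potential"
  unfolding uniformly_absolutely_convergent_def
proof (intro allI impI)
  fix V assume V: "finite V \<and> V \<subseteq> S"
  obtain N where N: "\<And>x. x \<in> V \<Longrightarrow> rank x < N" using finite_below_rank V by blast
  let ?h = "\<lambda>A. SUP \<omega>\<in>configs S. \<bar>potential A \<omega>\<bar>"
  have sm: "?h summable_on (\<Union>n<N. range (\<lambda>j. block (n, j)))" for N
  proof (induction N)
    case (Suc N)
    from summable_on_Un_disjoint[OF Suc sup_summable_on_range[of N] blocks_disjoint]
    show ?case by (simp add: lessThan_Suc Un_commute)
  qed simp
  have zero: "?h A = 0" if "A \<notin> range block" for A
    by (simp add: potential_outside[OF that] cSUP_const[OF configs_not_empty])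
  have "?h summable_on finite_sets_meeting S (first_sites N)"
    by (rule summable_on_cong_neutral[THEN iffD1, OF _ _ _ sm[of N, unfolded blocks_meeting_first_sites]])
       (use zero in blast)+
  moreover have "V \<subseteq> first_sites N"
  proof
    fix x assume "x \<in> V"
    then show "x \<in> first_sites N" using N[of x] site_at_rank[of x] V by (force simp: first_sites_def image_iff)
  qed
  then have "finite_sets_meeting S V \<subseteq> finite_sets_meeting S (first_sites N)"
    by (auto simp: finite_sets_meeting_def)
  ultimately show "?h summable_on finite_sets_meeting S V" by (rule summable_on_subset_banach)
qed

text \<open>
  The energies in \<open>V\<close> and in the first \<open>N\<close> sites differ by the terms that do not meet \<open>V\<close>, and these do not notice a change of
  the configuration in \<open>V\<close>.
\<close>

lemma energy_difference:
  assumes V: "V \<subseteq> first_sites N" and \<omega>: "\<omega> \<in> configs S" "\<tau> \<in> configs S" and agree: "\<And>i. i \<notin> V \<Longrightarrow> \<omega> i = \<tau> i"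
  shows "energy S potential V \<omega> - energy S potential V \<tau> = (\<Sum>n<N. step n \<tau>) - (\<Sum>n<N. step n \<omega>)"
proof -
  let ?W = "finite_sets_meeting S (first_sites N)" and ?V = "finite_sets_meeting S V"
  have VW: "?V \<subseteq> ?W" using V by (auto simp: finite_sets_meeting_def)
  have diff: "infsum (\<lambda>A. potential A \<eta>) (?W - ?V) = - (\<Sum>n<N. step n \<eta>) - energy S potential V \<eta>"
    if \<eta>: "\<eta> \<in> configs S" for \<eta>
  proof -
    note hs = energy_first_sites[OF \<eta>, of N]
    have sW: "(\<lambda>A. potential A \<eta>) summable_on ?W" using hs by (rule has_sum_imp_summable)
    from infsum_Diff[OF sW summable_on_subset_banach[OF sW VW] VW] infsumI[OF hs]
    show ?thesis by (simp add: energy_def)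
  qed
  have "infsum (\<lambda>A. potential A \<omega>) (?W - ?V) = infsum (\<lambda>A. potential A \<tau>) (?W - ?V)"
  proof (rule infsum_cong)
    fix A assume A: "A \<in> ?W - ?V"
    then have "finite A" "A \<subseteq> S" "\<forall>i\<in>A. \<omega> i = \<tau> i" using agree by (auto simp: finite_sets_meeting_def)
    then show "potential A \<omega> = potential A \<tau>" using is_potential \<omega> unfolding is_potential_def by blast
  qed
  then show ?thesis unfolding diff[OF \<omega>(1)] diff[OF \<omega>(2)] by linarith
qed

lemma gibbs: "is_gibbs_measure S \<nu>"
proof (rule gibbs_from_log_ratios[OF countable prob sets pos is_potential potential_converges])
  fix V :: "'a set" and \<epsilon> :: real assume V: "finite V" "V \<subseteq> S" and \<epsilon>: "0 < \<epsilon>"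
  obtain N where N: "\<And>x. x \<in> V \<Longrightarrow> rank x < N" using finite_below_rank[OF V(1)] by blast
  have VN: "V \<subseteq> first_sites N"
  proof
    fix x assume "x \<in> V"
    then show "x \<in> first_sites N" using N[of x] site_at_rank[of x] V by (force simp: first_sites_def image_iff)
  qed
  define \<delta> where "\<delta> = \<epsilon> / (2 * (real N + 1))"
  have \<delta>: "0 < \<delta>" "real N * \<delta> \<le> \<epsilon> / 2" using \<epsilon> by (auto simp: \<delta>_def field_simps)
  have "\<forall>\<^sub>F \<Delta> in finite_subsets_at_top S. \<forall>n\<in>{..<N}.
      \<forall>\<omega>\<in>configs S. \<bar>(ln (p \<Delta> \<omega>) - ln (p \<Delta> ((\<omega>)(site_at n := 1)))) - L (site_at n) \<omega>\<bar> < \<delta>"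
    by (rule eventually_ball_finite[OF finite_lessThan]) (intro ballI flip_close[OF site_at_in \<delta>(1)])
  then show "\<forall>\<^sub>F \<Delta> in finite_subsets_at_top S. \<forall>\<omega>\<in>configs S. \<forall>\<sigma>\<in>configs V. \<forall>\<tau>\<in>configs V.
         \<bar>(ln (p \<Delta> (glue V \<tau> \<omega>)) - ln (p \<Delta> (glue V \<sigma> \<omega>)))
          - (energy S potential V (glue V \<sigma> \<omega>) - energy S potential V (glue V \<tau> \<omega>))\<bar> \<le> \<epsilon>"
  proof (rule eventually_mono, intro ballI)
    fix \<Delta> \<omega> \<sigma> \<tau>
    assume close: "\<forall>n\<in>{..<N}. \<forall>\<omega>\<in>configs S. \<bar>(ln (p \<Delta> \<omega>) - ln (p \<Delta> ((\<omega>)(site_at n := 1)))) - L (site_at n) \<omega>\<bar> < \<delta>"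
      and \<omega>: "\<omega> \<in> configs S" and \<sigma>: "\<sigma> \<in> configs V" and \<tau>: "\<tau> \<in> configs V"
    have tele: "\<bar>(ln (p \<Delta> \<eta>) - ln (p \<Delta> (plus_before N \<eta>))) - (\<Sum>n<N. step n \<eta>)\<bar> \<le> \<epsilon> / 2" if \<eta>: "\<eta> \<in> configs S" for \<eta>
    proof -
      let ?d = "\<lambda>n. ln (p \<Delta> (plus_before n \<eta>)) - ln (p \<Delta> (plus_before (Suc n) \<eta>))"
      have "ln (p \<Delta> \<eta>) - ln (p \<Delta> (plus_before N \<eta>)) = (\<Sum>n<N. ?d n)"
        by (subst sum_lessThan_telescope') (simp add: plus_before_0)
      then have "\<bar>(ln (p \<Delta> \<eta>) - ln (p \<Delta> (plus_before N \<eta>))) - (\<Sum>n<N. step n \<eta>)\<bar> = \<bar>\<Sum>n<N. ?d n - step n \<eta>\<bar>"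
        by (simp add: sum_subtractf)
      also have "\<dots> \<le> (\<Sum>n<N. \<bar>?d n - step n \<eta>\<bar>)" by (rule sum_abs)
      also have "\<dots> \<le> (\<Sum>n<N. \<delta>)"
      proof (rule sum_mono)
        fix n assume "n \<in> {..<N}"
        from bspec[OF bspec[OF close this] plus_in_configs(1)[OF \<eta>, of n]]
        show "\<bar>?d n - step n \<eta>\<bar> \<le> \<delta>" unfolding plus_before_Suc step_def by linarith
      qed
      also have "\<dots> \<le> \<epsilon> / 2" using \<delta>(2) by simp
      finally show ?thesis .
    qed
    have c: "glue V \<sigma> \<omega> \<in> configs S" "glue V \<tau> \<omega> \<in> configs S"
      using glue_in_configs[OF _ \<omega> V(2)] \<sigma> \<tau> by blast+
    \<comment> \<open>Once the first spins are plus, the spins in \<open>V\<close> are forgotten.\<close>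
    have low: "plus_before N (glue V \<sigma> \<omega>) = plus_before N (glue V \<tau> \<omega>)"
      using N V(2) by (auto simp: plus_before_def glue_def fun_eq_iff)
    have "energy S potential V (glue V \<sigma> \<omega>) - energy S potential V (glue V \<tau> \<omega>)
        = (\<Sum>n<N. step n (glue V \<tau> \<omega>)) - (\<Sum>n<N. step n (glue V \<sigma> \<omega>))"
      by (rule energy_difference[OF VN c]) (simp add: glue_def)
    then show "\<bar>(ln (p \<Delta> (glue V \<tau> \<omega>)) - ln (p \<Delta> (glue V \<sigma> \<omega>)))
          - (energy S potential V (glue V \<sigma> \<omega>) - energy S potential V (glue V \<tau> \<omega>))\<bar> \<le> \<epsilon>"
      using tele[OF c(1)] tele[OF c(2)] unfolding low by linarith
  qed
qed

end

text \<open>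
  Kozlov's theorem, for an arbitrary countable set of sites.
\<close>

theorem quasilocal_implies_gibbs:
  fixes \<nu> :: "('a \<Rightarrow> real) measure"
  assumes S: "countable S" and \<nu>: "prob_space \<nu>" "sets \<nu> = sets (config_space S)"
    and pos: "\<And>\<Delta> \<omega>. finite \<Delta> \<Longrightarrow> \<Delta> \<subseteq> S \<Longrightarrow> \<omega> \<in> configs S \<Longrightarrow> 0 < measure \<nu> (cylinder S \<Delta> \<omega>)"
    and flip: "\<And>x. x \<in> S \<Longrightarrow> \<exists>L. uniform_limit (configs S)
      (\<lambda>\<Delta> \<omega>. ln (measure \<nu> (cylinder S \<Delta> \<omega>)) - ln (measure \<nu> (cylinder S \<Delta> ((\<omega>)(x := 1))))) L (finite_subsets_at_top S)"
  shows "is_gibbs_measure S \<nu>"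
proof (cases "finite S")
  case True
  then show ?thesis by (rule gibbs_if_finite[OF _ \<nu> pos])
next
  case False
  have "\<forall>x\<in>S. \<exists>L. uniform_limit (configs S)
      (\<lambda>\<Delta> \<omega>. ln (measure \<nu> (cylinder S \<Delta> \<omega>)) - ln (measure \<nu> (cylinder S \<Delta> ((\<omega>)(x := 1))))) L (finite_subsets_at_top S)"
    using flip by (rule ballI)
  from bchoice[OF this] obtain L where L: "\<forall>x\<in>S. uniform_limit (configs S)
      (\<lambda>\<Delta> \<omega>. ln (measure \<nu> (cylinder S \<Delta> \<omega>)) - ln (measure \<nu> (cylinder S \<Delta> ((\<omega>)(x := 1))))) (L x) (finite_subsets_at_top S)" ..
  interpret flip_ratios S \<nu> L
    by (rule flip_ratios.intro[OF S False \<nu> pos bspec[OF L]])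
  show ?thesis by (rule gibbs)
qed


section \<open>The plus phase\<close>

lemma topspace_config_topology: "topspace (config_topology S) = configs S"
  by (simp add: config_topology_def)

text \<open>
  Finitely many coordinates are restricted, so this is a basic open set of the product topology.
\<close>

lemma openin_cylinder:
  assumes "finite \<Delta>" "\<Delta> \<subseteq> S" "\<omega> \<in> configs S"
  shows "openin (config_topology S) (cylinder S \<Delta> \<omega>)"
proof -
  let ?X = "\<lambda>i. if i \<in> \<Delta> then {\<omega> i} else spins"
  have \<omega>: "\<omega> i \<in> spins" if "i \<in> S" for i using assms(3) that by (rule PiE_mem)
  have "cylinder S \<Delta> \<omega> = PiE S ?X"
  proof (intro set_eqI iffI)
    fix \<eta> assume "\<eta> \<in> cylinder S \<Delta> \<omega>"
    then show "\<eta> \<in> PiE S ?X" by (auto simp: cylinder_def PiE_iff)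
  next
    fix \<eta> assume \<eta>: "\<eta> \<in> PiE S ?X"
    have "\<eta> i \<in> spins" if "i \<in> S" for i using PiE_mem[OF \<eta> that] \<omega>[OF that] by (cases "i \<in> \<Delta>") auto
    moreover have "\<eta> i = \<omega> i" if "i \<in> \<Delta>" for i using PiE_mem[OF \<eta>, of i] assms(2) that by auto
    ultimately show "\<eta> \<in> cylinder S \<Delta> \<omega>" using \<eta> by (auto simp: cylinder_def PiE_iff)
  qed
  moreover have "openin (product_topology (\<lambda>_. discrete_topology spins) S) (PiE S ?X)"
    unfolding openin_PiE_gen
  proof (intro disjI2 conjI ballI)
    show "finite {i \<in> S. ?X i \<noteq> topspace (discrete_topology spins)}"
      by (rule finite_subset[OF _ assms(1)]) auto
    fix i assume "i \<in> S"
    then show "openin (discrete_topology spins) (?X i)" using \<omega>[of i] by simp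
  qed
  ultimately show ?thesis by (simp add: config_topology_def)
qed

lemma continuous_local_function:
  assumes \<Delta>: "finite \<Delta>" "\<Delta> \<subseteq> S"
    and loc: "\<And>\<sigma> \<tau>. \<sigma> \<in> configs S \<Longrightarrow> \<tau> \<in> configs S \<Longrightarrow> (\<And>i. i \<in> \<Delta> \<Longrightarrow> \<sigma> i = \<tau> i) \<Longrightarrow> f \<sigma> = f \<tau>"
  shows "continuous_map (config_topology S) euclideanreal f"
  unfolding continuous_map topspace_config_topology
proof (intro conjI allI impI)
  fix W :: "real set" assume "openin euclideanreal W"
  show "openin (config_topology S) {\<sigma> \<in> configs S. f \<sigma> \<in> W}"
  proof (subst openin_subopen, intro ballI)
    fix \<sigma> assume \<sigma>: "\<sigma> \<in> {\<sigma> \<in> configs S. f \<sigma> \<in> W}"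
    have "cylinder S \<Delta> \<sigma> \<subseteq> {\<sigma> \<in> configs S. f \<sigma> \<in> W}"
    proof
      fix \<tau> assume "\<tau> \<in> cylinder S \<Delta> \<sigma>"
      then have "\<tau> \<in> configs S" "f \<tau> = f \<sigma>" using loc[of \<tau> \<sigma>] \<sigma> by (auto simp: cylinder_def)
      then show "\<tau> \<in> {\<sigma> \<in> configs S. f \<sigma> \<in> W}" using \<sigma> by simp
    qed
    moreover have "\<sigma> \<in> cylinder S \<Delta> \<sigma>" using \<sigma> by (simp add: cylinder_def)
    moreover have "openin (config_topology S) (cylinder S \<Delta> \<sigma>)" using openin_cylinder[OF \<Delta>] \<sigma> by simp
    ultimately show "\<exists>T. openin (config_topology S) T \<and> \<sigma> \<in> T \<and> T \<subseteq> {\<sigma> \<in> configs S. f \<sigma> \<in> W}" by blast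
  qed
qed auto

text \<open>
  Compactness: finitely many cylinders on which the function varies little cover the space, and it suffices to take all sites on which these depend.
\<close>

lemma continuous_is_quasilocal:
  assumes f: "continuous_map (config_topology S) euclideanreal f" and \<epsilon>: "0 < \<epsilon>"
  obtains \<Delta> where "finite \<Delta>" "\<Delta> \<subseteq> S"
    "\<And>\<sigma> \<tau>. \<sigma> \<in> configs S \<Longrightarrow> \<tau> \<in> configs S \<Longrightarrow> (\<And>i. i \<in> \<Delta> \<Longrightarrow> \<sigma> i = \<tau> i) \<Longrightarrow> \<bar>f \<sigma> - f \<tau>\<bar> < \<epsilon>"
proof -
  let ?X = "config_topology S"
  have "\<exists>\<Delta>. finite \<Delta> \<and> \<Delta> \<subseteq> S \<and> (\<forall>\<tau>\<in>cylinder S \<Delta> \<sigma>. \<bar>f \<tau> - f \<sigma>\<bar> < \<epsilon> / 2)" if \<sigma>: "\<sigma> \<in> configs S" for \<sigma>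
  proof -
    have "openin ?X {\<tau> \<in> topspace ?X. f \<tau> \<in> ball (f \<sigma>) (\<epsilon> / 2)}"
      by (rule openin_continuous_map_preimage[OF f]) simp
    moreover have "\<sigma> \<in> {\<tau> \<in> topspace ?X. f \<tau> \<in> ball (f \<sigma>) (\<epsilon> / 2)}"
      using \<sigma> \<epsilon> by (simp add: topspace_config_topology)
    ultimately obtain V where V: "finite {i \<in> S. V i \<noteq> spins}" "\<sigma> \<in> PiE S V"
      "PiE S V \<subseteq> {\<tau> \<in> topspace ?X. f \<tau> \<in> ball (f \<sigma>) (\<epsilon> / 2)}"
      unfolding config_topology_def openin_product_topology_alt topspace_discrete_topology by meson
    have "cylinder S {i \<in> S. V i \<noteq> spins} \<sigma> \<subseteq> PiE S V"
    proof
      fix \<tau> assume \<tau>: "\<tau> \<in> cylinder S {i \<in> S. V i \<noteq> spins} \<sigma>"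
      then have \<tau>c: "\<tau> \<in> configs S" by (simp add: cylinder_def)
      show "\<tau> \<in> PiE S V"
      proof (rule PiE_I)
        fix i assume i: "i \<in> S"
        show "\<tau> i \<in> V i"
        proof (cases "V i = spins")
          case True
          then show ?thesis using PiE_mem[OF \<tau>c i] by simp
        next
          case False
          then have "\<tau> i = \<sigma> i" using \<tau> i by (simp add: cylinder_def)
          then show ?thesis using PiE_mem[OF V(2) i] by simp
        qed
      next
        fix i assume "i \<notin> S"
        then show "\<tau> i = undefined" by (rule PiE_arb[OF \<tau>c])
      qed
    qed
    then have "\<forall>\<tau>\<in>cylinder S {i \<in> S. V i \<noteq> spins} \<sigma>. \<bar>f \<tau> - f \<sigma>\<bar> < \<epsilon> / 2"
      using V(3) by (force simp: dist_real_def abs_minus_commute)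
    then show ?thesis using V(1) by (intro exI[of _ "{i \<in> S. V i \<noteq> spins}"]) simp
  qed
  then have "\<forall>\<sigma>\<in>configs S. \<exists>\<Delta>. finite \<Delta> \<and> \<Delta> \<subseteq> S \<and> (\<forall>\<tau>\<in>cylinder S \<Delta> \<sigma>. \<bar>f \<tau> - f \<sigma>\<bar> < \<epsilon> / 2)" by (rule ballI)
  from bchoice[OF this] obtain D
    where D: "\<forall>\<sigma>\<in>configs S. finite (D \<sigma>) \<and> D \<sigma> \<subseteq> S \<and> (\<forall>\<tau>\<in>cylinder S (D \<sigma>) \<sigma>. \<bar>f \<tau> - f \<sigma>\<bar> < \<epsilon> / 2)" ..
  have "compact_space ?X"
    unfolding config_topology_def compact_space_product_topology by (simp add: compact_space_discrete_topology)
  moreover have "\<forall>W\<in>(\<lambda>\<sigma>. cylinder S (D \<sigma>) \<sigma>) ` configs S. openin ?X W" using D openin_cylinder by blast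
  moreover have "topspace ?X \<subseteq> \<Union>((\<lambda>\<sigma>. cylinder S (D \<sigma>) \<sigma>) ` configs S)"
    unfolding topspace_config_topology
  proof
    fix \<sigma> assume \<sigma>: "\<sigma> \<in> configs S"
    then have "\<sigma> \<in> cylinder S (D \<sigma>) \<sigma>" by (simp add: cylinder_def)
    then show "\<sigma> \<in> \<Union>((\<lambda>\<sigma>. cylinder S (D \<sigma>) \<sigma>) ` configs S)" using \<sigma> by blast
  qed
  ultimately obtain \<F> where \<F>: "finite \<F>" "\<F> \<subseteq> (\<lambda>\<sigma>. cylinder S (D \<sigma>) \<sigma>) ` configs S" "configs S \<subseteq> \<Union>\<F>"
    unfolding compact_space_alt topspace_config_topology by meson
  obtain C where C: "C \<subseteq> configs S" "finite C" "\<F> = (\<lambda>\<sigma>. cylinder S (D \<sigma>) \<sigma>) ` C"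
    using finite_subset_image[OF \<F>(1,2)] by blast
  show thesis
  proof (rule that[of "\<Union>(D ` C)"])
    show "finite (\<Union>(D ` C))" "\<Union>(D ` C) \<subseteq> S" using C(1,2) D by blast+
    fix \<sigma> \<tau> assume \<sigma>: "\<sigma> \<in> configs S" and \<tau>: "\<tau> \<in> configs S" and agree: "\<And>i. i \<in> \<Union>(D ` C) \<Longrightarrow> \<sigma> i = \<tau> i"
    obtain \<rho> where \<rho>: "\<rho> \<in> C" "\<sigma> \<in> cylinder S (D \<rho>) \<rho>" using \<F>(3) \<sigma> C(3) by blast
    have "\<tau> i = \<rho> i" if "i \<in> D \<rho>" for i
    proof -
      have "\<sigma> i = \<tau> i" by (rule agree) (use that \<rho>(1) in blast)
      then show ?thesis using that \<rho>(2) by (auto simp: cylinder_def)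
    qed
    then have "\<tau> \<in> cylinder S (D \<rho>) \<rho>" using \<tau> by (simp add: cylinder_def)
    moreover have "\<forall>\<tau>\<in>cylinder S (D \<rho>) \<rho>. \<bar>f \<tau> - f \<rho>\<bar> < \<epsilon> / 2" using D \<rho>(1) C(1) by blast
    ultimately have "\<bar>f \<tau> - f \<rho>\<bar> < \<epsilon> / 2" "\<bar>f \<sigma> - f \<rho>\<bar> < \<epsilon> / 2" using \<rho>(2) by blast+
    then show "\<bar>f \<sigma> - f \<tau>\<bar> < \<epsilon>" by linarith
  qed
qed

lemma plus_weight_eq_weight:
  assumes fin: "finite \<Lambda>" and M: "M \<subseteq> \<Lambda>"
  shows "plus_weight \<beta> \<Lambda> (restrict (spin M) \<Lambda>) = weight \<beta> \<Lambda> M"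
proof -
  have ext: "plus_extension \<Lambda> (restrict (spin M) \<Lambda>) = spin M"
    using M by (auto simp: plus_extension_def spin_def fun_eq_iff)
  have "(\<Prod>x\<in>b. spin M x) - 1 = - 2 * of_bool (b \<inter> M \<noteq> {} \<and> \<not> b \<subseteq> M)" if bt: "b \<in> bonds_touching \<Lambda>" for b
  proof -
    obtain y z where b: "b = {y, z}" "nearest_neighbours y z" using bt unfolding bonds_touching_def by blast
    have "y \<noteq> z" using b(2) by (auto simp: nearest_neighbours_def)
    then show ?thesis unfolding b(1) by (simp add: spin_def)
  qed
  then have "(\<Sum>b\<in>bonds_touching \<Lambda>. (\<Prod>x\<in>b. spin M x) - 1)
      = (\<Sum>b\<in>bonds_touching \<Lambda>. - 2 * of_bool (b \<inter> M \<noteq> {} \<and> \<not> b \<subseteq> M))" by (rule sum.cong[OF refl])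
  also have "\<dots> = - 2 * (\<Sum>b\<in>bonds_touching \<Lambda>. of_bool (b \<inter> M \<noteq> {} \<and> \<not> b \<subseteq> M))"
    by (rule sum_distrib_left[symmetric])
  also have "(\<Sum>b\<in>bonds_touching \<Lambda>. of_bool (b \<inter> M \<noteq> {} \<and> \<not> b \<subseteq> M) :: real)
      = real (card (bonds_touching \<Lambda> \<inter> {b. b \<inter> M \<noteq> {} \<and> \<not> b \<subseteq> M}))"
    by (simp only: sum_of_bool_eq finite_bonds_touching(1)[OF fin])
  also have "bonds_touching \<Lambda> \<inter> {b. b \<inter> M \<noteq> {} \<and> \<not> b \<subseteq> M} = cut_bonds \<Lambda> M" unfolding cut_bonds_def by blast
  finally show ?thesis unfolding plus_weight_def weight_def ext by (simp only: mult.assoc mult.left_commute)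
qed

text \<open>
  A product of two spins minus one is -2 for an unsatisfied bond and 0 otherwise, so that the two descriptions of the finite-volume
  measure have the same weights.
\<close>

lemma ising_plus_integral:
  assumes fin: "finite \<Lambda>" and f: "f \<in> borel_measurable (config_space UNIV)"
  shows "(\<integral>\<sigma>. f \<sigma> \<partial>distr (ising_plus \<beta> \<Lambda>) (config_space UNIV) (plus_extension \<Lambda>))
       = gibbs_mean \<beta> \<Lambda> {} (\<lambda>M. f (spin M))"
proof -
  have m: "plus_extension \<Lambda> \<in> measurable (ising_plus \<beta> \<Lambda>) (config_space UNIV)"
    unfolding ising_plus_def measurable_point_measure_eq1
    by (auto simp: plus_extension_def space_config_space PiE_iff)
  have ext: "plus_extension \<Lambda> (restrict (spin M) \<Lambda>) = spin M" if "M \<in> Pow \<Lambda>" for M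
    using that by (auto simp: plus_extension_def spin_def fun_eq_iff)
  have bij: "bij_betw (\<lambda>M. restrict (spin M) \<Lambda>) (Pow \<Lambda>) (configs \<Lambda>)"
  proof (rule bij_betwI[where g = "\<lambda>\<sigma>. {x \<in> \<Lambda>. \<sigma> x = - 1}"])
    show "restrict (spin {x \<in> \<Lambda>. \<sigma> x = - 1}) \<Lambda> = \<sigma>" if "\<sigma> \<in> configs \<Lambda>" for \<sigma>
    proof
      fix x
      show "restrict (spin {x \<in> \<Lambda>. \<sigma> x = - 1}) \<Lambda> x = \<sigma> x"
        using PiE_mem[OF that, of x] PiE_arb[OF that, of x] by (cases "x \<in> \<Lambda>") (auto simp: spin_def)
    qed
  qed (auto simp: spin_def split: if_splits)
  let ?Z = "\<Sum>\<tau>\<in>configs \<Lambda>. plus_weight \<beta> \<Lambda> \<tau>"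
  have Z: "?Z = partition_sum \<beta> \<Lambda> {}"
    unfolding partition_sum_def sum.reindex_bij_betw[OF bij, symmetric] confs_eq_image
    using plus_weight_eq_weight[OF fin] by simp
  have Zpos: "0 < ?Z" unfolding Z by (rule partition_sum_pos[OF fin])
  have "(\<integral>\<sigma>. f \<sigma> \<partial>distr (ising_plus \<beta> \<Lambda>) (config_space UNIV) (plus_extension \<Lambda>))
      = (\<integral>\<sigma>. f (plus_extension \<Lambda> \<sigma>) \<partial>ising_plus \<beta> \<Lambda>)" by (rule integral_distr[OF m f])
  also have "\<dots> = (\<Sum>\<sigma>\<in>configs \<Lambda>. (plus_weight \<beta> \<Lambda> \<sigma> / ?Z) *\<^sub>R f (plus_extension \<Lambda> \<sigma>))"
    unfolding ising_plus_def
    by (rule lebesgue_integral_point_measure_finite[OF finite_configs[OF fin]])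
       (use Zpos in \<open>auto simp: plus_weight_def intro!: divide_nonneg_nonneg\<close>)
  also have "\<dots> = (\<Sum>M\<in>Pow \<Lambda>. (weight \<beta> \<Lambda> M / ?Z) * f (spin M))"
    unfolding sum.reindex_bij_betw[OF bij, symmetric]
    by (rule sum.cong[OF refl]) (simp add: ext plus_weight_eq_weight[OF fin])
  also have "\<dots> = gibbs_mean \<beta> \<Lambda> {} (\<lambda>M. f (spin M))"
    unfolding gibbs_mean_def Z confs_eq_image by (simp add: sum_divide_distrib)
  finally show ?thesis .
qed

definition minus_sites :: "(site \<Rightarrow> real) \<Rightarrow> site set" where
  "minus_sites \<sigma> = {x. \<sigma> x = - 1}"

lemma minus_sites_spin [simp]: "minus_sites (spin M) = M"
  by (auto simp: minus_sites_def spin_def)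

lemma spin_minus_sites: "\<sigma> \<in> configs UNIV \<Longrightarrow> spin (minus_sites \<sigma>) = \<sigma>"
proof
  fix x assume "\<sigma> \<in> configs UNIV"
  from PiE_mem[OF this, of x] show "spin (minus_sites \<sigma>) x = \<sigma> x" by (auto simp: minus_sites_def spin_def)
qed

lemma in_spin_cylinder_iff:
  assumes "\<sigma> \<in> configs UNIV" "s \<subseteq> \<Delta>"
  shows "\<sigma> \<in> cylinder UNIV \<Delta> (spin s) \<longleftrightarrow> minus_sites \<sigma> \<inter> \<Delta> = s"
proof -
  have "\<sigma> \<in> cylinder UNIV \<Delta> (spin s) \<longleftrightarrow> (\<forall>x\<in>\<Delta>. spin (minus_sites \<sigma>) x = spin s x)"
    unfolding spin_minus_sites[OF assms(1)] using assms(1) by (simp add: cylinder_def)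
  then show ?thesis using assms(2) by auto
qed

lemma local_function_expansion:
  fixes F :: "site set \<Rightarrow> real"
  assumes fin: "finite \<Delta>" and \<sigma>: "\<sigma> \<in> configs UNIV"
  shows "F (minus_sites \<sigma> \<inter> \<Delta>) = (\<Sum>s\<in>Pow \<Delta>. F s * indicator (cylinder UNIV \<Delta> (spin s)) \<sigma>)"
proof -
  have "(\<Sum>s\<in>Pow \<Delta>. F s * indicator (cylinder UNIV \<Delta> (spin s)) \<sigma>)
      = (\<Sum>s\<in>Pow \<Delta>. if minus_sites \<sigma> \<inter> \<Delta> = s then F s else 0)"
    by (rule sum.cong[OF refl]) (simp add: in_spin_cylinder_iff[OF \<sigma>] indicator_def)
  then show ?thesis using fin by simp
qed

lemma measurable_local_function:
  fixes F :: "site set \<Rightarrow> real"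
  assumes fin: "finite \<Delta>"
  shows "(\<lambda>\<sigma>. F (minus_sites \<sigma> \<inter> \<Delta>)) \<in> borel_measurable (config_space UNIV)"
proof -
  have "(\<lambda>\<sigma>. \<Sum>s\<in>Pow \<Delta>. F s * indicator (cylinder UNIV \<Delta> (spin s)) \<sigma>) \<in> borel_measurable (config_space UNIV)"
    using cylinder_measurable[OF fin subset_UNIV]
    by (intro borel_measurable_sum borel_measurable_times borel_measurable_const borel_measurable_indicator)
  then show ?thesis
    by (rule measurable_cong[THEN iffD2, rotated]) (simp add: space_config_space local_function_expansion[OF fin])
qed

lemma continuous_measurable:
  assumes f: "continuous_map (config_topology UNIV) euclideanreal f"
  shows "(f :: (site \<Rightarrow> real) \<Rightarrow> real) \<in> borel_measurable (config_space UNIV)"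
proof -
  obtain D :: "nat \<Rightarrow> site set" where D: "\<And>n. finite (D n)" "filterlim D (finite_subsets_at_top UNIV) sequentially"
    using exhausting_finite_sets[of "UNIV :: site set"] by (metis countableI_type)
  show ?thesis
  proof (rule borel_measurable_LIMSEQ_real)
    show "(\<lambda>\<sigma>. f (spin (minus_sites \<sigma> \<inter> D n))) \<in> borel_measurable (config_space UNIV)" for n
      by (rule measurable_local_function[OF D(1)])
    fix \<sigma> :: "site \<Rightarrow> real" assume "\<sigma> \<in> space (config_space UNIV)"
    then have \<sigma>: "\<sigma> \<in> configs UNIV" by (simp add: space_config_space)
    show "(\<lambda>n. f (spin (minus_sites \<sigma> \<inter> D n))) \<longlonglongrightarrow> f \<sigma>"
    proof (rule tendstoI)
      fix e :: real assume "0 < e"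
      then obtain \<Delta> where \<Delta>: "finite \<Delta>" "\<And>\<sigma> \<tau>. \<sigma> \<in> configs UNIV \<Longrightarrow> \<tau> \<in> configs UNIV \<Longrightarrow>
          (\<And>i. i \<in> \<Delta> \<Longrightarrow> \<sigma> i = \<tau> i) \<Longrightarrow> \<bar>f \<sigma> - f \<tau>\<bar> < e"
        using continuous_is_quasilocal[OF f] by metis
      have "\<forall>\<^sub>F n in sequentially. finite (D n) \<and> \<Delta> \<subseteq> D n \<and> D n \<subseteq> UNIV"
        using D(2) \<Delta>(1) unfolding filterlim_finite_subsets_at_top by blast
      then show "\<forall>\<^sub>F n in sequentially. dist (f (spin (minus_sites \<sigma> \<inter> D n))) (f \<sigma>) < e"
      proof (rule eventually_mono)
        fix n assume n: "finite (D n) \<and> \<Delta> \<subseteq> D n \<and> D n \<subseteq> UNIV"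
        have "\<bar>f (spin (minus_sites \<sigma> \<inter> D n)) - f (spin (minus_sites \<sigma>))\<bar> < e"
          by (rule \<Delta>(2)) (use n in auto)
        then show "dist (f (spin (minus_sites \<sigma> \<inter> D n))) (f \<sigma>) < e"
          by (simp add: dist_real_def spin_minus_sites[OF \<sigma>])
      qed
    qed
  qed
qed

text \<open>
  Indicator functions of cylinders are continuous.
\<close>

lemma plus_limit_unique:
  assumes "is_plus_limit \<beta> \<mu>" "is_plus_limit \<beta> \<mu>'"
  shows "\<mu> = \<mu>'"
proof (rule config_measure_eqI[where T = UNIV])
  interpret \<mu>: prob_space \<mu> using assms(1) by (simp add: is_plus_limit_def)
  interpret \<mu>': prob_space \<mu>' using assms(2) by (simp add: is_plus_limit_def)
  show "finite_measure \<mu>" "finite_measure \<mu>'" by unfold_locales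
  show s: "sets \<mu> = sets (config_space UNIV)" "sets \<mu>' = sets (config_space UNIV)"
    using assms by (auto simp: is_plus_limit_def)
  fix J :: "site set" and t :: "site \<Rightarrow> real" assume J: "finite J"
  let ?C = "cylinder UNIV J t"
  have "continuous_map (config_topology UNIV) euclideanreal (indicator ?C :: _ \<Rightarrow> real)"
    by (rule continuous_local_function[OF J]) (auto simp: indicator_def cylinder_def)
  then have "(\<integral>\<sigma>. indicator ?C \<sigma> \<partial>\<mu>) = (\<integral>\<sigma>. indicator ?C \<sigma> \<partial>\<mu>' :: real)"
    using assms tendsto_unique[OF finite_subsets_at_top_neq_bot] unfolding is_plus_limit_def by blast
  moreover have "?C \<in> sets \<mu>" "?C \<in> sets \<mu>'" using cylinder_measurable[OF J subset_UNIV] s by auto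
  ultimately show "measure \<mu> ?C = measure \<mu>' ?C" by simp
qed

lemma plus_limit_if_local_probs:
  assumes \<beta>: "0 \<le> \<beta>" and \<mu>: "prob_space \<mu>" "sets \<mu> = sets (config_space UNIV)"
    and cyl: "\<And>\<Delta> s. finite \<Delta> \<Longrightarrow> s \<subseteq> \<Delta> \<Longrightarrow> measure \<mu> (cylinder UNIV \<Delta> (spin s)) = local_prob \<beta> \<Delta> s"
  shows "is_plus_limit \<beta> \<mu>"
  unfolding is_plus_limit_def
proof (intro conjI allI impI \<mu>)
  interpret prob_space \<mu> by fact
  have space: "space \<mu> = configs UNIV" using sets_eq_imp_space_eq[OF \<mu>(2)] by (simp add: space_config_space)
  fix f :: "(site \<Rightarrow> real) \<Rightarrow> real" assume f: "continuous_map (config_topology UNIV) euclideanreal f"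
  have meas: "g \<in> borel_measurable \<mu>" if "g \<in> borel_measurable (config_space UNIV)" for g :: "(site \<Rightarrow> real) \<Rightarrow> real"
    using that measurable_cong_sets[OF \<mu>(2) refl] by blast
  have int_local: "integrable \<mu> (\<lambda>\<sigma>. F (minus_sites \<sigma> \<inter> \<Delta>))" if fin: "finite \<Delta>" for F :: "site set \<Rightarrow> real" and \<Delta>
  proof (rule integrable_const_bound[of _ "\<Sum>s\<in>Pow \<Delta>. \<bar>F s\<bar>"])
    have "\<bar>F (minus_sites \<sigma> \<inter> \<Delta>)\<bar> \<le> (\<Sum>s\<in>Pow \<Delta>. \<bar>F s\<bar>)" for \<sigma>
      by (rule member_le_sum[of _ "Pow \<Delta>" "\<lambda>s. \<bar>F s\<bar>"]) (use fin in auto)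
    then show "AE \<sigma> in \<mu>. norm (F (minus_sites \<sigma> \<inter> \<Delta>)) \<le> (\<Sum>s\<in>Pow \<Delta>. \<bar>F s\<bar>)" by simp
  qed (rule meas[OF measurable_local_function[OF fin]])
  have integral_local: "(\<integral>\<sigma>. F (minus_sites \<sigma> \<inter> \<Delta>) \<partial>\<mu>) = (\<Sum>s\<in>Pow \<Delta>. F s * local_prob \<beta> \<Delta> s)"
    if fin: "finite \<Delta>" for F :: "site set \<Rightarrow> real" and \<Delta>
  proof -
    have C: "cylinder UNIV \<Delta> (spin s) \<in> sets \<mu>" for s using cylinder_measurable[OF fin subset_UNIV] \<mu>(2) by simp
    have "(\<integral>\<sigma>. F (minus_sites \<sigma> \<inter> \<Delta>) \<partial>\<mu>) = (\<integral>\<sigma>. (\<Sum>s\<in>Pow \<Delta>. F s * indicator (cylinder UNIV \<Delta> (spin s)) \<sigma>) \<partial>\<mu>)"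
      by (rule Bochner_Integration.integral_cong[OF refl]) (simp only: space local_function_expansion[OF fin])
    also have "\<dots> = (\<Sum>s\<in>Pow \<Delta>. \<integral>\<sigma>. F s * indicator (cylinder UNIV \<Delta> (spin s)) \<sigma> \<partial>\<mu>)"
      by (rule Bochner_Integration.integral_sum)
         (use C in \<open>intro integrable_mult_right integrable_real_indicator; simp add: emeasure_eq_measure\<close>)
    also have "\<dots> = (\<Sum>s\<in>Pow \<Delta>. F s * local_prob \<beta> \<Delta> s)"
      by (rule sum.cong[OF refl]) (use C cyl[OF fin] in simp)
    finally show ?thesis .
  qed
  have near: "\<exists>\<Delta>. finite \<Delta> \<and> (\<forall>\<sigma>\<in>configs UNIV. \<bar>f \<sigma> - f (spin (minus_sites \<sigma> \<inter> \<Delta>))\<bar> < \<epsilon>)" if \<epsilon>: "0 < \<epsilon>" for \<epsilon>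
  proof -
    obtain \<Delta> where \<Delta>: "finite \<Delta>" "\<And>\<sigma> \<tau>. \<sigma> \<in> configs UNIV \<Longrightarrow> \<tau> \<in> configs UNIV \<Longrightarrow>
        (\<And>i. i \<in> \<Delta> \<Longrightarrow> \<sigma> i = \<tau> i) \<Longrightarrow> \<bar>f \<sigma> - f \<tau>\<bar> < \<epsilon>"
      using continuous_is_quasilocal[OF f \<epsilon>] by metis
    have "\<bar>f \<sigma> - f (spin (minus_sites \<sigma> \<inter> \<Delta>))\<bar> < \<epsilon>" if \<sigma>: "\<sigma> \<in> configs UNIV" for \<sigma>
    proof -
      have "\<bar>f (spin (minus_sites \<sigma>)) - f (spin (minus_sites \<sigma> \<inter> \<Delta>))\<bar> < \<epsilon>" by (rule \<Delta>(2)) auto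
      then show ?thesis by (simp only: spin_minus_sites[OF \<sigma>])
    qed
    then show ?thesis using \<Delta>(1) by blast
  qed
  have fm: "f \<in> borel_measurable (config_space UNIV)" by (rule continuous_measurable[OF f])
  have int_f: "integrable \<mu> f"
  proof -
    obtain \<Delta> where \<Delta>: "finite \<Delta>" "\<forall>\<sigma>\<in>configs UNIV. \<bar>f \<sigma> - f (spin (minus_sites \<sigma> \<inter> \<Delta>))\<bar> < 1" using near[of 1] by auto
    let ?g = "\<lambda>\<sigma>. f (spin (minus_sites \<sigma> \<inter> \<Delta>))"
    have "integrable \<mu> ?g" by (rule int_local[OF \<Delta>(1), of "\<lambda>s. f (spin s)"])
    moreover have "integrable \<mu> (\<lambda>\<sigma>. f \<sigma> - ?g \<sigma>)"
    proof (rule integrable_const_bound[of _ 1])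
      show "AE \<sigma> in \<mu>. norm (f \<sigma> - ?g \<sigma>) \<le> 1" using \<Delta>(2) by (intro AE_I2) (auto simp: space intro: less_imp_le)
      show "(\<lambda>\<sigma>. f \<sigma> - ?g \<sigma>) \<in> borel_measurable \<mu>"
        by (intro borel_measurable_diff meas fm measurable_local_function[OF \<Delta>(1), of "\<lambda>s. f (spin s)"])
    qed
    ultimately have "integrable \<mu> (\<lambda>\<sigma>. ?g \<sigma> + (f \<sigma> - ?g \<sigma>))" by (rule Bochner_Integration.integrable_add)
    then show ?thesis by simp
  qed
  show "((\<lambda>\<Lambda>. \<integral>\<sigma>. f \<sigma> \<partial>distr (ising_plus \<beta> \<Lambda>) (config_space UNIV) (plus_extension \<Lambda>)) \<longlongrightarrow> (\<integral>\<sigma>. f \<sigma> \<partial>\<mu>))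
      (finite_subsets_at_top UNIV)"
  proof (rule tendstoI)
    fix e :: real assume e: "0 < e"
    obtain \<Delta> where \<Delta>: "finite \<Delta>" "\<forall>\<sigma>\<in>configs UNIV. \<bar>f \<sigma> - f (spin (minus_sites \<sigma> \<inter> \<Delta>))\<bar> < e / 4"
      using near[of "e / 4"] e by auto
    let ?F = "\<lambda>s. f (spin s)"
    let ?I = "\<integral>\<sigma>. ?F (minus_sites \<sigma> \<inter> \<Delta>) \<partial>\<mu>"
    have "\<bar>(\<integral>\<sigma>. f \<sigma> \<partial>\<mu>) - ?I\<bar> = \<bar>\<integral>\<sigma>. f \<sigma> - ?F (minus_sites \<sigma> \<inter> \<Delta>) \<partial>\<mu>\<bar>"
      using int_f int_local[OF \<Delta>(1), of ?F] by simp
    also have "\<dots> \<le> (\<integral>\<sigma>. \<bar>f \<sigma> - ?F (minus_sites \<sigma> \<inter> \<Delta>)\<bar> \<partial>\<mu>)" by (rule integral_abs_bound)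
    also have "\<dots> \<le> (\<integral>\<sigma>. e / 4 \<partial>\<mu>)"
    proof (rule integral_mono)
      show "integrable \<mu> (\<lambda>\<sigma>. \<bar>f \<sigma> - ?F (minus_sites \<sigma> \<inter> \<Delta>)\<bar>)"
        by (intro integrable_abs Bochner_Integration.integrable_diff int_f int_local[OF \<Delta>(1), of ?F])
      show "integrable \<mu> (\<lambda>\<sigma>. e / 4)" by simp
      fix \<sigma> assume "\<sigma> \<in> space \<mu>"
      then show "\<bar>f \<sigma> - ?F (minus_sites \<sigma> \<inter> \<Delta>)\<bar> \<le> e / 4" using \<Delta>(2) unfolding space by (blast intro: less_imp_le)
    qed
    also have "\<dots> = e / 4" by (simp add: prob_space)
    finally have 1: "\<bar>(\<integral>\<sigma>. f \<sigma> \<partial>\<mu>) - ?I\<bar> \<le> e / 4" .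
    have "((\<lambda>\<Lambda>. gibbs_mean \<beta> \<Lambda> {} (\<lambda>M. ?F (M \<inter> \<Delta>))) \<longlongrightarrow> ?I) (finite_subsets_at_top UNIV)"
      unfolding integral_local[OF \<Delta>(1), of ?F] by (rule tendsto_local_mean[OF \<beta> \<Delta>(1)])
    from tendstoD[OF this, of "e / 4"] e
    have "\<forall>\<^sub>F \<Lambda> in finite_subsets_at_top UNIV. dist (gibbs_mean \<beta> \<Lambda> {} (\<lambda>M. ?F (M \<inter> \<Delta>))) ?I < e / 4" by simp
    from eventually_conj[OF this eventually_finite_supersets[OF finite.emptyI empty_subsetI]]
    show "\<forall>\<^sub>F \<Lambda> in finite_subsets_at_top UNIV.
        dist (\<integral>\<sigma>. f \<sigma> \<partial>distr (ising_plus \<beta> \<Lambda>) (config_space UNIV) (plus_extension \<Lambda>)) (\<integral>\<sigma>. f \<sigma> \<partial>\<mu>) < e"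
    proof (rule eventually_mono, elim conjE)
      fix \<Lambda> :: "site set"
      assume d: "dist (gibbs_mean \<beta> \<Lambda> {} (\<lambda>M. ?F (M \<inter> \<Delta>))) ?I < e / 4" and fin: "finite \<Lambda>"
      have b0: "\<bar>f (spin M) - ?F (M \<inter> \<Delta>)\<bar> \<le> e / 4" for M
        using bspec[OF \<Delta>(2) spin_in_configs(1)[of M]] by simp
      have b: "- (e / 4) \<le> f (spin M) - ?F (M \<inter> \<Delta>)" "f (spin M) - ?F (M \<inter> \<Delta>) \<le> e / 4" for M
        using b0[of M] by linarith+
      have "- (e / 4) \<le> gibbs_mean \<beta> \<Lambda> {} (\<lambda>M. f (spin M) - ?F (M \<inter> \<Delta>))"
        "gibbs_mean \<beta> \<Lambda> {} (\<lambda>M. f (spin M) - ?F (M \<inter> \<Delta>)) \<le> e / 4"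
        by (rule gibbs_mean_bounds[OF fin b])+
      then have "\<bar>gibbs_mean \<beta> \<Lambda> {} (\<lambda>M. f (spin M)) - gibbs_mean \<beta> \<Lambda> {} (\<lambda>M. ?F (M \<inter> \<Delta>))\<bar> \<le> e / 4"
        unfolding gibbs_mean_diff by linarith
      then show "dist (\<integral>\<sigma>. f \<sigma> \<partial>distr (ising_plus \<beta> \<Lambda>) (config_space UNIV) (plus_extension \<Lambda>)) (\<integral>\<sigma>. f \<sigma> \<partial>\<mu>) < e"
        using d 1 e unfolding ising_plus_integral[OF fin fm] dist_real_def by linarith
    qed
  qed
qed

theorem plus_phase_properties:
  assumes \<beta>: "0 \<le> \<beta>"
  shows "prob_space (plus_phase \<beta>)" "sets (plus_phase \<beta>) = sets (config_space UNIV)"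
    and "finite \<Delta> \<Longrightarrow> s \<subseteq> \<Delta> \<Longrightarrow> measure (plus_phase \<beta>) (cylinder UNIV \<Delta> (spin s)) = local_prob \<beta> \<Delta> s"
proof -
  have "\<exists>\<mu>. prob_space \<mu> \<and> sets \<mu> = sets (config_space UNIV) \<and>
      (\<forall>\<Delta> s. finite \<Delta> \<and> s \<subseteq> \<Delta> \<longrightarrow> measure \<mu> (cylinder UNIV \<Delta> (spin s)) = local_prob \<beta> \<Delta> s)"
  proof (rule exists_measure_with_local_probs[OF \<beta>])
    fix \<mu> assume \<mu>: "prob_space \<mu>" "sets \<mu> = sets (config_space UNIV)"
      "\<And>\<Delta> s. finite \<Delta> \<Longrightarrow> s \<subseteq> \<Delta> \<Longrightarrow>
        measure \<mu> {\<sigma> \<in> configs UNIV. \<forall>x\<in>\<Delta>. \<sigma> x = spin s x} = local_prob \<beta> \<Delta> s"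
    then show ?thesis unfolding cylinder_def by (intro exI[of _ \<mu>] conjI allI impI) auto
  qed
  then obtain \<mu> where *: "prob_space \<mu> \<and> sets \<mu> = sets (config_space UNIV) \<and>
      (\<forall>\<Delta> s. finite \<Delta> \<and> s \<subseteq> \<Delta> \<longrightarrow> measure \<mu> (cylinder UNIV \<Delta> (spin s)) = local_prob \<beta> \<Delta> s)" ..
  then have \<mu>: "prob_space \<mu>" "sets \<mu> = sets (config_space UNIV)" by simp_all
  have cyl: "measure \<mu> (cylinder UNIV \<Delta> (spin s)) = local_prob \<beta> \<Delta> s" if "finite \<Delta>" "s \<subseteq> \<Delta>" for \<Delta> s
    using * that by simp
  have lim: "is_plus_limit \<beta> \<mu>" by (rule plus_limit_if_local_probs[OF \<beta> \<mu> cyl])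
  have eq: "plus_phase \<beta> = \<mu>" unfolding plus_phase_def
    by (rule the_equality[where P = "is_plus_limit \<beta>", OF lim]) (rule plus_limit_unique[OF _ lim])
  show "prob_space (plus_phase \<beta>)" "sets (plus_phase \<beta>) = sets (config_space UNIV)"
    unfolding eq by (rule \<mu>(1), rule \<mu>(2))
  show "measure (plus_phase \<beta>) (cylinder UNIV \<Delta> (spin s)) = local_prob \<beta> \<Delta> s" if "finite \<Delta>" "s \<subseteq> \<Delta>"
    unfolding eq by (rule cyl[OF that])
qed


section \<open>Sparseness of the random set of sites\<close>

text \<open>
  Independence enters through this formula.
\<close>

lemma occupied_superset_prob:
  assumes p: "0 \<le> p" "p \<le> 1" and T: "finite T"
  shows "emeasure (iid_bernoulli p) {n \<in> space (iid_bernoulli p). T \<subseteq> occupied n} = ennreal (p ^ card T)"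
proof -
  let ?N = "measure_pmf (map_pmf of_bool (bernoulli_pmf p)) :: nat measure"
  interpret product_prob_space "\<lambda>_ :: int. ?N" UNIV
    by unfold_locales
  have "emeasure ?N {1} = ennreal p"
  proof -
    have "measure_pmf.prob (map_pmf of_bool (bernoulli_pmf p)) {1 :: nat} = measure_pmf.prob (bernoulli_pmf p) {True}"
      by (subst measure_map_pmf)
        (auto intro!: arg_cong[of _ _ "measure_pmf.prob (bernoulli_pmf p)"] simp: of_bool_def split: if_splits)
    also have "\<dots> = p" using p by (simp add: measure_pmf_single)
    finally show ?thesis by (simp add: measure_pmf.emeasure_eq_measure)
  qed
  then have "emeasure (Pi\<^sub>M UNIV (\<lambda>_. ?N)) {n \<in> space (Pi\<^sub>M UNIV (\<lambda>_. ?N)). \<forall>i\<in>T. n i \<in> {1}} = (\<Prod>i\<in>T. ennreal p)"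
    using emeasure_PiM_Collect[OF subset_UNIV T, of "\<lambda>_. {1}"] by simp
  moreover have "{n \<in> space (Pi\<^sub>M UNIV (\<lambda>_. ?N)). \<forall>i\<in>T. n i \<in> {1}} = {n \<in> space (iid_bernoulli p). T \<subseteq> occupied n}"
    by (auto simp: iid_bernoulli_def occupied_def)
  ultimately show ?thesis using p by (simp add: iid_bernoulli_def ennreal_power)
qed

definition crowded :: "int \<Rightarrow> nat \<Rightarrow> (int \<Rightarrow> nat) \<Rightarrow> bool" where
  "crowded j l n \<longleftrightarrow> (\<exists>a b. a \<le> j \<and> j \<le> b \<and> b - a + 1 = int l \<and> int l < 16 * int (card (occupied n \<inter> {a..b})))"

text \<open>
  A union bound over the at most \<open>l\<close> intervals and the at most \<open>2 ^ l\<close> subsets with more than \<open>l / 16\<close>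
  elements, each of which is fully occupied with probability at most \<open>8 ^ (- l)\<close>.
\<close>

lemma crowded_prob:
  assumes p: "0 \<le> p" "p < 1 / 2 ^ 48"
  shows "{n \<in> space (iid_bernoulli p). crowded j l n} \<in> sets (iid_bernoulli p)"
    and "measure (iid_bernoulli p) {n \<in> space (iid_bernoulli p). crowded j l n} \<le> (1 / 2) ^ l"
proof -
  let ?P = "iid_bernoulli p"
  interpret prob_space ?P unfolding iid_bernoulli_def by (rule prob_space_PiM) (rule measure_pmf.prob_space_axioms)
  have p1: "p \<le> 1" using p by simp
  define I where "I a = {a..a + int l - 1}" for a :: int
  let ?A = "{j - int l + 1..j}"
  define Ts where "Ts a = {T. T \<subseteq> I a \<and> l < 16 * card T}" for a
  have finI: "finite (I a)" "card (I a) = l" for a by (auto simp: I_def)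
  have finT: "finite (Ts a)" "card (Ts a) \<le> 2 ^ l" for a
  proof -
    have sub: "Ts a \<subseteq> Pow (I a)" by (auto simp: Ts_def)
    show "finite (Ts a)" by (rule finite_subset[OF sub]) (simp add: finI)
    have "card (Ts a) \<le> card (Pow (I a))" by (rule card_mono[OF _ sub]) (simp add: finI)
    then show "card (Ts a) \<le> 2 ^ l" by (simp add: card_Pow finI)
  qed
  let ?E = "\<lambda>T. {n \<in> space ?P. T \<subseteq> occupied n}"
  have eq: "{n \<in> space ?P. crowded j l n} = (\<Union>a\<in>?A. \<Union>T\<in>Ts a. ?E T)"
  proof (intro set_eqI iffI)
    fix n assume n: "n \<in> {n \<in> space ?P. crowded j l n}"
    then obtain a b where ab: "a \<le> j" "j \<le> b" "b - a + 1 = int l" "int l < 16 * int (card (occupied n \<inter> {a..b}))"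
      by (auto simp: crowded_def)
    have "{a..b} = I a" using ab(3) by (auto simp: I_def)
    then have "occupied n \<inter> I a \<in> Ts a" using ab(4) by (auto simp: Ts_def)
    moreover have "a \<in> ?A" using ab by auto
    ultimately show "n \<in> (\<Union>a\<in>?A. \<Union>T\<in>Ts a. ?E T)" using n by blast
  next
    fix n assume "n \<in> (\<Union>a\<in>?A. \<Union>T\<in>Ts a. ?E T)"
    then obtain a T where a: "a \<in> ?A" and T: "T \<in> Ts a" "T \<subseteq> occupied n" and n: "n \<in> space ?P" by blast
    have "card T \<le> card (occupied n \<inter> I a)"
      by (rule card_mono) (use T finI in \<open>auto simp: Ts_def\<close>)
    then have "int l < 16 * int (card (occupied n \<inter> {a..a + int l - 1}))"
      using T(1) unfolding Ts_def I_def by simp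
    then have "crowded j l n" unfolding crowded_def
      by (intro exI[of _ a] exI[of _ "a + int l - 1"]) (use a in auto)
    then show "n \<in> {n \<in> space ?P. crowded j l n}" using n by simp
  qed
  have finTT: "finite T" if "T \<in> Ts a" for T a using that finI(1)[of a] finite_subset by (auto simp: Ts_def)
  have em: "emeasure ?P (?E T) = ennreal (p ^ card T)" if "T \<in> Ts a" for T a
    by (rule occupied_superset_prob[OF p(1) p1 finTT[OF that]])
  have meas: "?E T \<in> sets ?P" if "T \<in> Ts a" for T a
  proof -
    have "{n \<in> space (Pi\<^sub>M UNIV (\<lambda>_ :: int. measure_pmf (map_pmf of_bool (bernoulli_pmf p)) :: nat measure)). \<forall>i\<in>T. n i = 1}
        \<in> sets (Pi\<^sub>M UNIV (\<lambda>_. measure_pmf (map_pmf of_bool (bernoulli_pmf p))))"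
      using finTT[OF that] by measurable
    then show ?thesis by (simp add: iid_bernoulli_def occupied_def subset_iff Ball_def)
  qed
  have prob_E: "prob (?E T) \<le> (1 / 8) ^ l" if "T \<in> Ts a" for T a
  proof -
    have "prob (?E T) = p ^ card T" using em[OF that] p by (simp add: measure_def)
    also have "\<dots> \<le> (1 / 2 ^ 48) ^ card T" by (rule power_mono) (use p in auto)
    also have "\<dots> = (1 / 8) ^ (16 * card T)" by (simp add: power_mult power_one_over)
    also have "\<dots> \<le> (1 / 8) ^ l" by (rule power_decreasing) (use that in \<open>auto simp: Ts_def\<close>)
    finally show ?thesis .
  qed
  show "{n \<in> space ?P. crowded j l n} \<in> sets ?P"
    unfolding eq using meas finT by (intro sets.finite_UN) auto
  have "prob {n \<in> space ?P. crowded j l n} \<le> (\<Sum>a\<in>?A. prob (\<Union>T\<in>Ts a. ?E T))"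
    unfolding eq by (rule finite_measure_subadditive_finite) (use meas finT in \<open>auto intro!: sets.finite_UN\<close>)
  also have "\<dots> \<le> (\<Sum>a\<in>?A. 2 ^ l * (1 / 8) ^ l)"
  proof (rule sum_mono)
    fix a
    have "prob (\<Union>T\<in>Ts a. ?E T) \<le> (\<Sum>T\<in>Ts a. prob (?E T))"
      by (rule finite_measure_subadditive_finite) (use meas finT in auto)
    also have "\<dots> \<le> (\<Sum>T\<in>Ts a. (1 / 8) ^ l)" by (rule sum_mono) (rule prob_E)
    also have "\<dots> = real (card (Ts a)) * (1 / 8) ^ l" by simp
    also have "\<dots> \<le> real (2 ^ l) * (1 / 8) ^ l" using finT(2)[of a] by (intro mult_right_mono) (simp_all only: of_nat_le_iff zero_le_power zero_le_divide_1_iff zero_le_numeral)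
    finally show "prob (\<Union>T\<in>Ts a. ?E T) \<le> 2 ^ l * (1 / 8) ^ l" by simp
  qed
  also have "\<dots> = real l * (1 / 4) ^ l" by (simp add: power_mult_distrib[symmetric])
  also have "\<dots> \<le> 2 ^ l * (1 / 4) ^ l"
  proof (rule mult_right_mono)
    show "real l \<le> 2 ^ l" using less_exp[of l] by (metis less_imp_le of_nat_le_iff of_nat_numeral of_nat_power)
  qed simp
  also have "\<dots> = (1 / 2) ^ l" by (simp add: power_mult_distrib[symmetric])
  finally show "prob {n \<in> space ?P. crowded j l n} \<le> (1 / 2) ^ l" .
qed

theorem almost_surely_sparse:
  assumes p: "0 \<le> p" "p < 1 / 2 ^ 48"
  shows "AE n in iid_bernoulli p. \<forall>j. \<exists>L. sparse_around (occupied n) j L"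
  unfolding AE_all_countable
proof
  fix j
  let ?P = "iid_bernoulli p"
  interpret prob_space ?P unfolding iid_bernoulli_def by (rule prob_space_PiM) (rule measure_pmf.prob_space_axioms)
  have "AE n in ?P. eventually (\<lambda>l. n \<in> space ?P - {n \<in> space ?P. crowded j l n}) sequentially"
  proof (rule borel_cantelli_AE1)
    show "summable (\<lambda>l. prob {n \<in> space ?P. crowded j l n})"
      by (rule summable_comparison_test'[of "\<lambda>l. (1 / 2 :: real) ^ l" 0])
         (use crowded_prob(2)[OF p] in \<open>auto intro!: summable_geometric\<close>)
  qed (use crowded_prob(1)[OF p] in \<open>auto simp: emeasure_eq_measure\<close>)
  then show "AE n in ?P. \<exists>L. sparse_around (occupied n) j L"
  proof (rule AE_mp, intro AE_I2 impI)
    fix n assume n: "n \<in> space ?P" and "eventually (\<lambda>l. n \<in> space ?P - {n \<in> space ?P. crowded j l n}) sequentially"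
    then obtain L where L: "\<And>l. L \<le> l \<Longrightarrow> \<not> crowded j l n" by (auto simp: eventually_sequentially)
    have "sparse_around (occupied n) j L"
      unfolding sparse_around_def
    proof (intro allI impI)
      fix a b assume ab: "a \<le> j \<and> j \<le> b \<and> int L \<le> b - a + 1"
      then have l: "int (nat (b - a + 1)) = b - a + 1" "L \<le> nat (b - a + 1)" by auto
      have "\<not> b - a + 1 < 16 * int (card (occupied n \<inter> {a..b}))"
        using L[OF l(2)] ab unfolding crowded_def l(1) by auto
      then show "16 * int (card (occupied n \<inter> {a..b})) \<le> b - a + 1" by simp
    qed
    then show "\<exists>L. sparse_around (occupied n) j L" ..
  qed
qed


section \<open>The decimated plus phase\<close>

text \<open>
  Uniform positivity of the conditional probabilities (finite energy).
\<close>

lemma gibbs_mean_point_lower: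
  fixes \<beta> :: real
  assumes \<beta>: "0 \<le> \<beta>" and fin: "finite \<Delta>" and s: "s \<subseteq> \<Delta>"
  shows "exp (- 2 * \<beta> * card (bonds_touching \<Delta>)) / 2 ^ card \<Delta> \<le> gibbs_mean \<beta> \<Delta> N (\<lambda>M. of_bool (M \<inter> \<Delta> = s))"
proof -
  let ?e = "exp (- 2 * \<beta> * card (bonds_touching \<Delta>))" and ?M = "s \<union> (N - \<Delta>)"
  have Z: "partition_sum \<beta> \<Delta> N \<le> 2 ^ card \<Delta>"
  proof -
    have "partition_sum \<beta> \<Delta> N \<le> (\<Sum>A\<in>Pow \<Delta>. 1)"
      unfolding partition_sum_def sum_confs by (rule sum_mono) (use \<beta> in \<open>simp add: weight_def\<close>)
    then show ?thesis by (simp add: card_Pow fin)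
  qed
  have "card (cut_bonds \<Delta> ?M) \<le> card (bonds_touching \<Delta>)"
    by (rule card_mono[OF finite_bonds_touching(1)[OF fin]]) (auto simp: cut_bonds_def)
  then have w: "?e \<le> weight \<beta> \<Delta> ?M" unfolding weight_def using \<beta> by (simp add: mult_left_mono)
  have M: "?M \<in> confs \<Delta> N" using s unfolding confs_def by blast
  have "weight \<beta> \<Delta> ?M = weight \<beta> \<Delta> ?M * of_bool (?M \<inter> \<Delta> = s)" using s by (auto simp: Int_Un_distrib2)
  also have "\<dots> \<le> (\<Sum>M\<in>confs \<Delta> N. weight \<beta> \<Delta> M * of_bool (M \<inter> \<Delta> = s))"
    by (rule member_le_sum[OF M]) (simp_all add: weight_pos less_imp_le finite_confs fin)
  finally have le: "?e \<le> (\<Sum>M\<in>confs \<Delta> N. weight \<beta> \<Delta> M * of_bool (M \<inter> \<Delta> = s))" using w by linarith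
  show ?thesis unfolding gibbs_mean_def
    by (rule frac_le[OF order_trans[OF exp_ge_zero le] le partition_sum_pos[OF fin] Z])
qed

lemma local_prob_pos:
  assumes \<beta>: "0 \<le> \<beta>" and fin: "finite \<Delta>" and s: "s \<subseteq> \<Delta>"
  shows "0 < local_prob \<beta> \<Delta> s"
proof -
  let ?c = "exp (- 2 * \<beta> * card (bonds_touching \<Delta>)) / 2 ^ card \<Delta>"
  have "?c \<le> local_prob \<beta> \<Delta> s"
  proof (rule tendsto_lowerbound[OF tendsto_local_prob[OF \<beta>] _ finite_subsets_at_top_neq_bot])
    from eventually_finite_supersets[OF fin subset_UNIV]
    show "\<forall>\<^sub>F \<Lambda> in finite_subsets_at_top UNIV. ?c \<le> gibbs_mean \<beta> \<Lambda> {} (\<lambda>M. of_bool (M \<inter> \<Delta> = s))"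
    proof (rule eventually_mono, elim conjE)
      fix \<Lambda> assume \<Lambda>: "finite \<Lambda>" "\<Delta> \<subseteq> \<Lambda>"
      have "?c = gibbs_mean \<beta> \<Lambda> {} (\<lambda>M. ?c)" by (rule gibbs_mean_const[OF \<Lambda>(1), symmetric])
      also have "\<dots> \<le> gibbs_mean \<beta> \<Lambda> {} (\<lambda>M. gibbs_mean \<beta> \<Delta> M (\<lambda>M. of_bool (M \<inter> \<Delta> = s)))"
        by (rule gibbs_mean_mono[OF \<Lambda>(1) gibbs_mean_point_lower[OF \<beta> fin s]])
      also have "\<dots> = gibbs_mean \<beta> \<Lambda> {} (\<lambda>M. of_bool (M \<inter> \<Delta> = s))"
        by (rule gibbs_mean_consistent[OF \<Lambda>, symmetric])
      finally show "?c \<le> gibbs_mean \<beta> \<Lambda> {} (\<lambda>M. of_bool (M \<inter> \<Delta> = s))" .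
    qed
  qed
  moreover have "0 < ?c" by simp
  ultimately show ?thesis by linarith
qed

text \<open>
  Conditioning on the spins in \<open>\<Delta>\<close> means freezing them.
\<close>

lemma gibbs_mean_condition:
  assumes fin: "finite \<Lambda>" and \<Delta>: "\<Delta> \<subseteq> \<Lambda>" "s \<subseteq> \<Delta>" "x \<notin> \<Delta>"
  shows "gibbs_mean \<beta> \<Lambda> {} (\<lambda>M. of_bool (M \<inter> insert x \<Delta> = insert x s)) =
     gibbs_mean \<beta> (\<Lambda> - \<Delta>) s (\<lambda>M. of_bool (x \<in> M)) * gibbs_mean \<beta> \<Lambda> {} (\<lambda>M. of_bool (M \<inter> \<Delta> = s))"
proof -
  let ?q = "gibbs_mean \<beta> (\<Lambda> - \<Delta>) s (\<lambda>M. of_bool (x \<in> M))"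
  have "M \<inter> insert x \<Delta> = insert x s \<longleftrightarrow> M \<inter> \<Delta> = s \<and> x \<in> M" for M
  proof
    assume eq: "M \<inter> insert x \<Delta> = insert x s"
    have "M \<inter> \<Delta> = (M \<inter> insert x \<Delta>) \<inter> \<Delta>" by blast
    also have "\<dots> = s" unfolding eq using \<Delta> by blast
    finally show "M \<inter> \<Delta> = s \<and> x \<in> M" using eq by blast
  qed blast
  then have "gibbs_mean \<beta> \<Lambda> {} (\<lambda>M. of_bool (M \<inter> insert x \<Delta> = insert x s)) =
      gibbs_mean \<beta> \<Lambda> {} (\<lambda>M. of_bool (M \<inter> \<Delta> = s) * of_bool (x \<in> M))" by (simp add: of_bool_conj)
  also have "\<dots> = gibbs_mean \<beta> \<Lambda> {} (\<lambda>M. gibbs_mean \<beta> (\<Lambda> - \<Delta>) M (\<lambda>M. of_bool (M \<inter> \<Delta> = s) * of_bool (x \<in> M)))"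
    by (rule gibbs_mean_consistent[OF fin]) blast
  also have "\<dots> = gibbs_mean \<beta> \<Lambda> {} (\<lambda>M. ?q * of_bool (M \<inter> \<Delta> = s))"
  proof (rule gibbs_mean_cong[OF refl])
    fix M assume M: "M \<in> confs \<Lambda> {}"
    have "gibbs_mean \<beta> (\<Lambda> - \<Delta>) M (\<lambda>M. of_bool (M \<inter> \<Delta> = s) * of_bool (x \<in> M))
        = of_bool (M \<inter> \<Delta> = s) * gibbs_mean \<beta> (\<Lambda> - \<Delta>) M (\<lambda>M. of_bool (x \<in> M))"
    proof (rule gibbs_mean_pull_out)
      fix M' assume "M' \<in> confs (\<Lambda> - \<Delta>) M"
      then have "M' \<inter> \<Delta> = M \<inter> \<Delta>" unfolding confs_def by blast
      then show "(of_bool (M' \<inter> \<Delta> = s) :: real) = of_bool (M \<inter> \<Delta> = s)" by simp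
    qed
    also have "\<dots> = ?q * of_bool (M \<inter> \<Delta> = s)"
    proof (cases "M \<inter> \<Delta> = s")
      case True
      have "M - (\<Lambda> - \<Delta>) = s - (\<Lambda> - \<Delta>)" using True M \<Delta> unfolding confs_def by blast
      then have "gibbs_mean \<beta> (\<Lambda> - \<Delta>) M (\<lambda>M. of_bool (x \<in> M)) = ?q" by (rule gibbs_mean_cong) (rule refl)
      then show ?thesis by simp
    qed simp
    finally show "gibbs_mean \<beta> (\<Lambda> - \<Delta>) M (\<lambda>M. of_bool (M \<inter> \<Delta> = s) * of_bool (x \<in> M)) = ?q * of_bool (M \<inter> \<Delta> = s)" .
  qed
  also have "\<dots> = ?q * gibbs_mean \<beta> \<Lambda> {} (\<lambda>M. of_bool (M \<inter> \<Delta> = s))" by (rule gibbs_mean_cmult)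
  finally show ?thesis .
qed

text \<open>
  The conditional probability in the plus phase of a minus spin at \<open>x\<close>, given the set \<open>s\<close> of minus spins in \<open>\<Delta>\<close>.
\<close>

definition minus_prob :: "real \<Rightarrow> site \<Rightarrow> site set \<Rightarrow> site set \<Rightarrow> real" where
  "minus_prob \<beta> x \<Delta> s = local_prob \<beta> (insert x \<Delta>) (insert x s) / local_prob \<beta> \<Delta> s"

lemma tendsto_minus_prob:
  assumes \<beta>: "0 \<le> \<beta>" and \<Delta>: "finite \<Delta>" "s \<subseteq> \<Delta>" "x \<notin> \<Delta>"
  shows "((\<lambda>\<Lambda>. gibbs_mean \<beta> (\<Lambda> - \<Delta>) s (\<lambda>M. of_bool (x \<in> M))) \<longlongrightarrow> minus_prob \<beta> x \<Delta> s) (finite_subsets_at_top UNIV)"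
proof -
  let ?g = "\<lambda>\<Lambda>. gibbs_mean \<beta> \<Lambda> {} (\<lambda>M. of_bool (M \<inter> \<Delta> = s))"
  have pos: "0 < local_prob \<beta> \<Delta> s" by (rule local_prob_pos[OF \<beta> \<Delta>(1,2)])
  have lim: "((\<lambda>\<Lambda>. gibbs_mean \<beta> \<Lambda> {} (\<lambda>M. of_bool (M \<inter> insert x \<Delta> = insert x s)) / ?g \<Lambda>)
      \<longlongrightarrow> minus_prob \<beta> x \<Delta> s) (finite_subsets_at_top UNIV)"
    unfolding minus_prob_def using pos by (intro tendsto_divide tendsto_local_prob[OF \<beta>]) simp
  have "\<forall>\<^sub>F \<Lambda> in finite_subsets_at_top UNIV. 0 < ?g \<Lambda>"
    by (rule order_tendstoD(1)[OF tendsto_local_prob[OF \<beta>] pos])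
  from eventually_conj[OF this eventually_finite_supersets[OF \<Delta>(1) subset_UNIV]]
  have "\<forall>\<^sub>F \<Lambda> in finite_subsets_at_top UNIV.
      gibbs_mean \<beta> \<Lambda> {} (\<lambda>M. of_bool (M \<inter> insert x \<Delta> = insert x s)) / ?g \<Lambda> = gibbs_mean \<beta> (\<Lambda> - \<Delta>) s (\<lambda>M. of_bool (x \<in> M))"
    by (rule eventually_mono) (use \<Delta>(2,3) in \<open>simp add: gibbs_mean_condition\<close>)
  from Lim_transform_eventually[OF lim this] show ?thesis .
qed

lemma minus_prob_bounds:
  assumes \<beta>: "0 \<le> \<beta>"
  obtains c where "0 < c" "\<And>\<Delta> s. finite \<Delta> \<Longrightarrow> s \<subseteq> \<Delta> \<Longrightarrow> x \<notin> \<Delta> \<Longrightarrow> c \<le> minus_prob \<beta> x \<Delta> s \<and> minus_prob \<beta> x \<Delta> s \<le> 1 - c"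
proof -
  let ?c = "exp (- 2 * \<beta> * card (bonds_touching {x})) / 2 ^ card {x}"
  have one: "?c \<le> gibbs_mean \<beta> {x} N (\<lambda>M. of_bool (x \<in> M)) \<and> gibbs_mean \<beta> {x} N (\<lambda>M. of_bool (x \<in> M)) \<le> 1 - ?c" for N
  proof
    have "?c \<le> gibbs_mean \<beta> {x} N (\<lambda>M. of_bool (M \<inter> {x} = {x}))" by (rule gibbs_mean_point_lower[OF \<beta>]) simp_all
    also have "(\<lambda>M. of_bool (M \<inter> {x} = {x})) = (\<lambda>M. of_bool (x \<in> M) :: real)" by (auto simp: fun_eq_iff)
    finally show "?c \<le> gibbs_mean \<beta> {x} N (\<lambda>M. of_bool (x \<in> M))" .
    have "?c \<le> gibbs_mean \<beta> {x} N (\<lambda>M. of_bool (M \<inter> {x} = {}))" by (rule gibbs_mean_point_lower[OF \<beta>]) simp_all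
    also have "(\<lambda>M. of_bool (M \<inter> {x} = {})) = (\<lambda>M. 1 - of_bool (x \<in> M) :: real)" by (auto simp: fun_eq_iff)
    finally show "gibbs_mean \<beta> {x} N (\<lambda>M. of_bool (x \<in> M)) \<le> 1 - ?c" by (simp add: gibbs_mean_diff gibbs_mean_const)
  qed
  have "?c \<le> minus_prob \<beta> x \<Delta> s \<and> minus_prob \<beta> x \<Delta> s \<le> 1 - ?c" if \<Delta>: "finite \<Delta>" "s \<subseteq> \<Delta>" "x \<notin> \<Delta>" for \<Delta> s
  proof -
    have bound: "?c \<le> gibbs_mean \<beta> (\<Lambda> - \<Delta>) s (\<lambda>M. of_bool (x \<in> M)) \<and> gibbs_mean \<beta> (\<Lambda> - \<Delta>) s (\<lambda>M. of_bool (x \<in> M)) \<le> 1 - ?c"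
      if \<Lambda>: "finite \<Lambda>" "{x} \<subseteq> \<Lambda>" for \<Lambda>
    proof -
      have fin: "finite (\<Lambda> - \<Delta>)" and sub: "{x} \<subseteq> \<Lambda> - \<Delta>" using \<Lambda> \<Delta>(3) by auto
      have "gibbs_mean \<beta> (\<Lambda> - \<Delta>) s (\<lambda>M. of_bool (x \<in> M)) =
          gibbs_mean \<beta> (\<Lambda> - \<Delta>) s (\<lambda>M. gibbs_mean \<beta> {x} M (\<lambda>M. of_bool (x \<in> M)))"
        by (rule gibbs_mean_consistent[OF fin sub])
      moreover have "?c \<le> gibbs_mean \<beta> (\<Lambda> - \<Delta>) s (\<lambda>M. gibbs_mean \<beta> {x} M (\<lambda>M. of_bool (x \<in> M)))"
        "gibbs_mean \<beta> (\<Lambda> - \<Delta>) s (\<lambda>M. gibbs_mean \<beta> {x} M (\<lambda>M. of_bool (x \<in> M))) \<le> 1 - ?c"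
        by (rule gibbs_mean_bounds[OF fin conjunct1[OF one] conjunct2[OF one]])+
      ultimately show ?thesis by (simp only: simp_thms)
    qed
    have "\<forall>\<^sub>F \<Lambda> in finite_subsets_at_top UNIV. finite \<Lambda> \<and> {x} \<subseteq> \<Lambda> \<and> \<Lambda> \<subseteq> UNIV"
      by (rule eventually_finite_supersets) simp_all
    then have both: "\<forall>\<^sub>F \<Lambda> in finite_subsets_at_top UNIV. ?c \<le> gibbs_mean \<beta> (\<Lambda> - \<Delta>) s (\<lambda>M. of_bool (x \<in> M)) \<and>
        gibbs_mean \<beta> (\<Lambda> - \<Delta>) s (\<lambda>M. of_bool (x \<in> M)) \<le> 1 - ?c"
      by (rule eventually_mono) (rule bound, simp_all)
    note ev = eventually_conj_iff[THEN iffD1, OF both, THEN conjunct1] eventually_conj_iff[THEN iffD1, OF both, THEN conjunct2]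
    show ?thesis
      using tendsto_lowerbound[OF tendsto_minus_prob[OF \<beta> \<Delta>] ev(1) finite_subsets_at_top_neq_bot]
        tendsto_upperbound[OF tendsto_minus_prob[OF \<beta> \<Delta>] ev(2) finite_subsets_at_top_neq_bot] by blast
  qed
  moreover have "0 < ?c" by simp
  ultimately show thesis using that by blast
qed

lemma minus_prob_quasilocal:
  assumes \<beta>: "ln 1024 \<le> \<beta>" and sparse: "sparse_around S j L" and \<epsilon>: "0 < \<epsilon>"
  obtains B where "finite B" "\<And>\<Delta> \<Delta>' s s'. finite \<Delta> \<Longrightarrow> finite \<Delta>' \<Longrightarrow>
     \<Delta> \<subseteq> (S - {j}) \<times> {0} \<Longrightarrow> \<Delta>' \<subseteq> (S - {j}) \<times> {0} \<Longrightarrow>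
     s \<subseteq> \<Delta> \<Longrightarrow> s' \<subseteq> \<Delta>' \<Longrightarrow> \<Delta> \<inter> B = \<Delta>' \<inter> B \<Longrightarrow> s \<inter> B = s' \<inter> B \<Longrightarrow>
     minus_prob \<beta> (j, 0) \<Delta> s \<le> minus_prob \<beta> (j, 0) \<Delta>' s' + \<epsilon>"
proof -
  have \<beta>0: "0 \<le> \<beta>" using \<beta> ln_ge_zero[of 1024] by linarith
  show thesis
  proof (rule finite_volume_quasilocality[OF \<beta> sparse \<epsilon>])
    fix B :: "site set" assume finB: "finite B" and B: "\<And>\<Lambda> \<Lambda>' \<Delta> \<Delta>' s s'. finite \<Lambda> \<Longrightarrow> finite \<Lambda>' \<Longrightarrow> finite \<Delta> \<Longrightarrow> finite \<Delta>' \<Longrightarrow>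
     B \<subseteq> \<Lambda> \<Longrightarrow> B \<subseteq> \<Lambda>' \<Longrightarrow> \<Delta> \<subseteq> (S - {j}) \<times> {0} \<Longrightarrow> \<Delta>' \<subseteq> (S - {j}) \<times> {0} \<Longrightarrow>
     s \<subseteq> \<Delta> \<Longrightarrow> s' \<subseteq> \<Delta>' \<Longrightarrow> \<Delta> \<inter> B = \<Delta>' \<inter> B \<Longrightarrow> s \<inter> B = s' \<inter> B \<Longrightarrow>
     gibbs_mean \<beta> (\<Lambda> - \<Delta>) s (\<lambda>M. of_bool ((j, 0) \<in> M))
       \<le> gibbs_mean \<beta> (\<Lambda>' - \<Delta>') s' (\<lambda>M. of_bool ((j, 0) \<in> M)) + \<epsilon>"
    show thesis
    proof (rule that[OF finB])
      fix \<Delta> \<Delta>' s s' :: "site set"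
      assume a: "finite \<Delta>" "finite \<Delta>'" "\<Delta> \<subseteq> (S - {j}) \<times> {0}" "\<Delta>' \<subseteq> (S - {j}) \<times> {0}"
        "s \<subseteq> \<Delta>" "s' \<subseteq> \<Delta>'" "\<Delta> \<inter> B = \<Delta>' \<inter> B" "s \<inter> B = s' \<inter> B"
      have n: "(j, 0) \<notin> \<Delta>" "(j, 0) \<notin> \<Delta>'" using a(3,4) by auto
      have "\<forall>\<^sub>F \<Lambda> in finite_subsets_at_top UNIV. gibbs_mean \<beta> (\<Lambda> - \<Delta>) s (\<lambda>M. of_bool ((j, 0) \<in> M))
          \<le> gibbs_mean \<beta> (\<Lambda> - \<Delta>') s' (\<lambda>M. of_bool ((j, 0) \<in> M)) + \<epsilon>"
        using eventually_finite_supersets[OF finB subset_UNIV]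
      proof (rule eventually_mono, elim conjE)
        fix \<Lambda> assume "finite \<Lambda>" "B \<subseteq> \<Lambda>"
        then show "gibbs_mean \<beta> (\<Lambda> - \<Delta>) s (\<lambda>M. of_bool ((j, 0) \<in> M))
          \<le> gibbs_mean \<beta> (\<Lambda> - \<Delta>') s' (\<lambda>M. of_bool ((j, 0) \<in> M)) + \<epsilon>" by (intro B a)
      qed
      then show "minus_prob \<beta> (j, 0) \<Delta> s \<le> minus_prob \<beta> (j, 0) \<Delta>' s' + \<epsilon>"
        by (rule tendsto_le[OF finite_subsets_at_top_neq_bot
              tendsto_add[OF tendsto_minus_prob[OF \<beta>0 a(2,6) n(2)] tendsto_const]
              tendsto_minus_prob[OF \<beta>0 a(1,5) n(1)]])
    qed
  qed
qed

lemma local_prob_flip: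
  assumes \<beta>: "0 \<le> \<beta>" and \<Delta>: "finite \<Delta>" "s \<subseteq> \<Delta>" "x \<notin> \<Delta>"
  shows "local_prob \<beta> (insert x \<Delta>) (insert x s) = minus_prob \<beta> x \<Delta> s * local_prob \<beta> \<Delta> s"
    and "local_prob \<beta> (insert x \<Delta>) s = (1 - minus_prob \<beta> x \<Delta> s) * local_prob \<beta> \<Delta> s"
proof -
  have pos: "0 < local_prob \<beta> \<Delta> s" by (rule local_prob_pos[OF \<beta> \<Delta>(1,2)])
  show 1: "local_prob \<beta> (insert x \<Delta>) (insert x s) = minus_prob \<beta> x \<Delta> s * local_prob \<beta> \<Delta> s"
    using pos by (simp add: minus_prob_def)
  have set: "{t. t \<subseteq> insert x \<Delta> \<and> t \<inter> \<Delta> = s} = {s, insert x s}" using \<Delta> by blast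
  have "s \<noteq> insert x s" using \<Delta> by blast
  then have "local_prob \<beta> \<Delta> s = local_prob \<beta> (insert x \<Delta>) s + local_prob \<beta> (insert x \<Delta>) (insert x s)"
    using local_prob_marginal[OF \<beta>, of "insert x \<Delta>" \<Delta> s] \<Delta>(1) unfolding set by (simp add: subset_insertI)
  then show "local_prob \<beta> (insert x \<Delta>) s = (1 - minus_prob \<beta> x \<Delta> s) * local_prob \<beta> \<Delta> s"
    unfolding 1 by (simp add: algebra_simps)
qed

lemma log_odds_close:
  fixes a b c :: real
  assumes c: "0 < c" and a: "c \<le> a" "a \<le> 1 - c" and b: "c \<le> b" "b \<le> 1 - c" and ab: "\<bar>a - b\<bar> \<le> \<epsilon>"
  shows "\<bar>(ln a - ln (1 - a)) - (ln b - ln (1 - b))\<bar> \<le> 2 * (\<epsilon> / c)"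
proof -
  have *: "ln u - ln v \<le> \<epsilon> / c" if "c \<le> u" "c \<le> v" "\<bar>u - v\<bar> \<le> \<epsilon>" for u v
  proof -
    have "ln u - ln v = ln (u / v)" using that c by (simp add: ln_div)
    also have "\<dots> \<le> u / v - 1" using that c by (intro ln_le_minus_one) simp
    also have "\<dots> = (u - v) / v" using that c by (simp add: diff_divide_distrib)
    also have "\<dots> \<le> \<epsilon> / c" using that c by (intro frac_le) auto
    finally show ?thesis .
  qed
  have "ln a - ln b \<le> \<epsilon> / c" "ln b - ln a \<le> \<epsilon> / c" using *[of a b] *[of b a] a b ab by auto
  moreover have "ln (1 - a) - ln (1 - b) \<le> \<epsilon> / c" "ln (1 - b) - ln (1 - a) \<le> \<epsilon> / c"
    using *[of "1 - a" "1 - b"] *[of "1 - b" "1 - a"] a b ab by auto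
  ultimately show ?thesis by linarith
qed

text \<open>
  Completeness of uniform convergence, along the net of finite subsets of a countable set.
\<close>

lemma uniform_limit_if_Cauchy:
  fixes R :: "'a set \<Rightarrow> 'b \<Rightarrow> real"
  assumes S: "countable S"
    and Cauchy: "\<And>\<epsilon>. 0 < \<epsilon> \<Longrightarrow> \<exists>\<Delta>0. finite \<Delta>0 \<and> \<Delta>0 \<subseteq> S \<and> (\<forall>\<Delta> \<Delta>'. finite \<Delta> \<and> \<Delta>0 \<subseteq> \<Delta> \<and> \<Delta> \<subseteq> S \<and>
        finite \<Delta>' \<and> \<Delta>0 \<subseteq> \<Delta>' \<and> \<Delta>' \<subseteq> S \<longrightarrow> (\<forall>\<omega>\<in>X. \<bar>R \<Delta> \<omega> - R \<Delta>' \<omega>\<bar> \<le> \<epsilon>))"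
  shows "\<exists>L. uniform_limit X R L (finite_subsets_at_top S)"
proof -
  obtain D where D: "\<And>n. finite (D n)" "\<And>n. D n \<subseteq> S" "filterlim D (finite_subsets_at_top S) sequentially"
    using exhausting_finite_sets[OF S] by metis
  have ev: "\<forall>\<^sub>F n in sequentially. \<Delta>0 \<subseteq> D n" if "finite \<Delta>0" "\<Delta>0 \<subseteq> S" for \<Delta>0
    using D(3) that unfolding filterlim_finite_subsets_at_top by (auto elim!: eventually_mono)
  have conv: "convergent (\<lambda>n. R (D n) \<omega>)" if \<omega>: "\<omega> \<in> X" for \<omega>
  proof (rule Cauchy_convergent, rule metric_CauchyI)
    fix e :: real assume e: "0 < e"
    then have "0 < e / 2" by simp
    from Cauchy[OF this] obtain \<Delta>0 where \<Delta>0: "finite \<Delta>0" "\<Delta>0 \<subseteq> S"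
      "\<forall>\<Delta> \<Delta>'. finite \<Delta> \<and> \<Delta>0 \<subseteq> \<Delta> \<and> \<Delta> \<subseteq> S \<and> finite \<Delta>' \<and> \<Delta>0 \<subseteq> \<Delta>' \<and> \<Delta>' \<subseteq> S \<longrightarrow> (\<forall>\<omega>\<in>X. \<bar>R \<Delta> \<omega> - R \<Delta>' \<omega>\<bar> \<le> e / 2)"
      by (elim exE conjE)
    obtain N where N: "\<And>n. N \<le> n \<Longrightarrow> \<Delta>0 \<subseteq> D n" using ev[OF \<Delta>0(1,2)] by (auto simp: eventually_sequentially)
    have "dist (R (D m) \<omega>) (R (D n) \<omega>) < e" if "N \<le> m" "N \<le> n" for m n
    proof -
      have "\<bar>R (D m) \<omega> - R (D n) \<omega>\<bar> \<le> e / 2"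
        using \<Delta>0(3)[rule_format, OF _ \<omega>, of "D m" "D n"] D(1,2) N that by simp
      then show ?thesis using e by (simp add: dist_real_def)
    qed
    then show "\<exists>M. \<forall>m\<ge>M. \<forall>n\<ge>M. dist (R (D m) \<omega>) (R (D n) \<omega>) < e" by blast
  qed
  define L where "L \<omega> = lim (\<lambda>n. R (D n) \<omega>)" for \<omega>
  have lim: "(\<lambda>n. R (D n) \<omega>) \<longlonglongrightarrow> L \<omega>" if "\<omega> \<in> X" for \<omega>
    unfolding L_def using conv[OF that] by (simp add: convergent_LIMSEQ_iff)
  have "uniform_limit X R L (finite_subsets_at_top S)"
    unfolding uniform_limit_iff
  proof (intro allI impI)
    fix e :: real assume e: "0 < e"
    then have "0 < e / 2" by simp
    from Cauchy[OF this] obtain \<Delta>0 where \<Delta>0: "finite \<Delta>0" "\<Delta>0 \<subseteq> S"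
      "\<forall>\<Delta> \<Delta>'. finite \<Delta> \<and> \<Delta>0 \<subseteq> \<Delta> \<and> \<Delta> \<subseteq> S \<and> finite \<Delta>' \<and> \<Delta>0 \<subseteq> \<Delta>' \<and> \<Delta>' \<subseteq> S \<longrightarrow> (\<forall>\<omega>\<in>X. \<bar>R \<Delta> \<omega> - R \<Delta>' \<omega>\<bar> \<le> e / 2)"
      by (elim exE conjE)
    show "\<forall>\<^sub>F \<Delta> in finite_subsets_at_top S. \<forall>\<omega>\<in>X. dist (R \<Delta> \<omega>) (L \<omega>) < e"
      using eventually_finite_supersets[OF \<Delta>0(1,2)]
    proof (rule eventually_mono, intro ballI)
      fix \<Delta> \<omega> assume \<Delta>: "finite \<Delta> \<and> \<Delta>0 \<subseteq> \<Delta> \<and> \<Delta> \<subseteq> S" and \<omega>: "\<omega> \<in> X"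
      have "\<bar>R \<Delta> \<omega> - L \<omega>\<bar> \<le> e / 2"
      proof (rule tendsto_upperbound)
        show "(\<lambda>n. \<bar>R \<Delta> \<omega> - R (D n) \<omega>\<bar>) \<longlonglongrightarrow> \<bar>R \<Delta> \<omega> - L \<omega>\<bar>"
          by (intro tendsto_rabs tendsto_diff tendsto_const lim[OF \<omega>])
        show "\<forall>\<^sub>F n in sequentially. \<bar>R \<Delta> \<omega> - R (D n) \<omega>\<bar> \<le> e / 2"
          using ev[OF \<Delta>0(1,2)]
        proof (rule eventually_mono)
          fix n assume "\<Delta>0 \<subseteq> D n"
          then show "\<bar>R \<Delta> \<omega> - R (D n) \<omega>\<bar> \<le> e / 2"
            using \<Delta>0(3)[rule_format, OF _ \<omega>, of \<Delta> "D n"] D(1,2) \<Delta> by simp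
        qed
      qed simp
      then show "dist (R \<Delta> \<omega>) (L \<omega>) < e" using e by (simp add: dist_real_def)
    qed
  qed
  then show ?thesis by (rule exI[of _ L])
qed

definition line_minus :: "int set \<Rightarrow> (int \<Rightarrow> real) \<Rightarrow> site set" where
  "line_minus \<Delta> \<omega> = {i \<in> \<Delta>. \<omega> i = - 1} \<times> {0}"

lemma decimated_measurable:
  assumes \<beta>: "0 \<le> \<beta>"
  shows "(\<lambda>\<sigma>. \<lambda>i\<in>S. \<sigma> (i, 0)) \<in> measurable (plus_phase \<beta>) (config_space S)"
  unfolding config_space_def
proof (rule measurable_restrict)
  fix i assume "i \<in> S"
  show "(\<lambda>\<sigma>. \<sigma> (i, 0)) \<in> measurable (plus_phase \<beta>) (count_space spins)"
    unfolding measurable_cong_sets[OF plus_phase_properties(2)[OF \<beta>] refl] config_space_def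
    by (rule measurable_component_singleton) simp
qed

lemma decimated_cylinder:
  assumes \<beta>: "0 \<le> \<beta>" and \<Delta>: "finite \<Delta>" "\<Delta> \<subseteq> occupied n" and \<omega>: "\<omega> \<in> configs (occupied n)"
  shows "measure (decimated_plus_phase \<beta> n) (cylinder (occupied n) \<Delta> \<omega>) = local_prob \<beta> (\<Delta> \<times> {0}) (line_minus \<Delta> \<omega>)"
proof -
  let ?S = "occupied n" and ?f = "\<lambda>\<sigma> :: site \<Rightarrow> real. \<lambda>i\<in>occupied n. \<sigma> (i, 0)"
  have space: "space (plus_phase \<beta>) = configs UNIV"
    using sets_eq_imp_space_eq[OF plus_phase_properties(2)[OF \<beta>]] by (simp add: space_config_space)
  have \<omega>s: "\<omega> i = spin (line_minus \<Delta> \<omega>) (i, 0)" if "i \<in> \<Delta>" for i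
    using PiE_mem[OF \<omega>, of i] that \<Delta>(2) by (auto simp: spin_def line_minus_def)
  have "?f -` cylinder ?S \<Delta> \<omega> \<inter> space (plus_phase \<beta>) = cylinder UNIV (\<Delta> \<times> {0}) (spin (line_minus \<Delta> \<omega>))"
    unfolding space
  proof (intro set_eqI iffI)
    fix \<sigma> assume \<sigma>: "\<sigma> \<in> ?f -` cylinder ?S \<Delta> \<omega> \<inter> configs UNIV"
    have "\<sigma> (i, 0) = \<omega> i" if "i \<in> \<Delta>" for i using \<sigma> that \<Delta>(2) by (force simp: cylinder_def)
    then show "\<sigma> \<in> cylinder UNIV (\<Delta> \<times> {0}) (spin (line_minus \<Delta> \<omega>))"
      using \<sigma> \<omega>s by (auto simp: cylinder_def)
  next
    fix \<sigma> assume \<sigma>: "\<sigma> \<in> cylinder UNIV (\<Delta> \<times> {0}) (spin (line_minus \<Delta> \<omega>))"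
    then have \<sigma>c: "\<sigma> \<in> configs UNIV" by (simp add: cylinder_def)
    have "?f \<sigma> \<in> configs ?S"
    proof (rule PiE_I)
      fix i assume "i \<in> ?S"
      then show "?f \<sigma> i \<in> spins" using PiE_mem[OF \<sigma>c, of "(i, 0)"] by simp
    qed simp
    moreover have "?f \<sigma> i = \<omega> i" if "i \<in> \<Delta>" for i
    proof -
      have "\<sigma> (i, 0) = spin (line_minus \<Delta> \<omega>) (i, 0)" using \<sigma> that by (simp add: cylinder_def)
      then show ?thesis using \<omega>s[OF that] that \<Delta>(2) by auto
    qed
    ultimately show "\<sigma> \<in> ?f -` cylinder ?S \<Delta> \<omega> \<inter> configs UNIV" using \<sigma>c by (simp add: cylinder_def)
  qed
  then have "measure (decimated_plus_phase \<beta> n) (cylinder ?S \<Delta> \<omega>)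
      = measure (plus_phase \<beta>) (cylinder UNIV (\<Delta> \<times> {0}) (spin (line_minus \<Delta> \<omega>)))"
    unfolding decimated_plus_phase_def
    by (subst measure_distr[OF decimated_measurable[OF \<beta>] cylinder_measurable[OF \<Delta>]]) simp
  also have "\<dots> = local_prob \<beta> (\<Delta> \<times> {0}) (line_minus \<Delta> \<omega>)"
    by (rule plus_phase_properties(3)[OF \<beta>]) (use \<Delta>(1) in \<open>auto simp: line_minus_def\<close>)
  finally show ?thesis .
qed

text \<open>
  In the flip ratio at \<open>j\<close> the common factor, the probability of the other spins, cancels. What remains are the log-odds of a minus spin, and
  these inherit uniform convergence from the conditional probabilities, which are bounded away from 0 and 1.
\<close>

theorem sparse_decimation_is_gibbs:
  assumes \<beta>: "ln 1024 \<le> \<beta>" and sparse: "\<And>j. \<exists>L. sparse_around (occupied n) j L"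
  shows "is_gibbs_measure (occupied n) (decimated_plus_phase \<beta> n)"
proof -
  let ?S = "occupied n" and ?\<nu> = "decimated_plus_phase \<beta> n"
  let ?p = "\<lambda>\<Delta> \<omega>. measure ?\<nu> (cylinder ?S \<Delta> \<omega>)"
  have \<beta>0: "0 \<le> \<beta>" using \<beta> ln_ge_zero[of 1024] by linarith
  have S: "countable ?S" by simp
  have "prob_space ?\<nu>" unfolding decimated_plus_phase_def
    by (rule prob_space.prob_space_distr[OF plus_phase_properties(1)[OF \<beta>0] decimated_measurable[OF \<beta>0]])
  moreover have "sets ?\<nu> = sets (config_space ?S)" by (simp add: decimated_plus_phase_def)
  moreover have "0 < ?p \<Delta> \<omega>" if "finite \<Delta>" "\<Delta> \<subseteq> ?S" "\<omega> \<in> configs ?S" for \<Delta> \<omega>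
    unfolding decimated_cylinder[OF \<beta>0 that]
    by (rule local_prob_pos[OF \<beta>0]) (use that in \<open>auto simp: line_minus_def\<close>)
  moreover have "\<exists>L. uniform_limit (configs ?S) (\<lambda>\<Delta> \<omega>. ln (?p \<Delta> \<omega>) - ln (?p \<Delta> ((\<omega>)(j := 1)))) L (finite_subsets_at_top ?S)"
    if j: "j \<in> ?S" for j
  proof (rule uniform_limit_if_Cauchy[OF S])
    fix \<epsilon> :: real assume \<epsilon>: "0 < \<epsilon>"
    obtain L where L: "sparse_around ?S j L" using sparse by blast
    show "\<exists>\<Delta>0. finite \<Delta>0 \<and> \<Delta>0 \<subseteq> ?S \<and> (\<forall>\<Delta> \<Delta>'. finite \<Delta> \<and> \<Delta>0 \<subseteq> \<Delta> \<and> \<Delta> \<subseteq> ?S \<and>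
        finite \<Delta>' \<and> \<Delta>0 \<subseteq> \<Delta>' \<and> \<Delta>' \<subseteq> ?S \<longrightarrow> (\<forall>\<omega>\<in>configs ?S.
          \<bar>(ln (?p \<Delta> \<omega>) - ln (?p \<Delta> ((\<omega>)(j := 1)))) - (ln (?p \<Delta>' \<omega>) - ln (?p \<Delta>' ((\<omega>)(j := 1))))\<bar> \<le> \<epsilon>))"
    proof (rule minus_prob_bounds[OF \<beta>0, of "(j, 0)"])
      fix c assume c: "0 < c" "\<And>\<Delta> s. finite \<Delta> \<Longrightarrow> s \<subseteq> \<Delta> \<Longrightarrow> (j, 0) \<notin> \<Delta> \<Longrightarrow>
          c \<le> minus_prob \<beta> (j, 0) \<Delta> s \<and> minus_prob \<beta> (j, 0) \<Delta> s \<le> 1 - c"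
      have \<epsilon>c: "0 < \<epsilon> * c / 2" using \<epsilon> c(1) by simp
      show ?thesis
      proof (rule minus_prob_quasilocal[OF \<beta> L \<epsilon>c])
        fix B :: "site set" assume B: "finite B" "\<And>\<Delta> \<Delta>' s s'. finite \<Delta> \<Longrightarrow> finite \<Delta>' \<Longrightarrow>
           \<Delta> \<subseteq> (?S - {j}) \<times> {0} \<Longrightarrow> \<Delta>' \<subseteq> (?S - {j}) \<times> {0} \<Longrightarrow>
           s \<subseteq> \<Delta> \<Longrightarrow> s' \<subseteq> \<Delta>' \<Longrightarrow> \<Delta> \<inter> B = \<Delta>' \<inter> B \<Longrightarrow> s \<inter> B = s' \<inter> B \<Longrightarrow>
           minus_prob \<beta> (j, 0) \<Delta> s \<le> minus_prob \<beta> (j, 0) \<Delta>' s' + \<epsilon> * c / 2"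
        \<comment> \<open>Sets that contain all occupied columns of \<open>B\<close> have the same trace on \<open>B\<close>.\<close>
        let ?\<Delta>0 = "insert j (?S \<inter> fst ` B)"
        let ?q = "\<lambda>\<Delta> \<omega>. minus_prob \<beta> (j, 0) ((\<Delta> - {j}) \<times> {0}) (line_minus (\<Delta> - {j}) \<omega>)"
        have flip: "ln (?p \<Delta> \<omega>) - ln (?p \<Delta> ((\<omega>)(j := 1))) = (if \<omega> j = 1 then 0 else ln (?q \<Delta> \<omega>) - ln (1 - ?q \<Delta> \<omega>))"
          if \<Delta>: "finite \<Delta>" "j \<in> \<Delta>" "\<Delta> \<subseteq> ?S" and \<omega>: "\<omega> \<in> configs ?S" for \<Delta> \<omega>
        proof (cases "\<omega> j = 1")
          case True
          then have "(\<omega>)(j := 1) = \<omega>" by auto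
          then show ?thesis using True by simp
        next
          case False
          then have m: "\<omega> j = - 1" using PiE_mem[OF \<omega> j] by auto
          have \<omega>1: "(\<omega>)(j := 1) \<in> configs ?S" using \<omega> j by (auto simp: PiE_iff extensional_def)
          let ?D = "(\<Delta> - {j}) \<times> {0 :: int}" and ?s = "line_minus (\<Delta> - {j}) \<omega>"
          have D: "finite ?D" "?s \<subseteq> ?D" "(j, 0) \<notin> ?D" using \<Delta>(1) by (auto simp: line_minus_def)
          have eqs: "\<Delta> \<times> {0} = insert (j, 0) ?D" "line_minus \<Delta> \<omega> = insert (j, 0) ?s" "line_minus \<Delta> ((\<omega>)(j := 1)) = ?s"
            using \<Delta>(2) m by (auto simp: line_minus_def)
          have p: "?p \<Delta> \<omega> = ?q \<Delta> \<omega> * local_prob \<beta> ?D ?s" "?p \<Delta> ((\<omega>)(j := 1)) = (1 - ?q \<Delta> \<omega>) * local_prob \<beta> ?D ?s"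
            unfolding decimated_cylinder[OF \<beta>0 \<Delta>(1,3) \<omega>] decimated_cylinder[OF \<beta>0 \<Delta>(1,3) \<omega>1] eqs
            by (rule local_prob_flip[OF \<beta>0 D])+
          have "0 < local_prob \<beta> ?D ?s" by (rule local_prob_pos[OF \<beta>0 D(1,2)])
          moreover have "0 < ?q \<Delta> \<omega>" "0 < 1 - ?q \<Delta> \<omega>" using c(1) c(2)[OF D] by linarith+
          ultimately show ?thesis unfolding p using False by (simp add: ln_mult)
        qed
        show ?thesis
        proof (intro exI[of _ ?\<Delta>0] conjI allI impI ballI)
          fix \<Delta> \<Delta>' \<omega> assume a: "finite \<Delta> \<and> ?\<Delta>0 \<subseteq> \<Delta> \<and> \<Delta> \<subseteq> ?S \<and> finite \<Delta>' \<and> ?\<Delta>0 \<subseteq> \<Delta>' \<and> \<Delta>' \<subseteq> ?S"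
            and \<omega>: "\<omega> \<in> configs ?S"
          let ?D = "(\<Delta> - {j}) \<times> {0 :: int}" and ?s = "line_minus (\<Delta> - {j}) \<omega>"
          let ?D' = "(\<Delta>' - {j}) \<times> {0 :: int}" and ?s' = "line_minus (\<Delta>' - {j}) \<omega>"
          have D: "finite ?D" "?s \<subseteq> ?D" "(j, 0) \<notin> ?D" "?D \<subseteq> (?S - {j}) \<times> {0}"
            and D': "finite ?D'" "?s' \<subseteq> ?D'" "(j, 0) \<notin> ?D'" "?D' \<subseteq> (?S - {j}) \<times> {0}"
            using a by (auto simp: line_minus_def)
          have in_iff: "i \<in> \<Delta> \<longleftrightarrow> i \<in> \<Delta>'" if "(i, k) \<in> B" for i k
          proof -
            have "i \<in> fst ` B" using that by force
            then show ?thesis using a by blast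
          qed
          have DB: "?D \<inter> B = ?D' \<inter> B" and sB: "?s \<inter> B = ?s' \<inter> B"
            using in_iff by (auto simp: line_minus_def)
          have "?q \<Delta> \<omega> \<le> ?q \<Delta>' \<omega> + \<epsilon> * c / 2"
            by (rule B(2)[OF D(1) D'(1) D(4) D'(4) D(2) D'(2) DB sB])
          moreover have "?q \<Delta>' \<omega> \<le> ?q \<Delta> \<omega> + \<epsilon> * c / 2"
            by (rule B(2)[OF D'(1) D(1) D'(4) D(4) D'(2) D(2) DB[symmetric] sB[symmetric]])
          ultimately have "\<bar>?q \<Delta> \<omega> - ?q \<Delta>' \<omega>\<bar> \<le> \<epsilon> * c / 2" by linarith
          from log_odds_close[OF c(1) _ _ _ _ this] c(2)[OF D(1-3)] c(2)[OF D'(1-3)]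
          have "\<bar>(ln (?q \<Delta> \<omega>) - ln (1 - ?q \<Delta> \<omega>)) - (ln (?q \<Delta>' \<omega>) - ln (1 - ?q \<Delta>' \<omega>))\<bar> \<le> \<epsilon>"
            using c(1) by simp
          moreover have "finite \<Delta>" "j \<in> \<Delta>" "\<Delta> \<subseteq> ?S" "finite \<Delta>'" "j \<in> \<Delta>'" "\<Delta>' \<subseteq> ?S" using a by auto
          ultimately show "\<bar>(ln (?p \<Delta> \<omega>) - ln (?p \<Delta> ((\<omega>)(j := 1)))) - (ln (?p \<Delta>' \<omega>) - ln (?p \<Delta>' ((\<omega>)(j := 1))))\<bar> \<le> \<epsilon>"
            using \<epsilon> \<omega> by (simp only: flip) simp
        qed (use B(1) j in auto)
      qed
    qed
  qed
  ultimately show ?thesis by (rule quasilocal_implies_gibbs[OF S])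
qed

text \<open>
  The constant \<open>2 ^ 48\<close> is \<open>8 ^ 16\<close>: in an interval of \<open>l\<close> sites, any given \<open>l / 16\<close> of them are to be
  all occupied with probability below \<open>8 ^ (- l)\<close>, as required in \<open>crowded_prob\<close>. The constant 1024
  makes up for \<open>512 ^ n\<close> contours and leaves \<open>2 ^ (- n)\<close>.
\<close>

theorem theorem4p3:
  "\<exists>p0 > (0::real). \<exists>\<beta>0 :: real. \<forall>\<beta> \<ge> \<beta>0. \<forall>p. 0 \<le> p \<and> p < p0 \<longrightarrow>
     (AE n in iid_bernoulli p. is_gibbs_measure (occupied n) (decimated_plus_phase \<beta> n))"
proof (rule exI[of _ "1 / 2 ^ 48"], rule conjI)
  show "\<exists>\<beta>0 :: real. \<forall>\<beta> \<ge> \<beta>0. \<forall>p. 0 \<le> p \<and> p < 1 / 2 ^ 48 \<longrightarrow>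
     (AE n in iid_bernoulli p. is_gibbs_measure (occupied n) (decimated_plus_phase \<beta> n))"
  proof (rule exI[of _ "ln 1024"], intro allI impI)
    fix \<beta> p :: real assume \<beta>: "ln 1024 \<le> \<beta>" and p: "0 \<le> p \<and> p < 1 / 2 ^ 48"
    have "AE n in iid_bernoulli p. \<forall>j. \<exists>L. sparse_around (occupied n) j L"
      by (rule almost_surely_sparse) (use p in auto)
    then show "AE n in iid_bernoulli p. is_gibbs_measure (occupied n) (decimated_plus_phase \<beta> n)"
      by (rule AE_mp) (intro AE_I2 impI sparse_decimation_is_gibbs[OF \<beta>], blast)
  qed
qed simp

end
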